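(* Let $K$ be a field with a Henselian valuation, and let $D$ be a tame $K$-central division algebra (finite-dimensional over $K$). Then either $(1+M_D)\cap \mathbf{G}\subseteq D'$, or $\mathrm{char}(\overline{K})=p>0$ and the group $\mathbf{H}=((1+M_D)\cap\mathbf{G})D'/D'$ is a $p$-group.
   Context: A valuation $v$ on a field $K$ is Henselian if it extends uniquely to every finite field extension of $K$. Let $D$ be a finite-dimensional division algebra with center $K$ (a $K$-central division algebra). Then a Henselian valuation $v$ on $K$ extends uniquely to a valuation, again denoted $v$, on $D$. Notation: $V_D$ and $V_K$ are the valuation rings of $v$ on $D$ and $K$; $M_D$ and $M_K$ are their maximal ideals; $\overline{D}=V_D/M_D$ and $\overline{K}=V_K/M_K$ are the residue division algebra and residue field; $Z(\overline{D})$ is the center of $\overline{D}$; the index is $\mathrm{ind}(D)=\sqrt{[D:K]}$ (and $\mathrm{ind}(\overline{D})=\sqrt{[\overline{D}:Z(\overline{D})]}$). $D$ is tame if $Z(\overline{D})$ is separable over $\overline{K}$ and $\mathrm{char}(\overline{K})$ does not divide $\mathrm{ind}(D)/(\mathrm{ind}(\overline{D})\,[Z(\overline{D}):\overline{K}])$. $D^*=D\setminus\{0\}$ is the multiplicative group and $D'=[D^*,D^*]$ its derived (commutator) subgroup. The Whitehead group is $\mathrm{K}_1(D)=D^*/D'$, and $\mathrm{TK}_1(D)$ is its torsion subgroup. $\mathbf{G}$ is the subgroup of $D^*$ containing $D'$ with $\mathrm{TK}_1(D)=\mathbf{G}/D'$, i.e. $\mathbf{G}=\{x\in D^*: x^k\in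 D' \text{ for some integer } k\ge 1\}$. A $p$-group is a (possibly infinite) group in which every element has order a power of $p$. *)

theory Defs
  imports "HOL-Algebra.Algebra" "HOL-Library.Discrete_Functions"
begin

section \<open>The divisible hull of an ordered abelian group\<close>

definition nscale :: "nat \<Rightarrow> 'g \<Rightarrow> 'g::linordered_ab_group_add"
  where "nscale n a = (\<Sum>i<n. a)"

lemma nscale_0 [simp]: "nscale 0 a = 0"
  and nscale_Suc: "nscale (Suc n) a = a + nscale n a"
  and nscale_1 [simp]: "nscale (Suc 0) a = a"
  and nscale_zero [simp]: "nscale n 0 = 0"
  by (simp_all add: nscale_def add.commute)

lemma nscale_add: "nscale n (a + b) = nscale n a + nscale n b"
  by (simp add: nscale_def sum.distrib)

lemma nscale_minus: "nscale n (- a) = - nscale n a"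
  by (simp add: nscale_def sum_negf)

lemma nscale_plus: "nscale (m + n) a = nscale m a + nscale n a"
  by (induction m) (simp_all add: nscale_Suc add.assoc)

lemma nscale_nscale: "nscale m (nscale n a) = nscale (m * n) a"
  by (induction m) (simp_all add: nscale_Suc nscale_plus)

lemma nscale_less: "n > 0 \<Longrightarrow> a < b \<Longrightarrow> nscale n a < nscale n b"
  unfolding nscale_def by (rule sum_strict_mono) auto

lemma nscale_le_iff: "n > 0 \<Longrightarrow> nscale n a \<le> nscale n b \<longleftrightarrow> a \<le> b"
  by (metis nscale_less leD leI order_le_less)

lemma nscale_eq_iff: "n > 0 \<Longrightarrow> nscale n a = nscale n b \<longleftrightarrow> a = b"
  by (metis nscale_le_iff order_antisym order_refl)

text \<open>A pair \<open>(a, n)\<close> with \<open>n > 0\<close> stands for the fraction \<open>a / n\<close>.\<close>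

definition hull_rel :: "'g::linordered_ab_group_add \<times> nat \<Rightarrow> 'g \<times> nat \<Rightarrow> bool"
  where "hull_rel x y \<longleftrightarrow>
    snd x > 0 \<and> snd y > 0 \<and> nscale (snd y) (fst x) = nscale (snd x) (fst y)"

lemma hull_rel_iff [simp]:
  "hull_rel (a, m) (b, n) \<longleftrightarrow> m > 0 \<and> n > 0 \<and> nscale n a = nscale m b"
  by (simp add: hull_rel_def)

lemma hull_rel_part_equivp: "part_equivp hull_rel"
proof (rule part_equivpI)
  show "\<exists>x :: 'a \<times> nat. hull_rel x x"
    by (rule exI [of _ "(0, 1)"]) simp
  show "symp (hull_rel :: 'a \<times> nat \<Rightarrow> _)"
    by (auto simp: symp_def)
  show "transp (hull_rel :: 'a \<times> nat \<Rightarrow> _)"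
  proof (rule transpI, clarsimp)
    fix a b c :: 'a and k m n :: nat
    assume h: "m > 0" "nscale m a = nscale k b" "nscale n b = nscale m c"
    have "nscale m (nscale n a) = nscale n (nscale m a)"
      by (simp add: nscale_nscale mult.commute)
    also have "\<dots> = nscale k (nscale n b)"
      by (simp add: h(2) nscale_nscale mult.commute)
    also have "\<dots> = nscale m (nscale k c)"
      by (simp add: h(3) nscale_nscale mult.commute)
    finally show "nscale n a = nscale k c"
      using h(1) by (simp add: nscale_eq_iff)
  qed
qed

quotient_type (overloaded) 'g divisible_hull = "'g::linordered_ab_group_add \<times> nat" /
  partial: hull_rel
  by (rule hull_rel_part_equivp)

lemma hull_le_aux:
  fixes a a' b b' :: "'g::linordered_ab_group_add"
  assumes "m > 0" "m' > 0" "n > 0" "n' > 0"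
    and "nscale m' a = nscale m a'" "nscale n' b = nscale n b'"
  shows "nscale n a \<le> nscale m b \<longleftrightarrow> nscale n' a' \<le> nscale m' b'"
proof -
  have "nscale n a \<le> nscale m b \<longleftrightarrow>
      nscale (m' * n') (nscale n a) \<le> nscale (m' * n') (nscale m b)"
    using assms by (simp add: nscale_le_iff)
  also have "nscale (m' * n') (nscale n a) = nscale (n' * n) (nscale m' a)"
    by (simp add: nscale_nscale mult_ac)
  also have "\<dots> = nscale (m * n) (nscale n' a')"
    by (simp add: assms nscale_nscale mult_ac)
  also have "nscale (m' * n') (nscale m b) = nscale (m' * m) (nscale n' b)"
    by (simp add: nscale_nscale mult_ac)
  also have "\<dots> = nscale (m * n) (nscale m' b')"
    by (simp add: assms nscale_nscale mult_ac)
  also have "nscale (m * n) (nscale n' a') \<le> nscale (m * n) (nscale m' b') \<longleftrightarrow>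
      nscale n' a' \<le> nscale m' b'"
    using assms by (simp add: nscale_le_iff)
  finally show ?thesis .
qed

instantiation divisible_hull :: (linordered_ab_group_add) linordered_ab_group_add
begin

lift_definition zero_divisible_hull :: "'a divisible_hull" is "(0, 1)"
  by simp

lift_definition plus_divisible_hull :: "'a divisible_hull \<Rightarrow> 'a divisible_hull \<Rightarrow> 'a divisible_hull"
  is "\<lambda>(a, m) (b, n). (nscale n a + nscale m b, m * n)"
proof (clarsimp simp: nscale_add nscale_nscale)
  fix a b c d :: 'a and k m n l :: nat
  assume "nscale k a = nscale m b" "nscale l c = nscale n d"
  then have "nscale (n * l) (nscale k a) = nscale (n * l) (nscale m b)"
    "nscale (m * k) (nscale l c) = nscale (m * k) (nscale n d)" by simp_all
  then show "nscale (k * l * n) a + nscale (k * l * m) c =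
      nscale (m * n * l) b + nscale (m * n * k) d"
    by (simp add: nscale_nscale mult_ac)
qed

lift_definition uminus_divisible_hull :: "'a divisible_hull \<Rightarrow> 'a divisible_hull"
  is "\<lambda>(a, m). (- a, m)"
  by (clarsimp simp: nscale_minus)

definition minus_divisible_hull :: "'a divisible_hull \<Rightarrow> 'a divisible_hull \<Rightarrow> 'a divisible_hull"
  where "minus_divisible_hull x y = x + - y"

lift_definition less_eq_divisible_hull :: "'a divisible_hull \<Rightarrow> 'a divisible_hull \<Rightarrow> bool"
  is "\<lambda>(a, m) (b, n). nscale n a \<le> nscale m b"
  by clarsimp (rule hull_le_aux)

definition less_divisible_hull :: "'a divisible_hull \<Rightarrow> 'a divisible_hull \<Rightarrow> bool"
  where "less_divisible_hull x y \<longleftrightarrow> x \<le> y \<and> \<not> y \<le> x"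

instance
proof
  fix x y z :: "'a divisible_hull"
  show "x + y + z = x + (y + z)"
    by transfer (clarsimp simp: nscale_add nscale_nscale mult_ac add_ac)
  show "x + y = y + x"
    by transfer (clarsimp simp: mult_ac add_ac)
  show "0 + x = x"
    by transfer clarsimp
  show "- x + x = 0"
    by transfer (clarsimp simp: nscale_minus)
  show "x - y = x + - y"
    by (rule minus_divisible_hull_def)
  show "x < y \<longleftrightarrow> x \<le> y \<and> \<not> y \<le> x"
    by (rule less_divisible_hull_def)
  show "x \<le> x"
    by transfer clarsimp
  show "x \<le> y \<or> y \<le> x"
    by transfer (clarsimp, meson linear)
  show "x \<le> y \<Longrightarrow> y \<le> x \<Longrightarrow> x = y"
    by transfer clarsimp
  show "x \<le> z" if "x \<le> y" "y \<le> z"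
    using that
  proof (transfer, clarsimp)
    fix a b c :: 'a and k m n :: nat
    assume h: "k > 0" "m > 0" "n > 0" "nscale m a \<le> nscale k b" "nscale n b \<le> nscale m c"
    have "nscale n (nscale m a) \<le> nscale n (nscale k b)"
      using h by (simp add: nscale_le_iff)
    also have "\<dots> = nscale k (nscale n b)"
      by (simp add: nscale_nscale mult.commute)
    also have "\<dots> \<le> nscale k (nscale m c)"
      using h by (simp add: nscale_le_iff)
    finally have "nscale m (nscale n a) \<le> nscale m (nscale k c)"
      by (simp add: nscale_nscale mult.commute)
    then show "nscale n a \<le> nscale k c"
      using h by (simp add: nscale_le_iff)
  qed
  show "z + x \<le> z + y" if "x \<le> y"
    using that
  proof (transfer, clarsimp simp: nscale_add nscale_nscale)
    fix a b c :: 'a and k m n :: nat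
    assume h: "k > 0" "m > 0" "n > 0" "nscale n a \<le> nscale m b"
    have "nscale (k * k) (nscale n a) \<le> nscale (k * k) (nscale m b)"
      using h by (simp add: nscale_le_iff)
    then show "nscale (k * n * m) c + nscale (k * n * k) a
        \<le> nscale (k * m * n) c + nscale (k * m * k) b"
      by (simp add: nscale_nscale mult_ac)
  qed
qed

end

lift_definition hull_of :: "'g::linordered_ab_group_add \<Rightarrow> 'g divisible_hull"
  is "\<lambda>a. (a, 1)"
  by simp

lemma hull_of_add: "hull_of (a + b) = hull_of a + hull_of b"
  by transfer simp

lemma hull_of_le_iff: "hull_of a \<le> hull_of b \<longleftrightarrow> a \<le> b"
  by transfer simp

lemma divisible_hull_divisible:
  assumes "n > 0"
  shows "\<exists>y. nscale n y = (x :: 'g::linordered_ab_group_add divisible_hull)"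
proof -
  define q where "q = (\<lambda>(a :: 'g) m. abs_divisible_hull (a, m))"
  have eq: "q a m = q b k \<longleftrightarrow> nscale k a = nscale m b" if "m > 0" "k > 0" for a b m k
    using that Quotient_rel [OF Quotient_divisible_hull, of "(a, m)" "(b, k)"]
    by (simp add: q_def)
  have add: "q a m + q b k = q (nscale k a + nscale m b) (m * k)" if "m > 0" "k > 0" for a b m k
    using that by (simp add: q_def plus_divisible_hull.abs_eq eq_onp_def)
  have zero: "0 = q 0 1"
    by (simp add: q_def zero_divisible_hull_def)
  have mul: "nscale k (q a m) = q (nscale k a) m" if "m > 0" for k a m
  proof (induction k)
    case 0
    show ?case using that by (simp add: zero eq)
  next
    case (Suc k)
    then show ?case using that
      by (simp add: nscale_Suc add eq nscale_add nscale_nscale mult_ac)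
  qed
  obtain a m where x: "x = q a m" "m > 0"
    using Quotient_abs_rep [OF Quotient_divisible_hull, of x]
      Quotient_rep_reflp [OF Quotient_divisible_hull, of x]
    by (cases "rep_divisible_hull x") (auto simp: q_def)
  have "nscale n (q a (n * m)) = x"
    using x assms by (simp add: mul eq nscale_nscale mult_ac)
  then show ?thesis ..
qed


section \<open>Valuations\<close>

definition nonzeros :: "('a, 'b) ring_scheme \<Rightarrow> 'a set"
  where "nonzeros R = carrier R - {\<zero>\<^bsub>R\<^esub>}"

definition division_ring :: "('a, 'b) ring_scheme \<Rightarrow> bool"
  where "division_ring R \<longleftrightarrow> ring R \<and> \<one>\<^bsub>R\<^esub> \<noteq> \<zero>\<^bsub>R\<^esub> \<and> Units R = nonzeros R"

text \<open>Krull valuations of arbitrary rank, written additively. The value at zero is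
  infinite by convention, hence the function is only inspected at nonzero elements. It need
  not be onto the type of values.\<close>

definition valuation_on :: "('a, 'b) ring_scheme \<Rightarrow> ('a \<Rightarrow> 'g::linordered_ab_group_add) \<Rightarrow> bool"
  where "valuation_on R v \<longleftrightarrow>
    (\<forall>x\<in>nonzeros R. \<forall>y\<in>nonzeros R. v (x \<otimes>\<^bsub>R\<^esub> y) = v x + v y) \<and>
    (\<forall>x\<in>nonzeros R. \<forall>y\<in>nonzeros R. x \<oplus>\<^bsub>R\<^esub> y \<noteq> \<zero>\<^bsub>R\<^esub> \<longrightarrow> min (v x) (v y) \<le> v (x \<oplus>\<^bsub>R\<^esub> y))"

definition val_ring :: "('a, 'b) ring_scheme \<Rightarrow> ('a \<Rightarrow> 'g::linordered_ab_group_add) \<Rightarrow> 'a set"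
  where "val_ring R v = {\<zero>\<^bsub>R\<^esub>} \<union> {x \<in> nonzeros R. 0 \<le> v x}"

definition val_ideal :: "('a, 'b) ring_scheme \<Rightarrow> ('a \<Rightarrow> 'g::linordered_ab_group_add) \<Rightarrow> 'a set"
  where "val_ideal R v = {\<zero>\<^bsub>R\<^esub>} \<union> {x \<in> nonzeros R. 0 < v x}"

definition residue_ring ::
    "('a, 'b) ring_scheme \<Rightarrow> ('a \<Rightarrow> 'g::linordered_ab_group_add) \<Rightarrow> 'a set ring"
  where "residue_ring R v = R\<lparr>carrier := val_ring R v\<rparr> Quot val_ideal R v"

text \<open>The value group of a valuation extending \<open>v\<close> to a finite-dimensional division algebra
  is torsion over the value group of \<open>v\<close>, so it embeds in exactly one way, over the value group
  of \<open>v\<close>, as an ordered group in the divisible hull. With values in the hull, equivalence of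
  extensions is equality.\<close>

definition extends_valuation ::
    "('a, 'b) ring_scheme \<Rightarrow> ('a \<Rightarrow> 'g::linordered_ab_group_add) \<Rightarrow> ('c, 'd) ring_scheme \<Rightarrow>
      ('a \<Rightarrow> 'c) \<Rightarrow> ('c \<Rightarrow> 'g divisible_hull) \<Rightarrow> bool"
  where "extends_valuation R v S \<phi> w \<longleftrightarrow>
    valuation_on S w \<and> (\<forall>x\<in>nonzeros R. w (\<phi> x) = hull_of (v x))"

definition finite_field_extension ::
    "('a, 'b) ring_scheme \<Rightarrow> ('c, 'd) ring_scheme \<Rightarrow> ('a \<Rightarrow> 'c) \<Rightarrow> bool"
  where "finite_field_extension K L \<phi> \<longleftrightarrow>
    field L \<and> \<phi> \<in> ring_hom K L \<and> ring.finite_dimension L (\<phi> ` carrier K) (carrier L)"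

text \<open>An extension of \<open>K\<close> of degree \<open>n\<close> is in bijection with the lists of length \<open>n\<close> over \<open>K\<close>,
  so up to isomorphism every finite extension of \<open>K\<close> lives on the type of lists.\<close>

definition henselian :: "('a, 'b) ring_scheme \<Rightarrow> ('a \<Rightarrow> 'g::linordered_ab_group_add) \<Rightarrow> bool"
  where "henselian K v \<longleftrightarrow> valuation_on K v \<and>
    (\<forall>(L :: 'a list ring) \<phi>. finite_field_extension K L \<phi> \<longrightarrow>
      (\<exists>w. extends_valuation K v L \<phi> w \<and>
        (\<forall>w'. extends_valuation K v L \<phi> w' \<longrightarrow> (\<forall>x\<in>nonzeros L. w' x = w x))))"


section \<open>Central division algebras and tameness\<close>

definition ring_center :: "('a, 'b) ring_scheme \<Rightarrow> 'a set"
  where "ring_center R =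
    {z \<in> carrier R. \<forall>x\<in>carrier R. z \<otimes>\<^bsub>R\<^esub> x = x \<otimes>\<^bsub>R\<^esub> z}"

definition central_division_algebra :: "'a set \<Rightarrow> ('a, 'b) ring_scheme \<Rightarrow> bool"
  where "central_division_algebra K D \<longleftrightarrow>
    division_ring D \<and> ring_center D = K \<and> ring.finite_dimension D K (carrier D)"

text \<open>The dimension of a division ring over its center is a perfect square whenever it is
  finite, so that the rounding in \<^const>\<open>floor_sqrt\<close> is immaterial.\<close>

definition ind :: "('a, 'b) ring_scheme \<Rightarrow> nat"
  where "ind R = floor_sqrt (ring.dim R (ring_center R) (carrier R))"

text \<open>\<^const>\<open>group.ord\<close> is zero on elements of infinite order.\<close>

definition ring_char :: "('a, 'b) ring_scheme \<Rightarrow> nat"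
  where "ring_char R = group.ord (add_monoid R) \<one>\<^bsub>R\<^esub>"

text \<open>Polynomials are lists of coefficients, the leading one first.\<close>

definition poly_deriv :: "('a, 'b) ring_scheme \<Rightarrow> 'a list \<Rightarrow> 'a list"
  where "poly_deriv R p =
    ring.normalize R (map (\<lambda>i. [Suc i] \<cdot>\<^bsub>R\<^esub> ring.coeff R p (Suc i)) (rev [0..<degree p]))"

definition separable_poly :: "('a, 'b) ring_scheme \<Rightarrow> 'a set \<Rightarrow> 'a list \<Rightarrow> bool"
  where "separable_poly E F p \<longleftrightarrow>
    (\<forall>d\<in>carrier (univ_poly E F).
      d divides\<^bsub>univ_poly E F\<^esub> p \<and> d divides\<^bsub>univ_poly E F\<^esub> poly_deriv E p \<longrightarrow>
        d \<in> Units (univ_poly E F))"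

definition separable_extension :: "'a set \<Rightarrow> ('a, 'b) ring_scheme \<Rightarrow> bool"
  where "separable_extension F E \<longleftrightarrow>
    (\<forall>x\<in>carrier E. \<not> ring.transcendental E F x \<and> separable_poly E F (ring.Irr E F x))"

text \<open>The image of the residue field of \<open>K\<close> under its canonical embedding into the residue
  division algebra of \<open>D\<close>.\<close>

definition residue_image ::
    "'a set \<Rightarrow> ('a, 'b) ring_scheme \<Rightarrow> ('a \<Rightarrow> 'g::linordered_ab_group_add) \<Rightarrow> 'a set set"
  where "residue_image K D w =
    (\<lambda>x. val_ideal D w +>\<^bsub>D\<^esub> x) ` val_ring (D\<lparr>carrier := K\<rparr>) w"

text \<open>The division in the tameness condition is exact.\<close>

definition tame ::
    "'a set \<Rightarrow> ('a, 'b) ring_scheme \<Rightarrow> ('a \<Rightarrow> 'g::linordered_ab_group_add) \<Rightarrow> bool"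
  where "tame K D w \<longleftrightarrow>
    (let Dbar = residue_ring D w;
         Z = ring_center Dbar;
         Kbar = residue_image K D w
     in separable_extension Kbar (Dbar\<lparr>carrier := Z\<rparr>) \<and>
        \<not> ring_char (residue_ring (D\<lparr>carrier := K\<rparr>) w) dvd
            ind D div (ind Dbar * ring.dim Dbar Kbar Z))"


section \<open>The Whitehead group and its torsion\<close>

definition comm_units :: "('a, 'b) ring_scheme \<Rightarrow> 'a set"
  where "comm_units D = derived (units_of D) (carrier (units_of D))"

definition torsion_units :: "('a, 'b) ring_scheme \<Rightarrow> 'a set"
  where "torsion_units D = {x \<in> Units D. \<exists>k::nat\<ge>1. x [^]\<^bsub>D\<^esub> k \<in> comm_units D}"

definition one_plus_ideal ::
    "('a, 'b) ring_scheme \<Rightarrow> ('a \<Rightarrow> 'g::linordered_ab_group_add) \<Rightarrow> 'a set"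
  where "one_plus_ideal D w = (\<lambda>m. \<one>\<^bsub>D\<^esub> \<oplus>\<^bsub>D\<^esub> m) ` val_ideal D w"

definition H_group ::
    "('a, 'b) ring_scheme \<Rightarrow> ('a \<Rightarrow> 'g::linordered_ab_group_add) \<Rightarrow> 'a set monoid"
  where "H_group D w =
    (units_of D)\<lparr>carrier :=
        (one_plus_ideal D w \<inter> torsion_units D) <#>\<^bsub>units_of D\<^esub> comm_units D\<rparr>
      Mod comm_units D"

definition p_group :: "nat \<Rightarrow> ('a, 'b) monoid_scheme \<Rightarrow> bool"
  where "p_group p G \<longleftrightarrow> group G \<and> (\<forall>x\<in>carrier G. \<exists>n. group.ord G x = p ^ n)"

end

theory Submission
  imports Defs "HOL-Combinatorics.Permutations"
begin

text \<open>Let \<open>x \<in> 1 + M\<^sub>D\<close> be torsion modulo \<open>D'\<close>. By Wedderburn's factorisation of minimal polynomials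
  a product \<open>c\<close> of \<open>m \<le> [D:K]\<close> conjugates of \<open>x\<close> lies in \<open>K\<close>, so that \<open>c \<equiv> x\<^sup>m\<close> modulo \<open>D'\<close>
  and \<open>c \<in> 1 + M\<^sub>K\<close>. The determinant of the regular representation shows that \<open>K \<inter> D'\<close> is torsion,
  hence \<open>c\<close> is a root of unity in \<open>1 + M\<^sub>K\<close>, where the torsion is \<open>p\<close>-primary, and trivial in
  residue characteristic zero. So \<open>x\<close> is killed modulo \<open>D'\<close> by \<open>[D:K]!\<close> times a power of \<open>p\<close>.
  By Hensel's lemma \<open>1 + M\<^sub>D\<close> is divisible by integers prime to \<open>p\<close>, which removes the prime-to-\<open>p\<close>
  part of \<open>[D:K]!\<close>.\<close>

section \<open>Determinants over a commutative ring\<close>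

text \<open>The number \<open>m\<close> of conjugates depends on the element in an uncontrolled way;
  only \<open>m \<le> n = [D:K]\<close> is known. This dictates the order of choices: the prime-to-p
  part \<open>j\<close> of \<open>n!\<close> is fixed first, a \<open>j\<close>-th root
  \<open>t\<close> of \<open>x\<close> is taken, and Wedderburn is applied to \<open>t\<close>
  instead of \<open>x\<close>. Whatever \<open>m\<close> comes out divides \<open>n!\<close>, and
  the factor \<open>j\<close> of the exponent is absorbed by \<open>t [^] j = x\<close>. Hensel's
  lemma lives on fields, so the root is extracted in a commutative subfield containing
  \<open>x\<close> and \<open>K\<close>. The double commutant of \<open>x\<close> is such a field
  and spares adjoining elements inside a noncommutative ring; the algebraic closure is only taken
  over that field. The regular representation replaces the reduced norm: it yields the exponent
  \<open>[D:K]\<close> instead of the index, which is harmless where only torsion matters, and it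
  asks for determinants over the center but for no splitting field of \<open>D\<close>.\<close>

lemma (in abelian_monoid) finsum_product_eq:
  assumes "finite A" "finite B" "\<And>a b. a \<in> A \<Longrightarrow> b \<in> B \<Longrightarrow> f a b \<in> carrier G"
  shows "(\<Oplus>p\<in>A \<times> B. f (fst p) (snd p)) = (\<Oplus>a\<in>A. \<Oplus>b\<in>B. f a b)"
proof -
  have "A \<times> B = (\<Union>a\<in>A. Pair a ` B)" by auto
  then have "(\<Oplus>p\<in>A \<times> B. f (fst p) (snd p)) = (\<Oplus>a\<in>A. \<Oplus>p\<in>Pair a ` B. f (fst p) (snd p))"
    using assms by (simp only:, subst add.finprod_UN_disjoint)
      (auto simp: pairwise_def disjnt_def intro!: add.finprod_cong')
  also have "\<dots> = (\<Oplus>a\<in>A. \<Oplus>b\<in>B. f a b)"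
    using assms
    by (intro add.finprod_cong' refl, force intro!: finsum_closed)
      (subst add.finprod_reindex, auto simp: inj_on_def)
  finally show ?thesis .
qed

lemma (in abelian_monoid) finsum_swap:
  assumes "finite A" "finite B" "\<And>a b. a \<in> A \<Longrightarrow> b \<in> B \<Longrightarrow> f a b \<in> carrier G"
  shows "(\<Oplus>a\<in>A. \<Oplus>b\<in>B. f a b) = (\<Oplus>b\<in>B. \<Oplus>a\<in>A. f a b)"
proof -
  have "(\<Oplus>p\<in>A \<times> B. f (fst p) (snd p)) = (\<Oplus>p\<in>prod.swap ` (B \<times> A). f (fst p) (snd p))"
    by (simp add: product_swap)
  also have "\<dots> = (\<Oplus>p\<in>B \<times> A. f (snd p) (fst p))"
    using assms by (subst add.finprod_reindex) (auto simp: Pi_def)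
  finally show ?thesis
    using finsum_product_eq[of A B f] finsum_product_eq[of B A "\<lambda>b a. f a b"] assms by simp
qed

text \<open>Extensional functions encode each choice of one summand per factor exactly once. In the
  induction, a choice on \<open>insert j I\<close> is a value at \<open>j\<close> together with a
  choice on \<open>I\<close>; \<open>?h\<close> is this bijection.\<close>

lemma (in cring) finprod_finsum_distr:
  assumes "finite I" "finite S" "\<And>i k. i \<in> I \<Longrightarrow> k \<in> S \<Longrightarrow> x i k \<in> carrier R"
  shows "(\<Otimes>i\<in>I. \<Oplus>k\<in>S. x i k) = (\<Oplus>f\<in>(I \<rightarrow>\<^sub>E S). \<Otimes>i\<in>I. x i (f i))"
  using assms(1,3)
proof (induction I rule: finite_induct)
  case empty
  then show ?case by (simp add: PiE_empty_domain)
next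
  case (insert j I)
  let ?h = "\<lambda>p. (snd p)(j := fst p)"
  have im: "insert j I \<rightarrow>\<^sub>E S = ?h ` (S \<times> (I \<rightarrow>\<^sub>E S))"
    unfolding PiE_insert_eq by (simp add: case_prod_unfold)
  have inj: "inj_on ?h (S \<times> (I \<rightarrow>\<^sub>E S))"
    using inj_combinator[OF insert.hyps(2), of "\<lambda>_. S"]
    by (simp add: case_prod_unfold)
  have fin: "finite (I \<rightarrow>\<^sub>E S)" using insert.hyps(1) assms(2) by (intro finite_PiE) auto
  have c: "(\<Otimes>i\<in>I. x i (g i)) \<in> carrier R" if "g \<in> I \<rightarrow>\<^sub>E S" for g
    using insert.prems that by (intro finprod_closed) (auto simp: PiE_def Pi_def)
  have "(\<Oplus>f\<in>(insert j I \<rightarrow>\<^sub>E S). \<Otimes>i\<in>insert j I. x i (f i))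
      = (\<Oplus>p\<in>S \<times> (I \<rightarrow>\<^sub>E S). \<Otimes>i\<in>insert j I. x i (?h p i))"
    unfolding im using insert.prems inj
    by (subst add.finprod_reindex) (auto intro!: finprod_closed simp: PiE_def Pi_def extensional_def)
  also have "\<dots> = (\<Oplus>p\<in>S \<times> (I \<rightarrow>\<^sub>E S). x j (fst p) \<otimes> (\<Otimes>i\<in>I. x i (snd p i)))"
  proof (intro add.finprod_cong' refl)
    fix p assume p: "p \<in> S \<times> (I \<rightarrow>\<^sub>E S)"
    have "(\<Otimes>i\<in>insert j I. x i (?h p i)) = x j (?h p j) \<otimes> (\<Otimes>i\<in>I. x i (?h p i))"
      using insert.hyps insert.prems p by (intro finprod_insert) (auto simp: PiE_def Pi_def)
    also have "(\<Otimes>i\<in>I. x i (?h p i)) = (\<Otimes>i\<in>I. x i (snd p i))"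
      using insert.hyps insert.prems p by (intro finprod_cong' refl) (auto simp: PiE_def Pi_def)
    finally show "(\<Otimes>i\<in>insert j I. x i (?h p i)) = x j (fst p) \<otimes> (\<Otimes>i\<in>I. x i (snd p i))"
      by simp
  qed (use c insert.prems in auto)
  also have "\<dots> = (\<Oplus>k\<in>S. \<Oplus>g\<in>(I \<rightarrow>\<^sub>E S). x j k \<otimes> (\<Otimes>i\<in>I. x i (g i)))"
    using finsum_product_eq[of S "I \<rightarrow>\<^sub>E S" "\<lambda>k g. x j k \<otimes> (\<Otimes>i\<in>I. x i (g i))"] assms(2) fin c insert.prems
    by auto
  also have "\<dots> = (\<Oplus>k\<in>S. x j k \<otimes> (\<Oplus>g\<in>(I \<rightarrow>\<^sub>E S). (\<Otimes>i\<in>I. x i (g i))))"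
    using fin c insert.prems by (intro add.finprod_cong' refl) (auto simp: finsum_rdistr Pi_def)
  also have "\<dots> = (\<Oplus>k\<in>S. x j k) \<otimes> (\<Oplus>g\<in>(I \<rightarrow>\<^sub>E S). (\<Otimes>i\<in>I. x i (g i)))"
    using assms(2) fin c insert.prems by (subst finsum_ldistr) (auto simp: Pi_def)
  also have "\<dots> = (\<Oplus>k\<in>S. x j k) \<otimes> (\<Otimes>i\<in>I. \<Oplus>k\<in>S. x i k)"
    using insert.IH insert.prems by simp
  also have "\<dots> = (\<Otimes>i\<in>insert j I. \<Oplus>k\<in>S. x i k)"
    using insert.hyps insert.prems by (subst finprod_insert) (auto intro!: finsum_closed simp: Pi_def)
  finally show ?case by simp
qed

section \<open>Leibniz determinants: alternation and multiplicativity\<close>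

definition psign :: "('a, 'b) ring_scheme \<Rightarrow> (nat \<Rightarrow> nat) \<Rightarrow> 'a"
  where "psign R p = (if evenperm p then \<one>\<^bsub>R\<^esub> else \<ominus>\<^bsub>R\<^esub> \<one>\<^bsub>R\<^esub>)"

definition leibniz_det :: "('a, 'b) ring_scheme \<Rightarrow> nat \<Rightarrow> (nat \<Rightarrow> nat \<Rightarrow> 'a) \<Rightarrow> 'a"
  where "leibniz_det R n A =
    (\<Oplus>\<^bsub>R\<^esub>p\<in>{p. p permutes {..<n}}. psign R p \<otimes>\<^bsub>R\<^esub> (\<Otimes>\<^bsub>R\<^esub>i\<in>{..<n}. A i (p i)))"

context cring
begin

lemma psign_closed [simp]: "psign R p \<in> carrier R"
  by (simp add: psign_def)

lemma psign_compose:
  assumes "p permutes {..<n::nat}" "q permutes {..<n}"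
  shows "psign R (p \<circ> q) = psign R p \<otimes> psign R q"
proof -
  have "permutation p" "permutation q"
    using assms permutation_permutes by blast+
  then show ?thesis
    by (auto simp: psign_def evenperm_comp l_minus r_minus)
qed

lemma permutes_less: "p permutes {..<n::nat} \<Longrightarrow> i < n \<Longrightarrow> p i < n"
  using permutes_in_image[of p "{..<n}" i] by simp

lemma leibniz_term_closed:
  fixes n :: nat
  assumes "\<And>i j. i < n \<Longrightarrow> j < n \<Longrightarrow> A i j \<in> carrier R" "p permutes {..<n}"
  shows "(\<Otimes>i\<in>{..<n}. A i (p i)) \<in> carrier R"
  using assms permutes_less[OF assms(2)] by (intro finprod_closed) auto

lemma leibniz_det_closed:
  assumes "\<And>i j. i < n \<Longrightarrow> j < n \<Longrightarrow> A i j \<in> carrier R"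
  shows "leibniz_det R n A \<in> carrier R"
  unfolding leibniz_det_def using assms leibniz_term_closed[of n A] by (intro finsum_closed) auto

lemma leibniz_det_cong:
  assumes "\<And>i j. i < n \<Longrightarrow> j < n \<Longrightarrow> A i j = B i j" "\<And>i j. i < n \<Longrightarrow> j < n \<Longrightarrow> B i j \<in> carrier R"
  shows "leibniz_det R n A = leibniz_det R n B"
proof -
  have "(\<Otimes>i\<in>{..<n}. A i (p i)) = (\<Otimes>i\<in>{..<n}. B i (p i))" if "p permutes {..<n}" for p
    using that assms permutes_less[OF that] by (intro finprod_cong' refl) auto
  then show ?thesis
    unfolding leibniz_det_def using assms(2) leibniz_term_closed[of n B]
    by (intro add.finprod_cong' refl) auto
qed

text \<open>Substituting \<open>p \<circ> f\<close> for \<open>p\<close> moves row and column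
  indices together, so each product is merely reordered and only the sign \<open>psign R f\<close>
  splits off.\<close>

lemma leibniz_det_permute_rows:
  assumes B: "\<And>i j. i < n \<Longrightarrow> j < n \<Longrightarrow> B i j \<in> carrier R" and f: "f permutes {..<n}"
  shows "leibniz_det R n (\<lambda>i. B (f i)) = psign R f \<otimes> leibniz_det R n B"
proof -
  let ?P = "{p. p permutes {..<n}}"
  have fin: "finite ?P" by (simp add: finite_permutations)
  have im: "?P = (\<lambda>p. p \<circ> f) ` ?P"
  proof (intro equalityI subsetI)
    fix p assume "p \<in> ?P"
    then have "p \<circ> Hilbert_Choice.inv f \<in> ?P" using f by (simp add: permutes_compose permutes_inv)
    moreover have "p = (p \<circ> Hilbert_Choice.inv f) \<circ> f" using f by (simp add: comp_assoc permutes_inv_o)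
    ultimately show "p \<in> (\<lambda>p. p \<circ> f) ` ?P" by blast
  qed (use f in \<open>auto intro: permutes_compose\<close>)
  have inj: "inj_on (\<lambda>p. p \<circ> f) ?P"
    using permutes_surj[OF f] by (auto simp: inj_on_def fun_eq_iff) (metis surjD)
  have re: "(\<Otimes>i\<in>{..<n}. B (f i) (p (f i))) = (\<Otimes>i\<in>{..<n}. B i (p i))" if "p permutes {..<n}" for p
  proof -
    have "(\<Otimes>i\<in>f ` {..<n}. B i (p i)) = (\<Otimes>i\<in>{..<n}. B (f i) (p (f i)))"
      using that B f permutes_less[OF that] permutes_less[OF f]
      by (intro finprod_reindex) (auto simp: permutes_image permutes_inj_on)
    then show ?thesis using f by (simp add: permutes_image)
  qed
  have c: "psign R p \<otimes> (\<Otimes>i\<in>{..<n}. B (f i) (p i)) \<in> carrier R" if "p permutes {..<n}" for p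
    using B leibniz_term_closed[of n "\<lambda>i. B (f i)" p] that permutes_less[OF f] by auto
  have "leibniz_det R n (\<lambda>i. B (f i)) = (\<Oplus>p\<in>(\<lambda>p. p \<circ> f) ` ?P. psign R p \<otimes> (\<Otimes>i\<in>{..<n}. B (f i) (p i)))"
    unfolding leibniz_det_def by (subst im) simp
  also have "\<dots> = (\<Oplus>p\<in>?P. psign R (p \<circ> f) \<otimes> (\<Otimes>i\<in>{..<n}. B (f i) ((p \<circ> f) i)))"
    using c f inj by (subst add.finprod_reindex) (auto intro: permutes_compose)
  also have "\<dots> = (\<Oplus>p\<in>?P. psign R f \<otimes> (psign R p \<otimes> (\<Otimes>i\<in>{..<n}. B i (p i))))"
    using f leibniz_term_closed[of n B] B
    by (intro add.finprod_cong' refl) (auto simp: psign_compose re m_ac)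
  also have "\<dots> = psign R f \<otimes> leibniz_det R n B"
    unfolding leibniz_det_def using fin leibniz_term_closed[of n B] B
    by (subst finsum_rdistr) auto
  finally show ?thesis .
qed

text \<open>The permutations are paired by composing with the transposition of the two equal rows;
  grouping the even ones against the odd ones makes this work in characteristic two.\<close>

lemma leibniz_det_equal_rows:
  assumes B: "\<And>i j. i < n \<Longrightarrow> j < n \<Longrightarrow> B i j \<in> carrier R"
    and ab: "a < n" "b < n" "a \<noteq> b" and eq: "\<And>j. j < n \<Longrightarrow> B a j = B b j"
  shows "leibniz_det R n B = \<zero>"
proof -
  let ?t = "transpose a b"
  let ?P = "{p. p permutes {..<n}}"
  let ?E = "{p \<in> ?P. evenperm p}"
  let ?O = "{p \<in> ?P. \<not> evenperm p}"
  let ?g = "\<lambda>p. psign R p \<otimes> (\<Otimes>i\<in>{..<n}. B i (p i))"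
  have t: "?t permutes {..<n}" using ab by (simp add: permutes_swap_id)
  have fin: "finite ?P" by (simp add: finite_permutations)
  have perm: "permutation p" if "p permutes {..<n}" for p :: "nat \<Rightarrow> nat"
    using that permutation_permutes by blast
  have ev: "evenperm (p \<circ> ?t) \<longleftrightarrow> \<not> evenperm p" if "p permutes {..<n}" for p
    using evenperm_comp[OF perm[OF that] perm[OF t]] ab(3) by (simp add: evenperm_swap)
  have tt: "p \<circ> ?t \<circ> ?t = p" for p by (simp add: comp_assoc)
  have im: "?O = (\<lambda>p. p \<circ> ?t) ` ?E"
  proof (intro equalityI subsetI)
    fix p assume p: "p \<in> ?O"
    then have "p \<circ> ?t \<in> ?E" using t ev by (auto intro: permutes_compose)
    then show "p \<in> (\<lambda>p. p \<circ> ?t) ` ?E"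
      by (intro image_eqI[of _ _ "p \<circ> ?t"]) (simp_all only: tt)
  qed (use t ev in \<open>auto intro: permutes_compose\<close>)
  have inj: "inj_on (\<lambda>p. p \<circ> ?t) ?E" by (rule inj_on_inverseI[of _ "\<lambda>p. p \<circ> ?t"]) (rule tt)
  have c: "?g p \<in> carrier R" if "p permutes {..<n}" for p
    using B leibniz_term_closed[of n B p] that by auto
  have re: "(\<Otimes>i\<in>{..<n}. B i (p (?t i))) = (\<Otimes>i\<in>{..<n}. B i (p i))" if "p permutes {..<n}" for p
  proof -
    have "(\<Otimes>i\<in>?t ` {..<n}. B i (p (?t i))) = (\<Otimes>i\<in>{..<n}. B (?t i) (p (?t (?t i))))"
      using that B t permutes_less[OF that] permutes_less[OF t]
      by (intro finprod_reindex) (auto simp: permutes_image permutes_inj_on)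
    also have "\<dots> = (\<Otimes>i\<in>{..<n}. B i (p i))"
      using that B eq ab permutes_less[OF that] permutes_less[OF t]
      by (intro finprod_cong' refl) (auto simp: transpose_def)
    finally show ?thesis using t by (simp add: permutes_image)
  qed
  have "leibniz_det R n B = (\<Oplus>p\<in>?E \<union> ?O. ?g p)"
    unfolding leibniz_det_def by (intro arg_cong[where f = "finsum R _"]) auto
  also have "\<dots> = (\<Oplus>p\<in>?E. ?g p) \<oplus> (\<Oplus>p\<in>?O. ?g p)"
    using fin c by (intro finsum_Un_disjoint) auto
  also have "(\<Oplus>p\<in>?O. ?g p) = (\<Oplus>p\<in>?E. ?g (p \<circ> ?t))"
    unfolding im using c inj t by (subst add.finprod_reindex) (auto intro: permutes_compose)
  also have "\<dots> = (\<Oplus>p\<in>?E. \<ominus> \<one> \<otimes> ?g p)"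
    using c leibniz_term_closed[of n B] B
    by (intro add.finprod_cong' refl) (auto simp: psign_def ev re l_minus)
  also have "\<dots> = \<ominus> \<one> \<otimes> (\<Oplus>p\<in>?E. ?g p)"
    using fin c by (subst finsum_rdistr) auto
  finally show ?thesis using c by (simp add: l_minus r_neg)
qed

text \<open>Expanding the product of the row sums gives one term for every map \<open>f\<close> of
  the index set to itself, namely a product of entries of \<open>A\<close> times the determinant of
  \<open>B\<close> with its rows selected by \<open>f\<close>. A noninjective \<open>f\<close>
  selects a row twice and contributes zero; the permutations contribute their signs and reassemble
  the determinant of \<open>A\<close>.\<close>

lemma leibniz_det_mult:
  assumes A: "\<And>i j. i < n \<Longrightarrow> j < n \<Longrightarrow> A i j \<in> carrier R"
    and B: "\<And>i j. i < n \<Longrightarrow> j < n \<Longrightarrow> B i j \<in> carrier R"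
  shows "leibniz_det R n (\<lambda>i j. \<Oplus>k\<in>{..<n}. A i k \<otimes> B k j) = leibniz_det R n A \<otimes> leibniz_det R n B"
proof -
  let ?S = "{..<n}"
  let ?P = "{p. p permutes ?S}"
  let ?F = "?S \<rightarrow>\<^sub>E ?S"
  let ?a = "\<lambda>f. \<Otimes>i\<in>?S. A i (f i)"
  let ?b = "\<lambda>f p. \<Otimes>i\<in>?S. B (f i) (p i)"
  have finP: "finite ?P" by (simp add: finite_permutations)
  have finF: "finite ?F" by (intro finite_PiE) auto
  have fl: "f i < n" if "f \<in> ?F" "i < n" for f i using that by auto
  have a: "?a f \<in> carrier R" if "f \<in> ?F" for f
    using that A by (intro finprod_closed) (auto dest: fl)
  have b: "?b f p \<in> carrier R" if "f \<in> ?F" "p permutes ?S" for f p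
    using that B permutes_less[OF that(2)] by (intro finprod_closed) (auto dest: fl)
  have sub: "(\<lambda>p. restrict p ?S) ` ?P \<subseteq> ?F"
    by (simp add: image_subset_iff restrict_PiE_iff permutes_less)
  have d: "?a f \<otimes> leibniz_det R n (\<lambda>i. B (f i)) \<in> carrier R" if "f \<in> ?F" for f
    using a[OF that] B fl[OF that] by (auto intro!: leibniz_det_closed)
  have "leibniz_det R n (\<lambda>i j. \<Oplus>k\<in>?S. A i k \<otimes> B k j)
      = (\<Oplus>p\<in>?P. \<Oplus>f\<in>?F. ?a f \<otimes> (psign R p \<otimes> ?b f p))"
    unfolding leibniz_det_def
  proof (intro add.finprod_cong' refl)
    fix p assume "p \<in> ?P"
    then have p: "p permutes ?S" by simp
    have "(\<Otimes>i\<in>?S. \<Oplus>k\<in>?S. A i k \<otimes> B k (p i)) = (\<Oplus>f\<in>?F. \<Otimes>i\<in>?S. A i (f i) \<otimes> B (f i) (p i))"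
      using A B permutes_less[OF p] by (intro finprod_finsum_distr) auto
    also have "\<dots> = (\<Oplus>f\<in>?F. ?a f \<otimes> ?b f p)"
      using A B permutes_less[OF p] a b[OF _ p]
      by (intro add.finprod_cong' refl) (auto intro!: finprod_multf dest: fl)
    finally have "psign R p \<otimes> (\<Otimes>i\<in>?S. \<Oplus>k\<in>?S. A i k \<otimes> B k (p i))
        = (\<Oplus>f\<in>?F. psign R p \<otimes> (?a f \<otimes> ?b f p))"
      using finF a b[OF _ p] by (simp add: finsum_rdistr Pi_def)
    also have "\<dots> = (\<Oplus>f\<in>?F. ?a f \<otimes> (psign R p \<otimes> ?b f p))"
      using a b[OF _ p] by (intro add.finprod_cong' refl) (auto simp: m_lcomm)
    finally show "psign R p \<otimes> (\<Otimes>i\<in>?S. \<Oplus>k\<in>?S. A i k \<otimes> B k (p i))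
        = (\<Oplus>f\<in>?F. ?a f \<otimes> (psign R p \<otimes> ?b f p))" .
  qed (use a b in \<open>auto intro!: finsum_closed\<close>)
  also have "\<dots> = (\<Oplus>f\<in>?F. \<Oplus>p\<in>?P. ?a f \<otimes> (psign R p \<otimes> ?b f p))"
    using finP finF a b by (intro finsum_swap) auto
  also have "\<dots> = (\<Oplus>f\<in>?F. ?a f \<otimes> leibniz_det R n (\<lambda>i. B (f i)))"
    unfolding leibniz_det_def using finP a b
    by (intro add.finprod_cong' refl) (auto simp: finsum_rdistr intro!: finsum_closed)
  \<comment> \<open>Permutations are total and fix everything outside \<open>?S\<close>, whereas
    \<open>?F\<close> consists of extensional functions; \<open>restrict\<close> passes from one
    encoding to the other.\<close>
  also have "\<dots> = (\<Oplus>p\<in>(\<lambda>p. restrict p ?S) ` ?P. ?a p \<otimes> leibniz_det R n (\<lambda>i. B (p i)))"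
  proof (rule add.finprod_mono_neutral_cong_right[OF finF])
    show "(\<lambda>p. restrict p ?S) ` ?P \<subseteq> ?F" by (rule sub)
    show "?a f \<otimes> leibniz_det R n (\<lambda>i. B (f i)) = \<zero>" if f: "f \<in> ?F - (\<lambda>p. restrict p ?S) ` ?P" for f
    proof -
      have "\<not> inj_on f ?S"
      proof
        assume inj: "inj_on f ?S"
        have "f ` ?S \<subseteq> ?S" using f by auto
        then have im: "f ` ?S = ?S" using inj by (simp add: endo_inj_surj)
        \<comment> \<open>The converse passage: an injective choice is continued by the
          identity.\<close>
        let ?p = "\<lambda>i. if i \<in> ?S then f i else i"
        have "bij_betw ?p ?S ?S"
          using inj im by (auto simp: bij_betw_def inj_on_def)
        then have "?p permutes ?S" by (intro bij_imp_permutes) auto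
        moreover have "restrict ?p ?S = f" using f by (auto simp: fun_eq_iff PiE_def extensional_def)
        ultimately have "f \<in> (\<lambda>p. restrict p ?S) ` ?P" by (intro image_eqI[of _ _ ?p]) auto
        then show False using f by simp
      qed
      then obtain i j where ij: "i < n" "j < n" "i \<noteq> j" "f i = f j" by (auto simp: inj_on_def)
      have "leibniz_det R n (\<lambda>i. B (f i)) = \<zero>"
        using f B ij by (intro leibniz_det_equal_rows[of n _ i j]) (auto dest: fl)
      then show ?thesis using a f by auto
    qed
    show "(\<lambda>f. ?a f \<otimes> leibniz_det R n (\<lambda>i. B (f i))) \<in> ?F \<rightarrow> carrier R"
      using d by blast
  qed auto
  also have "\<dots> = (\<Oplus>p\<in>?P. ?a (restrict p ?S) \<otimes> leibniz_det R n (\<lambda>i. B (restrict p ?S i)))"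
  proof (rule add.finprod_reindex)
    show "inj_on (\<lambda>p. restrict p ?S) ?P"
    proof (rule inj_onI)
      fix p q assume pq: "p \<in> ?P" "q \<in> ?P" "restrict p ?S = restrict q ?S"
      show "p = q"
      proof
        fix i show "p i = q i"
          using pq by (cases "i \<in> ?S") (auto simp: permutes_def restrict_def dest: fun_cong[of _ _ i])
      qed
    qed
    show "(\<lambda>p. ?a p \<otimes> leibniz_det R n (\<lambda>i. B (p i))) \<in> (\<lambda>p. restrict p ?S) ` ?P \<rightarrow> carrier R"
    proof
      fix f assume "f \<in> (\<lambda>p. restrict p ?S) ` ?P"
      then have "f \<in> ?F" using sub by blast
      then show "?a f \<otimes> leibniz_det R n (\<lambda>i. B (f i)) \<in> carrier R"
        by (rule d)
    qed
  qed
  also have "\<dots> = (\<Oplus>p\<in>?P. (psign R p \<otimes> ?a p) \<otimes> leibniz_det R n B)"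
  proof (intro add.finprod_cong' refl)
    fix p assume "p \<in> ?P"
    then have p: "p permutes ?S" by simp
    have "?a (restrict p ?S) = ?a p"
      using leibniz_term_closed[of n A p, OF A p] A permutes_less[OF p] by (intro finprod_cong' refl) auto
    moreover have "leibniz_det R n (\<lambda>i. B (restrict p ?S i)) = psign R p \<otimes> leibniz_det R n B"
      using leibniz_det_permute_rows[OF B p] B permutes_less[OF p]
      by (subst leibniz_det_cong[of n _ "\<lambda>i. B (p i)"]) auto
    ultimately show "?a (restrict p ?S) \<otimes> leibniz_det R n (\<lambda>i. B (restrict p ?S i))
        = (psign R p \<otimes> ?a p) \<otimes> leibniz_det R n B"
      using leibniz_term_closed[of n A p, OF A p] leibniz_det_closed[of n B, OF B] by (simp add: m_ac)
  qed (use A B leibniz_term_closed[of n A] leibniz_det_closed[of n B] in auto)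
  also have "\<dots> = leibniz_det R n A \<otimes> leibniz_det R n B"
    using finP A B leibniz_term_closed[of n A] leibniz_det_closed[of n B]
    by (subst leibniz_det_def[of R n A], subst finsum_ldistr) auto
  finally show ?thesis .
qed

lemma leibniz_det_scalar:
  assumes c: "c \<in> carrier R"
  shows "leibniz_det R n (\<lambda>i j. if i = j then c else \<zero>) = c [^] n"
proof -
  let ?A = "\<lambda>i j. if i = j then c else \<zero>"
  let ?P = "{p. p permutes {..<n}}"
  have z: "(\<Otimes>i\<in>{..<n}. ?A i (p i)) = \<zero>" if p: "p permutes {..<n}" "p \<noteq> id" for p
  proof -
    obtain k where k: "p k \<noteq> k" using p(2) by (auto simp: fun_eq_iff)
    then have kn: "k \<in> {..<n}" using p(1) by (auto simp: permutes_def)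
    have "(\<Otimes>i\<in>insert k ({..<n} - {k}). ?A i (p i)) = ?A k (p k) \<otimes> (\<Otimes>i\<in>{..<n} - {k}. ?A i (p i))"
      using c by (intro finprod_insert) auto
    also have "\<dots> = \<zero>" using k c by (auto intro!: l_null finprod_closed)
    finally show ?thesis using kn by (simp add: insert_absorb)
  qed
  have "leibniz_det R n ?A = (\<Oplus>p\<in>{id}. psign R p \<otimes> (\<Otimes>i\<in>{..<n}. ?A i (p i)))"
    unfolding leibniz_det_def using c z
    by (intro add.finprod_mono_neutral_cong_right)
      (auto simp: finite_permutations permutes_id intro!: finprod_closed)
  also have "\<dots> = psign R id \<otimes> (\<Otimes>i\<in>{..<n}. ?A i i)"
    using c by (subst finsum_insert) (auto intro!: finprod_closed)
  also have "(\<Otimes>i\<in>{..<n}. ?A i i) = c [^] n"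
    using finprod_const[OF c, of "{..<n}"] by simp
  finally show ?thesis using c by (simp add: psign_def evenperm_id)
qed

end

section \<open>Valued division rings\<close>

lemma nonzeros_iff: "x \<in> nonzeros R \<longleftrightarrow> x \<in> carrier R \<and> x \<noteq> \<zero>\<^bsub>R\<^esub>"
  by (auto simp: nonzeros_def)

section \<open>Arithmetic of division rings\<close>

locale skew_field = ring R for R (structure) +
  assumes division: "division_ring R"
begin

lemma one_neq_zero: "\<one> \<noteq> \<zero>"
  using division by (simp add: division_ring_def)

lemma Units_iff: "x \<in> Units R \<longleftrightarrow> x \<in> carrier R \<and> x \<noteq> \<zero>"
  using division by (auto simp: division_ring_def nonzeros_def)

lemma inv_closed: "x \<in> carrier R \<Longrightarrow> x \<noteq> \<zero> \<Longrightarrow> inv x \<in> carrier R"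
  by (simp add: Units_iff)

lemma l_inv_nz: "x \<in> carrier R \<Longrightarrow> x \<noteq> \<zero> \<Longrightarrow> inv x \<otimes> x = \<one>"
  by (simp add: Units_iff)

lemma r_inv_nz: "x \<in> carrier R \<Longrightarrow> x \<noteq> \<zero> \<Longrightarrow> x \<otimes> inv x = \<one>"
  by (simp add: Units_iff)

lemma mult_nz: "x \<in> carrier R \<Longrightarrow> y \<in> carrier R \<Longrightarrow> x \<noteq> \<zero> \<Longrightarrow> y \<noteq> \<zero> \<Longrightarrow> x \<otimes> y \<noteq> \<zero>"
  using Units_m_closed[of x y] by (simp add: Units_iff)

lemma inv_nz: "x \<in> carrier R \<Longrightarrow> x \<noteq> \<zero> \<Longrightarrow> inv x \<noteq> \<zero>"
  using Units_inv_Units[of x] by (simp add: Units_iff)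

lemma mult_zero_cases: "x \<in> carrier R \<Longrightarrow> y \<in> carrier R \<Longrightarrow> x \<otimes> y = \<zero> \<Longrightarrow> x = \<zero> \<or> y = \<zero>"
  using mult_nz by blast

end

lemma (in field) field_division_ring: "skew_field R"
  by unfold_locales (auto simp: division_ring_def nonzeros_def field_Units is_ring)

section \<open>Valuation ring, maximal ideal and the group of one-units\<close>

locale valued_division_ring = skew_field R for R (structure) +
  fixes v :: "_ \<Rightarrow> 'g::linordered_ab_group_add"
  assumes valuation: "valuation_on R v"
begin

lemma v_mult: "x \<in> carrier R \<Longrightarrow> y \<in> carrier R \<Longrightarrow> x \<noteq> \<zero> \<Longrightarrow> y \<noteq> \<zero> \<Longrightarrow> v (x \<otimes> y) = v x + v y"
  using valuation by (auto simp: valuation_on_def nonzeros_def)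

lemma v_add: "x \<in> carrier R \<Longrightarrow> y \<in> carrier R \<Longrightarrow> x \<noteq> \<zero> \<Longrightarrow> y \<noteq> \<zero> \<Longrightarrow> x \<oplus> y \<noteq> \<zero> \<Longrightarrow>
    min (v x) (v y) \<le> v (x \<oplus> y)"
  using valuation by (auto simp: valuation_on_def nonzeros_def)

lemma v_one: "v \<one> = 0"
  using v_mult[of \<one> \<one>] one_neq_zero by simp

lemma v_inv: "x \<in> carrier R \<Longrightarrow> x \<noteq> \<zero> \<Longrightarrow> v (inv x) = - v x"
  using v_mult[of "inv x" x] by (simp add: inv_closed inv_nz l_inv_nz v_one eq_neg_iff_add_eq_0)

lemma v_minus: "x \<in> carrier R \<Longrightarrow> x \<noteq> \<zero> \<Longrightarrow> v (\<ominus> x) = v x"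
proof -
  assume x: "x \<in> carrier R" "x \<noteq> \<zero>"
  have n: "\<ominus> \<one> \<noteq> \<zero>" using one_neq_zero by (metis minus_minus minus_zero one_closed)
  have "v (\<ominus> \<one>) + v (\<ominus> \<one>) = 0"
    using v_mult[of "\<ominus> \<one>" "\<ominus> \<one>"] n by (simp add: l_minus r_minus v_one)
  \<comment> \<open>An ordered group has no torsion.\<close>
  then have "v (\<ominus> \<one>) = 0" by (simp only: double_zero)
  then show ?thesis using v_mult[of "\<ominus> \<one>" x] x n by (simp add: l_minus)
qed

abbreviation V where "V \<equiv> val_ring R v"
abbreviation M where "M \<equiv> val_ideal R v"
abbreviation U where "U \<equiv> one_plus_ideal R v"

lemma V_iff: "x \<in> V \<longleftrightarrow> x \<in> carrier R \<and> (x = \<zero> \<or> 0 \<le> v x)"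
  by (auto simp: val_ring_def nonzeros_def)

lemma M_iff: "x \<in> M \<longleftrightarrow> x \<in> carrier R \<and> (x = \<zero> \<or> 0 < v x)"
  by (auto simp: val_ideal_def nonzeros_def)

lemma V_carrier: "x \<in> V \<Longrightarrow> x \<in> carrier R" and M_carrier: "x \<in> M \<Longrightarrow> x \<in> carrier R"
  and M_V: "x \<in> M \<Longrightarrow> x \<in> V"
  by (auto simp: V_iff M_iff)

lemma zero_M [simp]: "\<zero> \<in> M" and one_V [simp]: "\<one> \<in> V" and one_notin_M [simp]: "\<one> \<notin> M"
  by (auto simp: V_iff M_iff v_one one_neq_zero)

lemma V_add: "x \<in> V \<Longrightarrow> y \<in> V \<Longrightarrow> x \<oplus> y \<in> V"
  using v_add[of x y] order_trans[of 0 "min (v x) (v y)" "v (x \<oplus> y)"]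
  by (cases "x = \<zero> \<or> y = \<zero> \<or> x \<oplus> y = \<zero>") (auto simp: V_iff)

lemma M_add: "x \<in> M \<Longrightarrow> y \<in> M \<Longrightarrow> x \<oplus> y \<in> M"
  using v_add[of x y] less_le_trans[of 0 "min (v x) (v y)" "v (x \<oplus> y)"]
  by (cases "x = \<zero> \<or> y = \<zero> \<or> x \<oplus> y = \<zero>") (auto simp: M_iff)

lemma V_minus: "x \<in> V \<Longrightarrow> \<ominus> x \<in> V"
  using v_minus[of x] by (cases "x = \<zero>") (auto simp: V_iff)

lemma M_minus: "x \<in> M \<Longrightarrow> \<ominus> x \<in> M"
  using v_minus[of x] by (cases "x = \<zero>") (auto simp: M_iff)

lemma M_swap: "a \<in> carrier R \<Longrightarrow> b \<in> carrier R \<Longrightarrow> a \<ominus> b \<in> M \<Longrightarrow> b \<ominus> a \<in> M"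
proof -
  assume ab: "a \<in> carrier R" "b \<in> carrier R" "a \<ominus> b \<in> M"
  have "\<ominus> (a \<ominus> b) = b \<ominus> a" using ab(1,2) by algebra
  then show ?thesis using M_minus[OF ab(3)] by simp
qed

lemma V_mult: "x \<in> V \<Longrightarrow> y \<in> V \<Longrightarrow> x \<otimes> y \<in> V"
  using v_mult[of x y] by (fastforce simp: V_iff)

lemma M_mult_left: "x \<in> V \<Longrightarrow> y \<in> M \<Longrightarrow> x \<otimes> y \<in> M"
  using v_mult[of x y] by (fastforce simp: V_iff M_iff intro: add_nonneg_pos)

lemma M_mult_right: "x \<in> M \<Longrightarrow> y \<in> V \<Longrightarrow> x \<otimes> y \<in> M"
  using v_mult[of x y] by (fastforce simp: V_iff M_iff intro: add_pos_nonneg)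

lemma M_prime: "x \<in> V \<Longrightarrow> y \<in> V \<Longrightarrow> x \<otimes> y \<in> M \<Longrightarrow> x \<in> M \<or> y \<in> M"
  using v_mult[of x y] mult_zero_cases[of x y] by (force simp: V_iff M_iff)

text \<open>Outside \<open>M\<close> means value at most zero, so elements of negative value are
  covered too. This is essential for the linear factors of a polynomial, whose roots are not known
  to be integral.\<close>

lemma not_M_mult: "x \<in> carrier R \<Longrightarrow> y \<in> carrier R \<Longrightarrow> x \<notin> M \<Longrightarrow> y \<notin> M \<Longrightarrow> x \<otimes> y \<notin> M"
  using v_mult[of x y] mult_zero_cases[of x y] by (auto simp: M_iff not_less add_nonpos_nonpos)

text \<open>The value group is abelian, so conjugation leaves values unchanged, whatever the value
  of \<open>u\<close>.\<close>

lemma M_conj: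
  assumes "x \<in> M" "u \<in> carrier R" "u \<noteq> \<zero>"
  shows "u \<otimes> x \<otimes> inv u \<in> M"
proof (cases "x = \<zero>")
  case False
  then have x: "x \<in> carrier R" "0 < v x" using assms by (auto simp: M_iff)
  have "v (u \<otimes> x \<otimes> inv u) = v x"
    using assms x False by (simp add: v_mult mult_nz inv_closed inv_nz v_inv)
  then show ?thesis using assms x by (simp add: M_iff inv_closed)
qed (use assms in \<open>simp add: inv_closed\<close>)

lemma U_iff: "x \<in> U \<longleftrightarrow> x \<in> carrier R \<and> x \<ominus> \<one> \<in> M"
proof
  assume "x \<in> U"
  then obtain m where m: "m \<in> M" "x = \<one> \<oplus> m" by (auto simp: one_plus_ideal_def)
  then have "x \<ominus> \<one> = m" using M_carrier[OF m(1)] by algebra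
  then show "x \<in> carrier R \<and> x \<ominus> \<one> \<in> M" using m M_carrier by simp
next
  assume x: "x \<in> carrier R \<and> x \<ominus> \<one> \<in> M"
  then have "x = \<one> \<oplus> (x \<ominus> \<one>)" by algebra
  then show "x \<in> U" using x by (auto simp: one_plus_ideal_def)
qed

lemma U_carrier: "x \<in> U \<Longrightarrow> x \<in> carrier R"
  by (simp add: U_iff)

lemma U_V: "x \<in> U \<Longrightarrow> x \<in> V"
proof -
  assume x: "x \<in> U"
  then have "x = (x \<ominus> \<one>) \<oplus> \<one>" using U_carrier by algebra
  then show ?thesis using x V_add[of "x \<ominus> \<one>" \<one>] by (auto simp: U_iff M_V)
qed

lemma U_not_M: "x \<in> U \<Longrightarrow> x \<notin> M"
proof
  assume x: "x \<in> U" "x \<in> M"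
  then have "\<one> = x \<oplus> \<ominus> (x \<ominus> \<one>)" using U_carrier by algebra
  then show False using x M_add[of x "\<ominus> (x \<ominus> \<one>)"] M_minus[of "x \<ominus> \<one>"] by (simp add: U_iff)
qed

lemma U_nz: "x \<in> U \<Longrightarrow> x \<noteq> \<zero>"
  using U_not_M by fastforce

lemma v_U: "x \<in> U \<Longrightarrow> v x = 0"
  using U_V[of x] U_not_M[of x] by (auto simp: V_iff M_iff)

lemma one_U [simp]: "\<one> \<in> U"
  by (simp add: U_iff r_neg a_minus_def)

lemma U_mult: "x \<in> U \<Longrightarrow> y \<in> U \<Longrightarrow> x \<otimes> y \<in> U"
proof -
  assume x: "x \<in> U" and y: "y \<in> U"
  have "x \<otimes> y \<ominus> \<one> = (x \<ominus> \<one>) \<otimes> y \<oplus> (y \<ominus> \<one>)"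
    using U_carrier[OF x] U_carrier[OF y] by algebra
  moreover have "(x \<ominus> \<one>) \<otimes> y \<oplus> (y \<ominus> \<one>) \<in> M"
    using x y by (intro M_add M_mult_right) (auto simp: U_iff intro: U_V)
  ultimately show ?thesis using x y by (simp add: U_iff)
qed

lemma U_inv: "x \<in> U \<Longrightarrow> inv x \<in> U"
proof -
  assume x: "x \<in> U"
  note c = U_carrier[OF x] U_nz[OF x]
  have i: "inv x \<in> V" using c v_U[OF x] by (simp add: V_iff inv_closed v_inv)
  have "inv x \<ominus> \<one> = inv x \<otimes> \<ominus> (x \<ominus> \<one>)"
    using c inv_closed[OF c] l_inv_nz[OF c]
    by (simp add: a_minus_def r_distr r_minus minus_add a_ac)
  also have "\<dots> \<in> M" using x i by (intro M_mult_left M_minus) (auto simp: U_iff)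
  finally show ?thesis using c by (simp add: U_iff inv_closed)
qed

lemma U_pow: "x \<in> U \<Longrightarrow> x [^] (n::nat) \<in> U"
  by (induction n) (auto intro: U_mult)

lemma U_conj:
  assumes "x \<in> U" "u \<in> carrier R" "u \<noteq> \<zero>"
  shows "u \<otimes> x \<otimes> inv u \<in> U"
proof -
  have c: "x \<in> carrier R" "inv u \<in> carrier R" using assms by (auto simp: U_carrier inv_closed)
  have "u \<otimes> x \<otimes> inv u \<ominus> \<one> = u \<otimes> (x \<ominus> \<one>) \<otimes> inv u"
    using assms(2) c r_inv_nz[OF assms(2,3)] by algebra
  then show ?thesis using M_conj[of "x \<ominus> \<one>" u] assms c by (simp add: U_iff)
qed

lemma natural_V: "[(n::nat)] \<cdot> \<one> \<in> V"
proof (induction n)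
  case 0
  then show ?case using M_V[OF zero_M] by (simp add: add_pow_def)
next
  case (Suc n)
  have "[Suc n] \<cdot> \<one> = [n] \<cdot> \<one> \<oplus> \<one>"
    by (simp add: add_pow_def)
  then show ?case using Suc V_add by simp
qed

text \<open>The cofactor is the geometric sum, which is congruent to its number of terms.\<close>

lemma U_power_minus_one:
  assumes c: "c \<in> U"
  shows "\<exists>s\<in>carrier R. c [^] (n::nat) \<ominus> \<one> = (c \<ominus> \<one>) \<otimes> s \<and> s \<ominus> [n] \<cdot> \<one> \<in> M"
proof (induction n)
  case 0
  have "\<one> \<ominus> \<one> = (c \<ominus> \<one>) \<otimes> \<zero>" "\<zero> \<ominus> \<zero> \<in> M"
    using U_carrier[OF c] by (simp_all add: a_minus_def r_neg)
  then show ?case by (intro bexI[of _ \<zero>]) (auto simp: add_pow_def)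
next
  case (Suc n)
  then obtain s where s: "s \<in> carrier R" "c [^] n \<ominus> \<one> = (c \<ominus> \<one>) \<otimes> s" "s \<ominus> [n] \<cdot> \<one> \<in> M"
    by blast
  define k where "k = [n] \<cdot> \<one>"
  have k: "k \<in> V" "k \<in> carrier R" using natural_V[of n] V_carrier by (auto simp: k_def)
  note cc = U_carrier[OF c] nat_pow_closed[OF U_carrier[OF c], of n]
  have "c [^] Suc n \<ominus> \<one> = (c [^] n \<ominus> \<one>) \<otimes> c \<oplus> (c \<ominus> \<one>)"
    using cc by (simp, algebra)
  also have "\<dots> = (c \<ominus> \<one>) \<otimes> (s \<otimes> c \<oplus> \<one>)"
    unfolding s(2) using cc s(1)
    by (simp add: a_minus_def r_distr l_distr r_minus l_minus minus_add a_ac m_assoc)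
  finally have 1: "c [^] Suc n \<ominus> \<one> = (c \<ominus> \<one>) \<otimes> (s \<otimes> c \<oplus> \<one>)" .
  have "k \<otimes> (c \<ominus> \<one>) = k \<otimes> c \<ominus> k"
    using cc k(2) by (simp add: a_minus_def r_distr r_minus)
  then have "s \<otimes> c \<oplus> \<one> \<ominus> (k \<oplus> \<one>) = (s \<ominus> k) \<otimes> c \<oplus> k \<otimes> (c \<ominus> \<one>)"
    using cc s(1) k(2) by (simp only:) algebra
  also have "\<dots> \<in> M"
    using s(3) c k by (intro M_add M_mult_left M_mult_right) (auto simp: U_V k_def U_iff)
  finally show ?case using 1 s(1) cc by (intro bexI[of _ "s \<otimes> c \<oplus> \<one>"]) (auto simp: k_def)
qed

text \<open>In \<open>0 = (c - 1) s\<close> the cofactor \<open>s\<close> is congruent to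
  \<open>n\<close>, which is not in \<open>M\<close>; hence \<open>s\<close> is nonzero and
  \<open>c - 1\<close> must vanish.\<close>

lemma U_torsion_trivial:
  assumes c: "c \<in> U" and n: "[n] \<cdot> \<one> \<notin> M" and 1: "c [^] (n::nat) = \<one>"
  shows "c = \<one>"
proof (rule ccontr)
  assume "c \<noteq> \<one>"
  then have ne: "c \<ominus> \<one> \<noteq> \<zero>" using U_carrier[OF c] by (simp add: r_right_minus_eq)
  obtain s where s: "s \<in> carrier R" "c [^] n \<ominus> \<one> = (c \<ominus> \<one>) \<otimes> s" "s \<ominus> [n] \<cdot> \<one> \<in> M"
    using U_power_minus_one[OF c] by blast
  have "(c \<ominus> \<one>) \<otimes> s = \<zero>" using s(2) 1 by (simp add: a_minus_def r_neg)
  then have "s = \<zero>" using mult_zero_cases[of "c \<ominus> \<one>" s] ne s(1) U_carrier[OF c] by auto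
  then have "\<ominus> ([n] \<cdot> \<one>) \<in> M" using s(3) V_carrier[OF natural_V[of n]] by (simp add: a_minus_def)
  then show False using M_minus[of "\<ominus> ([n] \<cdot> \<one>)"] V_carrier[OF natural_V[of n]] n by simp
qed

text \<open>The quotient \<open>a \<otimes> inv b\<close> is a torsion one-unit of order prime to
  the residue characteristic. Commutation is what lets the power pass through the quotient.\<close>

lemma U_eq_if_power_eq:
  assumes "a \<in> U" "b \<in> U" "a \<otimes> b = b \<otimes> a" and n: "[n] \<cdot> \<one> \<notin> M" and "a [^] (n::nat) = b [^] n"
  shows "a = b"
proof -
  note c = U_carrier[OF assms(1)] U_carrier[OF assms(2)] U_nz[OF assms(2)]
  note i = inv_closed[OF c(2,3)]
  have com: "a \<otimes> inv b = inv b \<otimes> a"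
  proof -
    have "inv b \<otimes> (a \<otimes> b) \<otimes> inv b = inv b \<otimes> (b \<otimes> a) \<otimes> inv b" using assms(3) by simp
    then have "inv b \<otimes> a \<otimes> (b \<otimes> inv b) = (inv b \<otimes> b) \<otimes> a \<otimes> inv b"
      using c i by (simp add: m_assoc)
    then show ?thesis using c i by (simp add: l_inv_nz r_inv_nz)
  qed
  have "(a \<otimes> inv b) [^] n = b [^] n \<otimes> inv b [^] n"
    using pow_mult_distrib[OF com] c i assms(5) by simp
  also have "\<dots> = (b \<otimes> inv b) [^] n"
    using pow_mult_distrib[of b "inv b" n] c(2,3) i l_inv_nz[OF c(2,3)] r_inv_nz[OF c(2,3)] by argo
  finally have "(a \<otimes> inv b) [^] n = \<one>" using c by (simp add: r_inv_nz)
  then have "a \<otimes> inv b = \<one>"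
    using U_torsion_trivial[of "a \<otimes> inv b" n] assms U_mult U_inv by blast
  then have "a \<otimes> (inv b \<otimes> b) = b" using c i by (metis l_one m_assoc)
  then show ?thesis using c by (simp add: l_inv_nz)
qed

end

section \<open>Roots of one-units over Henselian fields\<close>

lemma (in ring) subring_finite_dimension:
  assumes K: "subfield K R" and S: "subring S R" and KS: "K \<subseteq> S" and fin: "finite_dimension K S"
  shows "ring.finite_dimension (R\<lparr>carrier := S\<rparr>) K S"
proof -
  let ?S = "R\<lparr>carrier := S\<rparr>"
  interpret S: ring ?S using subring_is_ring[OF S] .
  interpret id: ring_hom_ring ?S R id
    using subringE(1)[OF S] by (intro ring_hom_ringI2[OF S.ring_axioms ring_axioms] ring_hom_memI) auto
  have one: "\<one> \<noteq> \<zero>" using subfieldE(6)[OF K] .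
  have K': "subfield K ?S"
    using subfield_iff(2)[OF K] KS by (intro S.subfield_iff(1)) auto
  \<comment> \<open>Dimension refers to the ambient ring: infinite dimension inside \<open>S\<close>
    would be carried into \<open>R\<close> by the inclusion.\<close>
  show ?thesis
    using id.infinite_dimension_hom[OF K' one, of S] S.carrier_is_subalgebra[of K] KS fin by auto
qed

lemma finite_field_extension_subfield:
  assumes "ring R" "field K" "\<phi> \<in> ring_hom K R" "subring E R" "field (R\<lparr>carrier := E\<rparr>)"
    and "\<phi> ` carrier K \<subseteq> E" "ring.finite_dimension R (\<phi> ` carrier K) E"
  shows "finite_field_extension K (R\<lparr>carrier := E\<rparr>) \<phi>"
proof -
  interpret R: ring R by fact
  interpret K: field K by fact
  interpret E: field "R\<lparr>carrier := E\<rparr>" by fact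
  interpret h: ring_hom_ring K R \<phi>
    using assms by (intro ring_hom_ringI2) (auto simp: K.is_ring)
  have "\<one>\<^bsub>R\<^esub> \<noteq> \<zero>\<^bsub>R\<^esub>" using E.one_not_zero by simp
  then have "subfield (\<phi> ` carrier K) R"
    using h.img_is_subfield(2)[OF K.carrier_is_subfield] by simp
  then have "ring.finite_dimension (R\<lparr>carrier := E\<rparr>) (\<phi> ` carrier K) E"
    using assms by (intro R.subring_finite_dimension)
  moreover have "\<phi> \<in> ring_hom K (R\<lparr>carrier := E\<rparr>)"
    using assms(3,6) unfolding ring_hom_def by auto
  ultimately show ?thesis using assms(5) by (simp add: finite_field_extension_def)
qed

text \<open>Field homomorphisms are injective, so values can be pulled back. This one pullback
  serves the change of carrier type, the restriction to a subfield, and the comparison of two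
  embeddings of a simple extension.\<close>

lemma extends_valuation_comp:
  assumes w: "extends_valuation K v S \<psi> w" and R: "field R" and S: "field S" and h: "h \<in> ring_hom R S"
    and \<phi>: "\<phi> \<in> carrier K \<rightarrow> carrier R" and comp: "\<And>x. x \<in> carrier K \<Longrightarrow> h (\<phi> x) = \<psi> x"
  shows "extends_valuation K v R \<phi> (w \<circ> h)"
proof -
  interpret R: field R by fact
  interpret S: field S by fact
  interpret h: ring_hom_ring R S h
    using h by (intro ring_hom_ringI2) (auto simp: R.is_ring S.is_ring)
  have inj: "inj_on h (carrier R)"
    using h.non_trivial_field_hom_imp_inj[OF R] h.hom_one S.one_not_zero R.one_closed
    by (metis image_eqI singletonD)
  have nz: "h x \<in> nonzeros S" if "x \<in> nonzeros R" for x
    using that inj_onD[OF inj, of x "\<zero>\<^bsub>R\<^esub>"] by (auto simp: nonzeros_def)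
  have "valuation_on R (w \<circ> h)"
    unfolding valuation_on_def
  proof (intro conjI ballI impI)
    fix x y assume x: "x \<in> nonzeros R" and y: "y \<in> nonzeros R"
    then have c: "x \<in> carrier R" "y \<in> carrier R" by (auto simp: nonzeros_def)
    show "(w \<circ> h) (x \<otimes>\<^bsub>R\<^esub> y) = (w \<circ> h) x + (w \<circ> h) y"
      using w nz[OF x] nz[OF y] c by (simp add: extends_valuation_def valuation_on_def)
    assume "x \<oplus>\<^bsub>R\<^esub> y \<noteq> \<zero>\<^bsub>R\<^esub>"
    then have "h (x \<oplus>\<^bsub>R\<^esub> y) \<in> nonzeros S" using c nz[of "x \<oplus>\<^bsub>R\<^esub> y"] by (simp add: nonzeros_def)
    then show "min ((w \<circ> h) x) ((w \<circ> h) y) \<le> (w \<circ> h) (x \<oplus>\<^bsub>R\<^esub> y)"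
      using w nz[OF x] nz[OF y] c by (simp add: extends_valuation_def valuation_on_def nonzeros_def)
  qed
  moreover have "(w \<circ> h) (\<phi> x) = hull_of (v x)" if "x \<in> nonzeros K" for x
    using that w comp[of x] by (simp add: extends_valuation_def nonzeros_def)
  ultimately show ?thesis by (simp add: extends_valuation_def)
qed

text \<open>Coordinates with respect to a basis carry a finite extension over to the type of lists,
  to which the definition of a Henselian valuation is restricted.\<close>

lemma finite_field_extension_on_lists:
  fixes K :: "('a, 'b) ring_scheme" and E :: "('c, 'd) ring_scheme"
  assumes K: "field K" and ext: "finite_field_extension K E \<phi>"
  obtains L :: "'a list ring" and f where "f \<in> ring_iso E L" "finite_field_extension K L (f \<circ> \<phi>)"
proof -
  interpret K: field K by fact
  interpret E: field E using ext by (simp add: finite_field_extension_def)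
  have \<phi>: "\<phi> \<in> ring_hom K E" using ext by (simp add: finite_field_extension_def)
  interpret h: ring_hom_ring K E \<phi>
    using \<phi> by (intro ring_hom_ringI2) (auto simp: K.is_ring E.is_ring)
  let ?F = "\<phi> ` carrier K"
  have F: "subfield ?F E"
    using h.img_is_subfield(2)[OF K.carrier_is_subfield E.one_not_zero] by simp
  obtain n where n: "E.dimension n ?F (carrier E)"
    using ext by (auto simp: finite_field_extension_def elim: E.finite_dimensionE')
  then obtain Us where Us: "set Us \<subseteq> carrier E" "E.independent ?F Us" "E.Span ?F Us = carrier E"
    using E.exists_base[OF F] by blast
  define coord where "coord x = (THE Ks. set Ks \<subseteq> ?F \<and> length Ks = length Us \<and> x = E.combine Ks Us)" for x
  have coord: "set (coord x) \<subseteq> ?F" "x = E.combine (coord x) Us" if "x \<in> carrier E" for x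
    using theI'[OF E.unique_decomposition[OF F Us(2), of x]] that Us(3) by (auto simp: coord_def)
  define f where "f x = map (inv_into (carrier K) \<phi>) (coord x)" for x
  have inj: "inj_on f (carrier E)"
  proof (rule inj_onI)
    fix x y assume xy: "x \<in> carrier E" "y \<in> carrier E" "f x = f y"
    have "map \<phi> (f x) = coord x" if "x \<in> carrier E" for x
      using coord(1)[OF that] by (auto simp: f_def map_idI f_inv_into_f subset_iff)
    then have "coord x = coord y" using xy by metis
    then show "x = y" using coord(2) xy by metis
  qed
  let ?L = "image_ring f E"
  have iso: "f \<in> ring_iso E ?L" using inj_imp_image_ring_iso[OF inj] .
  interpret L: field ?L using E.inj_imp_image_ring_is_field[OF inj] .
  interpret f: ring_hom_ring E ?L f
    using iso by (intro ring_hom_ringI2) (auto simp: ring_iso_def E.is_ring L.is_ring)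
  have "L.dimension n (f ` ?F) (f ` carrier E)"
    by (rule f.inj_hom_dimension[OF F L.one_not_zero inj n])
  then have "L.finite_dimension ((f \<circ> \<phi>) ` carrier K) (carrier ?L)"
    by (simp add: image_comp image_ring_carrier L.finite_dimensionI)
  moreover have "f \<circ> \<phi> \<in> ring_hom K ?L"
    using \<phi> f.homh by (rule ring_hom_trans)
  ultimately have "finite_field_extension K ?L (f \<circ> \<phi>)"
    by (simp add: finite_field_extension_def L.field_axioms)
  with iso show thesis by (rule that)
qed

text \<open>Removes the restriction to the type of lists: pulling back along \<open>f\<close> and
  its inverse \<open>g\<close> matches the extensions of \<open>v\<close> to \<open>E\<close> with
  those to \<open>L\<close>.\<close>

lemma henselian_unique_extension:
  fixes E :: "('c, 'd) ring_scheme"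
  assumes K: "field K" and hens: "henselian K v" and ext: "finite_field_extension K E \<phi>"
  shows "\<exists>w. extends_valuation K v E \<phi> w \<and>
    (\<forall>w'. extends_valuation K v E \<phi> w' \<longrightarrow> (\<forall>x\<in>nonzeros E. w' x = w x))"
proof -
  obtain L :: "'a list ring" and f where f: "f \<in> ring_iso E L" and L: "finite_field_extension K L (f \<circ> \<phi>)"
    using finite_field_extension_on_lists[OF K ext] by blast
  have fE: "field E" and fL: "field L" and \<phi>: "\<phi> \<in> ring_hom K E"
    using ext L by (auto simp: finite_field_extension_def)
  interpret E: field E by fact
  define g where "g = inv_into (carrier E) f"
  have g: "g \<in> ring_hom L E" using ring_iso_set_sym[OF E.is_ring f] by (simp add: g_def ring_iso_def)
  have bij: "bij_betw f (carrier E) (carrier L)" and fh: "f \<in> ring_hom E L"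
    using f by (auto simp: ring_iso_def)
  have gf: "g (f x) = x" if "x \<in> carrier E" for x
    using bij that by (simp add: g_def bij_betw_def)
  have fc: "f x \<in> carrier L" if "x \<in> carrier E" for x using bij that by (auto simp: bij_betw_def)
  have \<phi>c: "\<phi> x \<in> carrier E" if "x \<in> carrier K" for x using \<phi> that by (simp add: ring_hom_closed)
  have fz: "f \<zero>\<^bsub>E\<^esub> = \<zero>\<^bsub>L\<^esub>"
    using ring_hom_zero[OF fh E.is_ring field.is_ring[OF fL]] .
  obtain w where w: "extends_valuation K v L (f \<circ> \<phi>) w"
    and u: "\<And>w' x. extends_valuation K v L (f \<circ> \<phi>) w' \<Longrightarrow> x \<in> nonzeros L \<Longrightarrow> w' x = w x"
    using hens L unfolding henselian_def by blast
  have "extends_valuation K v E \<phi> (w \<circ> f)"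
    using w fE fL fh by (rule extends_valuation_comp) (auto simp: \<phi>c)
  moreover have "w' x = (w \<circ> f) x" if w': "extends_valuation K v E \<phi> w'" and x: "x \<in> nonzeros E" for w' x
  proof -
    have "extends_valuation K v L (f \<circ> \<phi>) (w' \<circ> g)"
      using w' fL fE g by (rule extends_valuation_comp) (auto simp: \<phi>c fc gf)
    moreover have "f x \<in> nonzeros L"
      using x fc gf fz E.zero_closed unfolding nonzeros_def by (metis Diff_iff singletonD singletonI)
    ultimately have "(w' \<circ> g) (f x) = w (f x)" by (rule u)
    then show ?thesis using x gf by (simp add: nonzeros_def)
  qed
  ultimately show ?thesis by blast
qed

section \<open>Linear factors, separability of \<open>T^n - y\<close>, and conjugate roots\<close>

lemma (in domain) linear_poly_closed: "a \<in> carrier R \<Longrightarrow> [\<one>, \<ominus> a] \<in> carrier (poly_ring R)"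
  unfolding univ_poly_carrier[symmetric] polynomial_def by auto

lemma (in domain) eval_mult_closed:
  assumes "p \<in> carrier (poly_ring R)" "q \<in> carrier (poly_ring R)" "x \<in> carrier R"
  shows "eval (p \<otimes>\<^bsub>poly_ring R\<^esub> q) x = eval p x \<otimes> eval q x"
  using ring_hom_mult[OF eval_is_hom[OF carrier_is_subring assms(3)]] assms by simp

text \<open>The factor split off is monic, so the leading coefficient is kept while the degree drops
  by one. This drives the induction of \<open>eval_as_product\<close> and later produces a second
  root of a minimal polynomial.\<close>

lemma (in algebraically_closed) exists_root_poly:
  assumes "p \<in> carrier (poly_ring L)" "degree p > 0"
  obtains a q where "a \<in> carrier L" "q \<in> carrier (poly_ring L)" "q \<noteq> []"
    "p = [\<one>, \<ominus> a] \<otimes>\<^bsub>poly_ring L\<^esub> q" "degree p = Suc (degree q)" "lead_coeff p = lead_coeff q"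
proof -
  interpret UP: domain "poly_ring L" using univ_poly_is_domain[OF carrier_is_subring] .
  have p: "p \<noteq> []" using assms(2) by auto
  have "size (roots p) = degree p" using roots_over_carrier[OF assms(1)] by (simp add: splitted_def)
  then have "roots p \<noteq> {#}" using assms(2) by auto
  then obtain a where a: "a \<in> carrier L" "[\<one>, \<ominus> a] pdivides p"
    using not_empty_rootsE[OF assms(1)] by blast
  then obtain q where q: "q \<in> carrier (poly_ring L)" "p = [\<one>, \<ominus> a] \<otimes>\<^bsub>poly_ring L\<^esub> q"
    unfolding pdivides_def factor_def by blast
  note l = linear_poly_closed[OF a(1)]
  have q0: "q \<noteq> []"
  proof
    assume "q = []"
    then have "p = \<zero>\<^bsub>poly_ring L\<^esub>" using q(2) UP.r_null[OF l] by (simp add: univ_poly_zero)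
    then show False using p by (simp add: univ_poly_zero)
  qed
  have pp: "polynomial (carrier L) [\<one>, \<ominus> a]" "polynomial (carrier L) q"
    using l q(1) by (simp_all add: univ_poly_carrier)
  have "degree p = Suc (degree q)"
    using poly_mult_degree_eq[OF carrier_is_subring pp] q q0 by (simp add: univ_poly_mult)
  moreover have "lead_coeff p = lead_coeff q"
    using poly_mult_lead_coeff[OF carrier_is_subring pp] q q0 lead_coeff_in_carrier[OF carrier_is_subring, of "hd q" "tl q"] pp(2)
    by (simp add: univ_poly_mult)
  ultimately show thesis using a(1) q(1) q0 q(2) that by blast
qed

text \<open>Values suffice: at a candidate root the product decides membership in \<open>ts\<close>,
  and at one it locates a root among the one-units.\<close>

lemma (in algebraically_closed) eval_as_product:
  assumes "p \<in> carrier (poly_ring L)" "p \<noteq> []"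
  shows "\<exists>ts. set ts \<subseteq> carrier L \<and>
    (\<forall>z\<in>carrier L. eval p z = lead_coeff p \<otimes> foldr (\<lambda>t a. (z \<ominus> t) \<otimes> a) ts \<one>)"
  using assms
proof (induction "degree p" arbitrary: p)
  case 0
  then obtain c where p: "p = [c]" "c \<in> carrier L"
    unfolding univ_poly_carrier[symmetric] polynomial_def by (cases p) auto
  then show ?case by (intro exI[of _ "[]"]) auto
next
  case (Suc n)
  obtain a q where q: "a \<in> carrier L" "q \<in> carrier (poly_ring L)" "q \<noteq> []"
    "p = [\<one>, \<ominus> a] \<otimes>\<^bsub>poly_ring L\<^esub> q" "degree p = Suc (degree q)" "lead_coeff p = lead_coeff q"
    using exists_root_poly[of p] Suc.prems Suc.hyps(2) by (metis zero_less_Suc)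
  have nq: "n = degree q" using Suc.hyps(2) q(5) by linarith
  obtain ts where ts: "set ts \<subseteq> carrier L"
    "\<And>z. z \<in> carrier L \<Longrightarrow> eval q z = lead_coeff q \<otimes> foldr (\<lambda>t a. (z \<ominus> t) \<otimes> a) ts \<one>"
    using Suc.hyps(1)[OF nq q(2,3)] by blast
  have lc: "lead_coeff q \<in> carrier L"
    using q(2,3) lead_coeff_in_carrier[OF carrier_is_subring, of "hd q" "tl q"] by (simp add: univ_poly_carrier)
  have "eval p z = lead_coeff p \<otimes> foldr (\<lambda>t a. (z \<ominus> t) \<otimes> a) (a # ts) \<one>" if z: "z \<in> carrier L" for z
  proof -
    have c: "foldr (\<lambda>t a. (z \<ominus> t) \<otimes> a) ts \<one> \<in> carrier L"
      using ts(1) z by (induction ts) auto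
    have "eval p z = (z \<ominus> a) \<otimes> eval q z"
      unfolding q(4) using eval_mult_closed[OF linear_poly_closed[OF q(1)] q(2) z] q(1) z
      by (simp add: a_minus_def)
    then show ?thesis using ts(2)[OF z] c lc q(1,6) z by (simp add: m_lcomm)
  qed
  then show ?case using ts(1) q(1) by (intro exI[of _ "a # ts"]) auto
qed

text \<open>The coefficient list of \<open>T^n - y\<close>. At \<open>n = 0\<close> truncated
  subtraction yields \<open>T - y\<close>, the same list as at \<open>n = 1\<close>, whence the
  hypothesis \<open>n > 0\<close> below.\<close>

definition (in ring) power_minus_poly :: "nat \<Rightarrow> 'a \<Rightarrow> 'a list"
  where "power_minus_poly n y = \<one> # replicate (n - 1) \<zero> @ [\<ominus> y]"

lemma (in domain) power_minus_poly_closed: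
  assumes "subring K R" "y \<in> K"
  shows "power_minus_poly n y \<in> carrier (K[X])"
  using subringE[OF assms(1)] assms(2)
  unfolding univ_poly_carrier[symmetric] polynomial_def power_minus_poly_def by auto

lemma (in domain) eval_power_minus_poly:
  assumes "y \<in> carrier R" "z \<in> carrier R" "n > 0"
  shows "eval (power_minus_poly n y) z = z [^] n \<ominus> y"
  using assms eval_replicate[of "[\<ominus> y]" z "n - 1"] by (simp add: power_minus_poly_def a_minus_def)

text \<open>The case split comes from normalisation: for \<open>y = \<zero>\<close> the constant
  polynomial is the empty list, and only for nonzero \<open>y\<close> is \<open>[y]\<close> itself a
  polynomial.\<close>

lemma (in domain) power_minus_poly_eq:
  assumes y: "y \<in> carrier R" and n: "n > 0"
  shows "power_minus_poly n y = X [^]\<^bsub>poly_ring R\<^esub> n \<ominus>\<^bsub>poly_ring R\<^esub> poly_of_const y"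
proof (cases "y = \<zero>")
  case True
  interpret UP: domain "poly_ring R" using univ_poly_is_domain[OF carrier_is_subring] .
  have "power_minus_poly n y = monom \<one> n"
    using n True by (simp add: power_minus_poly_def monom_def replicate_append_same flip: replicate_Suc)
  moreover have "poly_of_const y = \<zero>\<^bsub>poly_ring R\<^esub>"
    using True by (simp add: poly_of_const_def univ_poly_zero)
  ultimately show ?thesis
    using unitary_monom_eq_var_pow[OF carrier_is_subring, of n] var_pow_closed[OF carrier_is_subring, of n]
    by (simp add: a_minus_def UP.minus_zero)
next
  case False
  interpret UP: domain "poly_ring R" using univ_poly_is_domain[OF carrier_is_subring] .
  have c: "[y] \<in> carrier (poly_ring R)" "[\<ominus> y] \<in> carrier (poly_ring R)"
    using y False unfolding univ_poly_carrier[symmetric] polynomial_def by auto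
  have "[\<ominus> y] \<oplus>\<^bsub>poly_ring R\<^esub> [y] = \<zero>\<^bsub>poly_ring R\<^esub>"
    using y by (simp add: univ_poly_add univ_poly_zero l_neg)
  then have m: "\<ominus>\<^bsub>poly_ring R\<^esub> [y] = [\<ominus> y]" using c by (metis UP.minus_equality)
  obtain k where k: "n = Suc k" using n by (cases n) auto
  have "map2 (\<oplus>) (\<one> # replicate n \<zero>) (replicate n \<zero> @ [\<ominus> y]) = \<one> # replicate k \<zero> @ [\<ominus> y]"
  proof -
    have "map2 (\<oplus>) (replicate k \<zero> @ [\<zero>]) (replicate k \<zero> @ [\<ominus> y]) = replicate k \<zero> @ [\<ominus> y]"
      using y by (simp add: zip_replicate)
    then show ?thesis by (simp add: k replicate_append_same)
  qed
  then have "poly_add (monom \<one> n) [\<ominus> y] = power_minus_poly n y"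
    by (simp add: monom_def power_minus_poly_def k)
  then show ?thesis
    using unitary_monom_eq_var_pow[OF carrier_is_subring, of n] m y False
    by (simp add: a_minus_def univ_poly_add poly_of_const_def)
qed

text \<open>A substitute for the derivative. The cofactor is a geometric sum, whose image is
  \<open>n c^(n-1)\<close> where the images of \<open>x\<close> and \<open>c\<close> agree;
  multiplying by \<open>h c\<close> avoids the exponent \<open>n - 1\<close>. It is applied with
  \<open>h\<close> the evaluation at \<open>t\<close>, \<open>x\<close> the variable and
  \<open>c\<close> the constant \<open>t\<close>.\<close>

lemma (in ring_hom_cring) power_minus_cofactor:
  assumes "x \<in> carrier R" "c \<in> carrier R" "h x = h c"
  shows "\<exists>s\<in>carrier R. x [^] n \<ominus> c [^] n = (x \<ominus> c) \<otimes> s \<and> h s \<otimes>\<^bsub>S\<^esub> h c = [n] \<cdot>\<^bsub>S\<^esub> (h c [^]\<^bsub>S\<^esub> (n::nat))"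
proof (induction n)
  case 0
  have "\<one> \<ominus> \<one> = (x \<ominus> c) \<otimes> \<zero>" using assms by (simp add: R.r_neg R.minus_eq)
  then show ?case using assms by (intro bexI[of _ \<zero>]) (auto simp: add_pow_def)
next
  case (Suc n)
  then obtain s where s: "s \<in> carrier R" "x [^] n \<ominus> c [^] n = (x \<ominus> c) \<otimes> s"
    "h s \<otimes>\<^bsub>S\<^esub> h c = [n] \<cdot>\<^bsub>S\<^esub> (h c [^]\<^bsub>S\<^esub> n)" by blast
  note cl = assms(1,2) s(1) R.nat_pow_closed[OF assms(1), of n] R.nat_pow_closed[OF assms(2), of n]
  have "x [^] Suc n \<ominus> c [^] Suc n = (x [^] n \<ominus> c [^] n) \<otimes> x \<oplus> c [^] n \<otimes> (x \<ominus> c)"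
    using cl by (simp, algebra)
  also have "\<dots> = (x \<ominus> c) \<otimes> (s \<otimes> x \<oplus> c [^] n)"
    unfolding s(2) using cl by algebra
  finally have 1: "x [^] Suc n \<ominus> c [^] Suc n = (x \<ominus> c) \<otimes> (s \<otimes> x \<oplus> c [^] n)" .
  have hc: "h c \<in> carrier S" "h s \<in> carrier S" using cl by auto
  have "h (s \<otimes> x \<oplus> c [^] n) \<otimes>\<^bsub>S\<^esub> h c = (h s \<otimes>\<^bsub>S\<^esub> h c) \<otimes>\<^bsub>S\<^esub> h c \<oplus>\<^bsub>S\<^esub> h c [^]\<^bsub>S\<^esub> Suc n"
    using cl assms(3) hc by (simp add: hom_nat_pow S.l_distr)
  also have "\<dots> = [Suc n] \<cdot>\<^bsub>S\<^esub> (h c [^]\<^bsub>S\<^esub> Suc n)"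
    unfolding s(3) using hc by (simp add: S.add_pow_ldistr)
  finally show ?case using 1 cl by (intro bexI[of _ "s \<otimes> x \<oplus> c [^] n"]) auto
qed

text \<open>Cancelling one factor \<open>T - t\<close> identifies the cofactor \<open>s\<close> of
  \<open>T^n - t^n\<close> with \<open>(T - t) q\<close>. The latter vanishes at \<open>t\<close>,
  while \<open>s\<close> takes there a value whose product with \<open>t\<close> is
  \<open>n t^n\<close>, which is nonzero.\<close>

lemma (in domain) power_minus_poly_no_double_root:
  assumes t: "t \<in> carrier R" "t \<noteq> \<zero>" and n: "n > 0" "[n] \<cdot> \<one> \<noteq> \<zero>" and q: "q \<in> carrier (poly_ring R)"
  shows "power_minus_poly n (t [^] n) \<noteq>
    [\<one>, \<ominus> t] \<otimes>\<^bsub>poly_ring R\<^esub> ([\<one>, \<ominus> t] \<otimes>\<^bsub>poly_ring R\<^esub> q)"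
proof
  assume eq: "power_minus_poly n (t [^] n) =
    [\<one>, \<ominus> t] \<otimes>\<^bsub>poly_ring R\<^esub> ([\<one>, \<ominus> t] \<otimes>\<^bsub>poly_ring R\<^esub> q)"
  interpret UP: domain "poly_ring R" using univ_poly_is_domain[OF carrier_is_subring] .
  interpret ev: ring_hom_cring "poly_ring R" R "\<lambda>p. eval p t"
    using eval_cring_hom[OF carrier_is_subring t(1)] .
  let ?c = "poly_of_const t"
  have c: "?c \<in> carrier (poly_ring R)"
    using t unfolding univ_poly_carrier[symmetric] polynomial_def poly_of_const_def by auto
  have X: "X \<in> carrier (poly_ring R)" using var_closed(1)[OF carrier_is_subring] .
  have ec: "eval ?c t = t" using t by (simp add: poly_of_const_def)
  have eX: "eval X t = t" using eval_var[OF t(1)] .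
  have cn: "poly_of_const (t [^] n) = ?c [^]\<^bsub>poly_ring R\<^esub> n"
  proof (induction n)
    case (Suc n)
    have "poly_of_const (t [^] n \<otimes> t) = poly_of_const (t [^] n) \<otimes>\<^bsub>poly_ring R\<^esub> ?c"
      using ring_hom_mult[OF canonical_embedding_is_hom[OF carrier_is_subring], of "t [^] n" t] t(1) by simp
    then show ?case using Suc by simp
  qed (simp add: poly_of_const_def univ_poly_one)
  have lin: "[\<one>, \<ominus> t] = X \<ominus>\<^bsub>poly_ring R\<^esub> ?c"
    using power_minus_poly_eq[OF t(1), of 1] X by (simp add: power_minus_poly_def)
  obtain s where s: "s \<in> carrier (poly_ring R)"
    "X [^]\<^bsub>poly_ring R\<^esub> n \<ominus>\<^bsub>poly_ring R\<^esub> ?c [^]\<^bsub>poly_ring R\<^esub> n = (X \<ominus>\<^bsub>poly_ring R\<^esub> ?c) \<otimes>\<^bsub>poly_ring R\<^esub> s"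
    "eval s t \<otimes> t = [n] \<cdot> (t [^] n)"
    using ev.power_minus_cofactor[OF X c, of n] ec eX by auto
  have l: "[\<one>, \<ominus> t] \<in> carrier (poly_ring R)" using linear_poly_closed[OF t(1)] .
  have "[\<one>, \<ominus> t] \<otimes>\<^bsub>poly_ring R\<^esub> s = [\<one>, \<ominus> t] \<otimes>\<^bsub>poly_ring R\<^esub> ([\<one>, \<ominus> t] \<otimes>\<^bsub>poly_ring R\<^esub> q)"
    using eq power_minus_poly_eq[of "t [^] n" n] t(1) n(1) s(2) by (simp add: cn lin)
  then have "s = [\<one>, \<ominus> t] \<otimes>\<^bsub>poly_ring R\<^esub> q"
    using UP.m_lcancel[of "[\<one>, \<ominus> t]" s "[\<one>, \<ominus> t] \<otimes>\<^bsub>poly_ring R\<^esub> q"] l s(1) q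
    by (simp add: univ_poly_zero)
  then have "eval s t = (t \<ominus> t) \<otimes> eval q t"
    using eval_mult_closed[OF l q t(1)] t(1) by (simp add: a_minus_def)
  moreover have "eval q t \<in> carrier R" using ev.hom_closed[OF q] .
  ultimately have "eval s t = \<zero>" using t(1) by (simp add: a_minus_def r_neg)
  then have "[n] \<cdot> (t [^] n) = \<zero>" using s(3) t(1) by simp
  then have "([n] \<cdot> \<one>) \<otimes> t [^] n = \<zero>" using t(1) add_pow_ldistr[of \<one> "t [^] n" n] by simp
  moreover have "t [^] n \<noteq> \<zero>"
  proof (induction n)
    case (Suc n)
    then show ?case using integral[of "t [^] n" t] t by auto
  qed simp
  ultimately show False using integral[of "[n] \<cdot> \<one>" "t [^] n"] n(2) t(1) by auto
qed

text \<open>The elements of \<open>F(t)\<close> are the values \<open>p(t)\<close>. Sending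
  \<open>p(t)\<close> to \<open>p(t')\<close> is well defined, because the minimal polynomial of
  \<open>t\<close> divides the difference of two representatives and has \<open>t'\<close> as a
  root.\<close>

lemma (in domain) conjugate_hom:
  assumes F: "subfield F R" and t: "t \<in> carrier R" "(algebraic over F) t"
    and t': "t' \<in> carrier R" and root: "eval (Irr F t) t' = \<zero>"
  obtains \<sigma> where "\<sigma> \<in> ring_hom (R\<lparr>carrier := simple_extension F t\<rparr>) R"
    "\<And>p. p \<in> carrier (F[X]) \<Longrightarrow> \<sigma> (eval p t) = eval p t'"
proof -
  have sF: "subring F R" using subfieldE(1)[OF F] .
  interpret UP: domain "F[X]" using univ_poly_is_domain[OF sF] .
  interpret et: ring_hom_ring "F[X]" R "\<lambda>p. eval p t"
    using eval_ring_hom[OF sF t(1)] .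
  interpret et': ring_hom_ring "F[X]" R "\<lambda>p. eval p t'"
    using eval_ring_hom[OF sF t'] .
  have wd: "eval p t' = eval q t'" if p: "p \<in> carrier (F[X])" and q: "q \<in> carrier (F[X])"
    and eq: "eval p t = eval q t" for p q
  proof -
    have pq: "p \<ominus>\<^bsub>F[X]\<^esub> q \<in> carrier (F[X])" using p q by simp
    have "eval (p \<ominus>\<^bsub>F[X]\<^esub> q) t = \<zero>"
      using p q eq et.hom_closed[OF q] by (simp add: UP.minus_eq r_neg)
    then have "Irr F t pdivides (p \<ominus>\<^bsub>F[X]\<^esub> q)" using Irr_minimal[OF F t pq] by simp
    then have "eval (p \<ominus>\<^bsub>F[X]\<^esub> q) t' = \<zero>"
      using pdivides_imp_root_sharing[OF carrier_polynomial_shell[OF sF IrrE(1)[OF F t]] _ t' root] by simp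
    then show ?thesis
      using p q et'.hom_closed[OF p] et'.hom_closed[OF q]
      by (simp add: UP.minus_eq flip: minus_eq)
  qed
  define \<sigma> where "\<sigma> y = eval (SOME p. p \<in> carrier (F[X]) \<and> eval p t = y) t'" for y
  have \<sigma>: "\<sigma> (eval p t) = eval p t'" if p: "p \<in> carrier (F[X])" for p
  proof -
    have "(SOME q. q \<in> carrier (F[X]) \<and> eval q t = eval p t) \<in> carrier (F[X]) \<and>
        eval (SOME q. q \<in> carrier (F[X]) \<and> eval q t = eval p t) t = eval p t"
      by (rule someI[of _ p]) (simp add: p)
    then show ?thesis unfolding \<sigma>_def using wd p by blast
  qed
  have ext: "\<exists>p\<in>carrier (F[X]). y = eval p t" if "y \<in> simple_extension F t" for y
    using that simple_extension_as_eval_img[OF subringE(1)[OF sF] t(1)] by auto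
  have "\<sigma> \<in> ring_hom (R\<lparr>carrier := simple_extension F t\<rparr>) R"
  proof (rule ring_hom_memI)
    fix x y assume x: "x \<in> carrier (R\<lparr>carrier := simple_extension F t\<rparr>)"
      and y: "y \<in> carrier (R\<lparr>carrier := simple_extension F t\<rparr>)"
    obtain p where p: "p \<in> carrier (F[X])" "x = eval p t" using ext[of x] x by auto
    obtain q where q: "q \<in> carrier (F[X])" "y = eval q t" using ext[of y] y by auto
    have m: "x \<otimes> y = eval (p \<otimes>\<^bsub>F[X]\<^esub> q) t" and a: "x \<oplus> y = eval (p \<oplus>\<^bsub>F[X]\<^esub> q) t"
      using p q by auto
    have "\<sigma> (x \<otimes> y) = \<sigma> x \<otimes> \<sigma> y"
      unfolding m unfolding p(2) q(2) using p(1) q(1) by (simp add: \<sigma> del: et.hom_mult)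
    then show "\<sigma> (x \<otimes>\<^bsub>R\<lparr>carrier := simple_extension F t\<rparr>\<^esub> y) = \<sigma> x \<otimes> \<sigma> y" by simp
    have "\<sigma> (x \<oplus> y) = \<sigma> x \<oplus> \<sigma> y"
      unfolding a unfolding p(2) q(2) using p(1) q(1) by (simp add: \<sigma> del: et.hom_add)
    then show "\<sigma> (x \<oplus>\<^bsub>R\<lparr>carrier := simple_extension F t\<rparr>\<^esub> y) = \<sigma> x \<oplus> \<sigma> y" by simp
    show "\<sigma> x \<in> carrier R" using p \<sigma> by simp
  next
    have "\<sigma> (eval \<one>\<^bsub>F[X]\<^esub> t) = eval \<one>\<^bsub>F[X]\<^esub> t'" by (rule \<sigma>) simp
    then show "\<sigma> \<one>\<^bsub>R\<lparr>carrier := simple_extension F t\<rparr>\<^esub> = \<one>"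
      by simp
  qed
  then show thesis using \<sigma> that by blast
qed

lemma (in ring) minus_consistent:
  assumes "subring H R" "a \<in> H" "b \<in> H"
  shows "a \<ominus>\<^bsub>R\<lparr>carrier := H\<rparr>\<^esub> b = a \<ominus> b"
proof -
  interpret H: ring "R\<lparr>carrier := H\<rparr>" using subring_is_ring[OF assms(1)] .
  have "\<ominus>\<^bsub>R\<lparr>carrier := H\<rparr>\<^esub> b \<oplus> b = \<zero>"
    using H.l_neg[of b] assms(3) by simp
  moreover have "\<ominus>\<^bsub>R\<lparr>carrier := H\<rparr>\<^esub> b \<in> carrier R" "b \<in> carrier R"
    using H.a_inv_closed[of b] assms(3) subringE(1)[OF assms(1)] by auto
  ultimately have "\<ominus>\<^bsub>R\<lparr>carrier := H\<rparr>\<^esub> b = \<ominus> b" by (simp add: minus_equality)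
  then show ?thesis by (simp add: a_minus_def)
qed

text \<open>Since \<open>t\<close> is not in \<open>F\<close>, its minimal polynomial has degree at
  least two and retains a root \<open>s\<close> after removal of \<open>T - t\<close>. If
  \<open>s = t\<close>, then the multiple \<open>T^n - t^n\<close> would have a double root at
  \<open>t\<close>, which is excluded as \<open>n\<close> is nonzero in the field.\<close>

lemma (in algebraically_closed) separable_other_root:
  assumes F: "subfield F L" and t: "t \<in> carrier L" "(algebraic over F) t" "t \<notin> F" "t \<noteq> \<zero>"
    and n: "n > 0" "[n] \<cdot> \<one> \<noteq> \<zero>" and tn: "t [^] (n::nat) \<in> F"
  obtains t' where "t' \<in> carrier L" "t' \<noteq> t" "eval (Irr F t) t' = \<zero>" "t' [^] n = t [^] n"
proof -
  interpret UP: domain "poly_ring L" using univ_poly_is_domain[OF carrier_is_subring] .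
  have sF: "subring F L" using subfieldE(1)[OF F] .
  let ?g = "Irr F t" and ?P = "power_minus_poly n (t [^] n)"
  note g = IrrE[OF F t(1,2)]
  have gc: "?g \<in> carrier (poly_ring L)" using carrier_polynomial_shell[OF sF g(1)] .
  have tnc: "t [^] n \<in> carrier L" using t(1) by simp
  have P: "?P \<in> carrier (F[X])" "?P \<in> carrier (poly_ring L)"
    using power_minus_poly_closed[OF sF tn] carrier_polynomial_shell[OF sF] by auto
  have "eval ?P t = \<zero>"
    using eval_power_minus_poly[OF tnc t(1) n(1)] tnc by (simp add: a_minus_def r_neg)
  then have gP: "?g pdivides ?P" using Irr_minimal[OF F t(1,2) P(1)] by simp
  have fin: thesis if "t' \<in> carrier L" "t' \<noteq> t" "eval ?g t' = \<zero>" for t'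
  proof -
    have "eval ?P t' = \<zero>" using pdivides_imp_root_sharing[OF gc gP that(1,3)] .
    then have "t' [^] n = t [^] n"
      using eval_power_minus_poly[OF tnc that(1) n(1)] that(1) tnc by (simp add: r_right_minus_eq)
    then show thesis using that \<open>\<And>t'. \<lbrakk>t' \<in> carrier L; t' \<noteq> t; eval ?g t' = \<zero>; t' [^] n = t [^] n\<rbrakk> \<Longrightarrow> thesis\<close> by blast
  qed
  have deg: "degree ?g \<ge> 2"
  proof (rule ccontr)
    assume "\<not> degree ?g \<ge> 2"
    then have "degree ?g = 1" using pirreducible_degree[OF F g(1,2)] by linarith
    then have "length ?g = Suc (Suc 0)" by simp
    then obtain a b where ab: "?g = [a, b]" by (metis length_0_conv length_Suc_conv)
    have b: "b \<in> F" using g(1) unfolding univ_poly_carrier[symmetric] polynomial_def ab by simp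
    have bc: "b \<in> carrier L" using subfieldE(3)[OF F] b by auto
    have "t \<oplus> b = \<zero>" using g(3,4) t(1) bc by (simp add: ab)
    then have "t = \<ominus> b" using t(1) bc minus_equality by simp
    then show False using t(3) subringE(5)[OF sF b] by simp
  qed
  note l = linear_poly_closed[OF t(1)]
  have "?g \<noteq> []" using deg by auto
  then have "[\<one>, \<ominus> t] pdivides ?g"
    using is_root_imp_pdivides[OF gc] g(4) t(1) by (simp add: is_root_def)
  then obtain q where q: "q \<in> carrier (poly_ring L)" "?g = [\<one>, \<ominus> t] \<otimes>\<^bsub>poly_ring L\<^esub> q"
    unfolding pdivides_def factor_def by blast
  have q0: "q \<noteq> []"
  proof
    assume "q = []"
    then have "?g = \<zero>\<^bsub>poly_ring L\<^esub>" using q(2) UP.r_null[OF l] by (simp add: univ_poly_zero)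
    then show False using \<open>?g \<noteq> []\<close> by (simp add: univ_poly_zero)
  qed
  have "degree ?g = Suc (degree q)"
    using poly_mult_degree_eq[OF carrier_is_subring, of "[\<one>, \<ominus> t]" q] l q q0
    by (simp add: univ_poly_mult univ_poly_carrier)
  then have "degree q > 0" using deg by simp
  then obtain s r where s: "s \<in> carrier L" "r \<in> carrier (poly_ring L)"
    "q = [\<one>, \<ominus> s] \<otimes>\<^bsub>poly_ring L\<^esub> r"
    using exists_root_poly[OF q(1)] by metis
  note ls = linear_poly_closed[OF s(1)]
  have "eval q s = (s \<ominus> s) \<otimes> eval r s"
    unfolding s(3) using eval_mult_closed[OF ls s(2,1)] s(1) by (simp add: a_minus_def)
  moreover have "eval r s \<in> carrier L"
    using ring_hom_closed[OF eval_is_hom[OF carrier_is_subring s(1)] s(2)] .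
  ultimately have "eval q s = \<zero>" using s(1) by (simp add: a_minus_def r_neg)
  then have gs: "eval ?g s = \<zero>"
    unfolding q(2) using eval_mult_closed[OF l q(1) s(1)] s(1) t(1) by (simp add: a_minus_def)
  show thesis
  proof (cases "s = t")
    case False
    then show ?thesis using fin s(1) gs by blast
  next
    case True
    obtain u where u: "u \<in> carrier (poly_ring L)" "?P = ?g \<otimes>\<^bsub>poly_ring L\<^esub> u"
      using gP unfolding pdivides_def factor_def by blast
    have "?P = [\<one>, \<ominus> t] \<otimes>\<^bsub>poly_ring L\<^esub> ([\<one>, \<ominus> t] \<otimes>\<^bsub>poly_ring L\<^esub> (r \<otimes>\<^bsub>poly_ring L\<^esub> u))"
      unfolding u(2) q(2) s(3) True using l s(2) u(1) by (simp add: UP.m_assoc)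
    then show ?thesis
      using power_minus_poly_no_double_root[OF t(1,4) n UP.m_closed[OF s(2) u(1)]] by simp
  qed
qed

text \<open>In a splitting field of \<open>T\<^sup>n - x\<close> some root \<open>t\<close> is a one-unit. If it were not in \<open>L\<close>, a
  conjugate \<open>t'\<close> would give a second extension of the valuation to \<open>L(t)\<close>; by uniqueness \<open>t'\<close>
  is then a one-unit too, contradicting the uniqueness of \<open>n\<close>-th roots among one-units.\<close>

lemma henselian_root:
  fixes L :: "('c, 'd) ring_scheme"
  assumes K: "field K" and hens: "henselian K v"
    and L: "finite_field_extension K L \<phi>" and w: "extends_valuation K v L \<phi> w"
    and n: "[n] \<cdot>\<^bsub>L\<^esub> \<one>\<^bsub>L\<^esub> \<notin> val_ideal L w" and x: "x \<in> one_plus_ideal L w"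
  shows "\<exists>t\<in>one_plus_ideal L w. t [^]\<^bsub>L\<^esub> (n::nat) = x"
proof -
  interpret K: field K by fact
  interpret L: field L using L by (simp add: finite_field_extension_def)
  have \<phi>: "\<phi> \<in> ring_hom K L" using L by (simp add: finite_field_extension_def)
  interpret L: skew_field L by (rule L.field_division_ring)
  interpret L: valued_division_ring L w
    using w by unfold_locales (simp add: extends_valuation_def)
  have n0: "n > 0" using n L.zero_M by (cases n) (auto simp: add_pow_def)
  obtain \<Omega> :: "(('c list \<times> nat) multiset \<Rightarrow> 'c) ring" and \<iota>
    where \<iota>: "\<iota> \<in> ring_hom L \<Omega>" and clo: "algebraic_closure \<Omega> (\<iota> ` carrier L)"
    using L.alg_closureE by blast
  define F where "F = \<iota> ` carrier L"
  interpret \<Omega>: algebraic_closure \<Omega> F using clo by (simp add: F_def)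
  interpret \<iota>: ring_hom_ring L \<Omega> \<iota>
    using \<iota> by (intro ring_hom_ringI2) (auto simp: L.is_ring \<Omega>.is_ring)
  have F: "subfield F \<Omega>" using \<Omega>.subfield_axioms .
  have Fc: "F \<subseteq> carrier \<Omega>" using subfieldE(3)[OF F] .
  have \<iota>c: "\<iota> z \<in> F" if "z \<in> carrier L" for z using that by (simp add: F_def)
  have \<iota>inj: "inj_on \<iota> (carrier L)"
    using \<iota>.non_trivial_field_hom_imp_inj[OF L.field_axioms] \<iota>.hom_one \<Omega>.one_not_zero L.one_closed
    by (metis image_eqI singletonD)
  have \<iota>nz: "\<iota> z \<noteq> \<zero>\<^bsub>\<Omega>\<^esub>" if "z \<in> carrier L" "z \<noteq> \<zero>\<^bsub>L\<^esub>" for z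
    using inj_onD[OF \<iota>inj, of z "\<zero>\<^bsub>L\<^esub>"] that by auto
  have alg: "(\<Omega>.algebraic over F) z" if "z \<in> carrier \<Omega>" for z
    using \<Omega>.algebraic_extension[OF that] .
  let ?\<psi> = "\<iota> \<circ> \<phi>"
  have \<psi>: "?\<psi> \<in> ring_hom K \<Omega>" using \<phi> \<iota> by (rule ring_hom_trans)
  have \<psi>F: "?\<psi> ` carrier K \<subseteq> F" using \<phi> \<iota>c by (auto simp: ring_hom_closed)
  interpret \<phi>: ring_hom_ring K L \<phi>
    using \<phi> by (intro ring_hom_ringI2) (auto simp: L.is_ring K.is_ring)
  interpret \<psi>: ring_hom_ring K \<Omega> ?\<psi>
    using \<psi> by (intro ring_hom_ringI2) (auto simp: \<Omega>.is_ring K.is_ring)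
  have \<phi>K: "subfield (\<phi> ` carrier K) L"
    using \<phi>.img_is_subfield(2)[OF K.carrier_is_subfield L.one_not_zero] .
  have \<psi>K: "subfield (?\<psi> ` carrier K) \<Omega>"
    using \<psi>.img_is_subfield(2)[OF K.carrier_is_subfield \<Omega>.one_not_zero] .
  obtain d where "L.dimension d (\<phi> ` carrier K) (carrier L)"
    using L by (auto simp: finite_field_extension_def elim: L.finite_dimensionE')
  then have "\<Omega>.dimension d (\<iota> ` \<phi> ` carrier K) (\<iota> ` carrier L)"
    using \<iota>.inj_hom_dimension[OF \<phi>K \<Omega>.one_not_zero \<iota>inj] by simp
  then have dimF: "\<Omega>.dimension d (?\<psi> ` carrier K) F" by (simp add: F_def image_comp)
  \<comment> \<open>The Henselian property speaks about extensions of \<open>K\<close>, so finite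
    extensions of \<open>F\<close> are regarded over \<open>K\<close> through the tower.\<close>
  have fin_ext: "finite_field_extension K (\<Omega>\<lparr>carrier := E\<rparr>) ?\<psi>"
    if E: "subfield E \<Omega>" "F \<subseteq> E" "\<Omega>.finite_dimension F E" for E
  proof -
    obtain e where "\<Omega>.dimension e F E" using E(3) by (elim \<Omega>.finite_dimensionE')
    then have "\<Omega>.finite_dimension (?\<psi> ` carrier K) E"
      using \<Omega>.telescopic_base[OF \<psi>K F dimF] by (intro \<Omega>.finite_dimensionI)
    then show ?thesis
      using \<psi>F E(2) \<Omega>.subfield_iff(2)[OF E(1)] subfieldE(1)[OF E(1)]
      by (intro finite_field_extension_subfield[OF \<Omega>.is_ring K \<psi>]) auto
  qed
  define y where "y = \<iota> x"
  have xc: "x \<in> carrier L" using L.U_carrier[OF x] .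
  have y: "y \<in> F" "y \<in> carrier \<Omega>" "y \<noteq> \<zero>\<^bsub>\<Omega>\<^esub>"
    using \<iota>c[OF xc] Fc \<iota>nz[OF xc L.U_nz[OF x]] by (auto simp: y_def)
  let ?P = "\<Omega>.power_minus_poly n y"
  have P: "?P \<in> carrier (F[X]\<^bsub>\<Omega>\<^esub>)" "?P \<in> carrier (poly_ring \<Omega>)"
    using \<Omega>.power_minus_poly_closed[OF subfieldE(1)[OF F] y(1)]
      \<Omega>.power_minus_poly_closed[OF \<Omega>.carrier_is_subring y(2)] by auto
  obtain ts where ts: "set ts \<subseteq> carrier \<Omega>"
    "\<And>z. z \<in> carrier \<Omega> \<Longrightarrow> \<Omega>.eval ?P z =
      hd ?P \<otimes>\<^bsub>\<Omega>\<^esub> foldr (\<lambda>t a. (z \<ominus>\<^bsub>\<Omega>\<^esub> t) \<otimes>\<^bsub>\<Omega>\<^esub> a) ts \<one>\<^bsub>\<Omega>\<^esub>"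
    using \<Omega>.eval_as_product[OF P(2)] by (auto simp: \<Omega>.power_minus_poly_def)
  have prod_c: "foldr (\<lambda>t a. (z \<ominus>\<^bsub>\<Omega>\<^esub> t) \<otimes>\<^bsub>\<Omega>\<^esub> a) us \<one>\<^bsub>\<Omega>\<^esub> \<in> carrier \<Omega>"
    if "set us \<subseteq> carrier \<Omega>" "z \<in> carrier \<Omega>" for us z
    using that by (induction us) auto
  have fac: "z [^]\<^bsub>\<Omega>\<^esub> n \<ominus>\<^bsub>\<Omega>\<^esub> y = foldr (\<lambda>t a. (z \<ominus>\<^bsub>\<Omega>\<^esub> t) \<otimes>\<^bsub>\<Omega>\<^esub> a) ts \<one>\<^bsub>\<Omega>\<^esub>"
    if "z \<in> carrier \<Omega>" for z
    using ts(2)[OF that] \<Omega>.eval_power_minus_poly[OF y(2) that n0] prod_c[OF ts(1) that]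
    by (simp add: \<Omega>.power_minus_poly_def)
  have root: "z \<in> set ts \<longleftrightarrow> z [^]\<^bsub>\<Omega>\<^esub> n = y" if z: "z \<in> carrier \<Omega>" for z
  proof -
    have "foldr (\<lambda>t a. (z \<ominus>\<^bsub>\<Omega>\<^esub> t) \<otimes>\<^bsub>\<Omega>\<^esub> a) us \<one>\<^bsub>\<Omega>\<^esub> = \<zero>\<^bsub>\<Omega>\<^esub> \<longleftrightarrow> z \<in> set us"
      if "set us \<subseteq> carrier \<Omega>" for us
      using that
    proof (induction us)
      case (Cons u us)
      then show ?case using z prod_c[of us z] \<Omega>.integral_iff by auto
    qed simp
    from this[OF ts(1)] show ?thesis
      using \<Omega>.r_right_minus_eq[of "z [^]\<^bsub>\<Omega>\<^esub> n" y] fac[OF z] z y(2) by simp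
  qed
  \<comment> \<open>All roots are adjoined, so that every conjugate of a root lies in one and the
    same valued field.\<close>
  define E where "E = \<Omega>.finite_extension F ts"
  have E: "subfield E \<Omega>" "F \<subseteq> E" "\<Omega>.finite_dimension F E" "set ts \<subseteq> E"
    unfolding E_def using ts(1) alg
    by (intro \<Omega>.finite_extension_is_subfield[OF F] \<Omega>.finite_extension_incl[OF Fc]
        \<Omega>.finite_extension_finite_dimension(1)[OF F] \<Omega>.finite_extension_mem[OF subfieldE(1)[OF F]]; blast)+
  let ?E = "\<Omega>\<lparr>carrier := E\<rparr>"
  have fE: "field ?E" using \<Omega>.subfield_iff(2)[OF E(1)] .
  interpret E: field ?E by (rule fE)
  obtain wE where wE: "extends_valuation K v ?E ?\<psi> wE"
    using henselian_unique_extension[OF K hens fin_ext[OF E(1-3)]] by blast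
  interpret E: skew_field ?E by (rule E.field_division_ring)
  interpret E: valued_division_ring ?E wE
    using wE by unfold_locales (simp add: extends_valuation_def)
  have pE: "z [^]\<^bsub>?E\<^esub> (k::nat) = z [^]\<^bsub>\<Omega>\<^esub> k" for z k by (simp add: nat_pow_def)
  have mE: "a \<ominus>\<^bsub>?E\<^esub> b = a \<ominus>\<^bsub>\<Omega>\<^esub> b" if "a \<in> E" "b \<in> E" for a b
    using \<Omega>.minus_consistent[OF subfieldE(1)[OF E(1)] that] .
  \<comment> \<open>Uniqueness over \<open>L\<close> forces \<open>wE\<close> to restrict to the
    given \<open>w\<close>; one-units of \<open>L\<close> and of \<open>E\<close> can then be
    compared.\<close>
  have wE_\<iota>: "wE (\<iota> z) = w z" if z: "z \<in> carrier L" "z \<noteq> \<zero>\<^bsub>L\<^esub>" for z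
  proof -
    have "\<iota> \<in> ring_hom L ?E" using \<iota> \<iota>c E(2) unfolding ring_hom_def by auto
    then have "extends_valuation K v L \<phi> (wE \<circ> \<iota>)"
      using wE L.field_axioms fE by (intro extends_valuation_comp[of K v ?E ?\<psi>]) auto
    then have "(wE \<circ> \<iota>) z = w z"
      using henselian_unique_extension[OF K hens L] w z by (metis nonzeros_iff)
    then show ?thesis by simp
  qed
  have M_\<iota>: "\<iota> z \<in> E.M \<longleftrightarrow> z \<in> L.M" if z: "z \<in> carrier L" for z
    using wE_\<iota>[of z] \<iota>nz[of z] \<iota>c[of z] E(2) z by (cases "z = \<zero>\<^bsub>L\<^esub>") (auto simp: E.M_iff L.M_iff)
  have U_\<iota>: "\<iota> z \<in> E.U \<longleftrightarrow> z \<in> L.U" if z: "z \<in> carrier L" for z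
  proof -
    have "\<iota> z \<ominus>\<^bsub>?E\<^esub> \<one>\<^bsub>?E\<^esub> = \<iota> (z \<ominus>\<^bsub>L\<^esub> \<one>\<^bsub>L\<^esub>)"
      using mE[of "\<iota> z" "\<one>\<^bsub>\<Omega>\<^esub>"] E.one_closed \<iota>c[OF z] E(2) z
      by (simp add: L.minus_eq \<Omega>.minus_eq subset_iff)
    then show ?thesis using M_\<iota>[of "z \<ominus>\<^bsub>L\<^esub> \<one>\<^bsub>L\<^esub>"] z \<iota>c[OF z] E(2) by (auto simp: E.U_iff L.U_iff)
  qed
  have nat_\<iota>: "\<iota> ([k] \<cdot>\<^bsub>L\<^esub> \<one>\<^bsub>L\<^esub>) = [k] \<cdot>\<^bsub>?E\<^esub> \<one>\<^bsub>?E\<^esub>" for k :: nat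
    by (induction k) (use L.add.nat_pow_closed[OF L.one_closed] in \<open>simp_all add: add_pow_def\<close>)
  have nE: "[n] \<cdot>\<^bsub>?E\<^esub> \<one>\<^bsub>?E\<^esub> \<notin> E.M"
    using M_\<iota>[of "[n] \<cdot>\<^bsub>L\<^esub> \<one>\<^bsub>L\<^esub>"] n by (simp add: nat_\<iota>)
  have n\<Omega>: "[n] \<cdot>\<^bsub>\<Omega>\<^esub> \<one>\<^bsub>\<Omega>\<^esub> \<noteq> \<zero>\<^bsub>\<Omega>\<^esub>"
    using nE E.zero_M by (auto simp: add_pow_def nat_pow_def)
  have yU: "y \<in> E.U" using U_\<iota>[OF xc] x by (simp add: y_def)
  have oneE: "\<one>\<^bsub>\<Omega>\<^esub> \<in> E" using E.one_closed by simp
  have UE: "z \<in> E.U \<longleftrightarrow> z \<in> E \<and> z \<ominus>\<^bsub>\<Omega>\<^esub> \<one>\<^bsub>\<Omega>\<^esub> \<in> E.M" for z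
    using mE[of z "\<one>\<^bsub>\<Omega>\<^esub>"] oneE by (auto simp: E.U_iff)
  have M_swap: "b \<ominus>\<^bsub>\<Omega>\<^esub> a \<in> E.M" if "a \<ominus>\<^bsub>\<Omega>\<^esub> b \<in> E.M" "a \<in> E" "b \<in> E" for a b
    using E.M_swap[of a b] that mE by simp
  \<comment> \<open>The product of all \<open>1 - t\<close> equals \<open>1 - y\<close>, which lies
    in the maximal ideal, so some factor does.\<close>
  have "\<exists>t\<in>set ts. t \<in> E.U"
  proof (rule ccontr)
    assume no: "\<not> (\<exists>t\<in>set ts. t \<in> E.U)"
    have "foldr (\<lambda>t a. (\<one>\<^bsub>\<Omega>\<^esub> \<ominus>\<^bsub>\<Omega>\<^esub> t) \<otimes>\<^bsub>\<Omega>\<^esub> a) us \<one>\<^bsub>\<Omega>\<^esub> \<in> E - E.M" if "set us \<subseteq> set ts" for us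
      using that
    proof (induction us)
      case Nil
      then show ?case using oneE E.one_notin_M by simp
    next
      case (Cons u us)
      have u: "u \<in> set ts" "u \<in> E" using Cons.prems E(4) by auto
      have "u \<notin> E.U" using no u by blast
      then have "u \<ominus>\<^bsub>\<Omega>\<^esub> \<one>\<^bsub>\<Omega>\<^esub> \<notin> E.M" using u by (simp add: UE)
      then have "\<one>\<^bsub>\<Omega>\<^esub> \<ominus>\<^bsub>\<Omega>\<^esub> u \<notin> E.M" using M_swap u oneE by blast
      moreover have "\<one>\<^bsub>\<Omega>\<^esub> \<ominus>\<^bsub>\<Omega>\<^esub> u \<in> E" using E.minus_closed[of "\<one>\<^bsub>\<Omega>\<^esub>" u] u oneE mE by simp
      ultimately show ?case
        using Cons E.not_M_mult E.m_closed by auto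
    qed
    from this[of ts] have "\<one>\<^bsub>\<Omega>\<^esub> \<ominus>\<^bsub>\<Omega>\<^esub> y \<notin> E.M" using fac[of "\<one>\<^bsub>\<Omega>\<^esub>"] by simp
    moreover have "y \<ominus>\<^bsub>\<Omega>\<^esub> \<one>\<^bsub>\<Omega>\<^esub> \<in> E.M" using yU by (simp add: UE)
    ultimately show False using M_swap y(1) E(2) oneE by blast
  qed
  then obtain t where t: "t \<in> set ts" "t \<in> E.U" by blast
  have tc: "t \<in> carrier \<Omega>" "t \<in> E" using t(1) ts(1) E(4) by auto
  have tn: "t [^]\<^bsub>\<Omega>\<^esub> n = y" using root[OF tc(1)] t(1) by simp
  have "t \<in> F"
  proof (rule ccontr)
    assume tF: "t \<notin> F"
    have "t \<noteq> \<zero>\<^bsub>\<Omega>\<^esub>" using E.U_nz[OF t(2)] by simp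
    then obtain t' where t': "t' \<in> carrier \<Omega>" "t' \<noteq> t" "\<Omega>.eval (\<Omega>.Irr F t) t' = \<zero>\<^bsub>\<Omega>\<^esub>"
        "t' [^]\<^bsub>\<Omega>\<^esub> n = y"
      using \<Omega>.separable_other_root[OF F tc(1) alg[OF tc(1)] tF _ n0 n\<Omega>] tn y(1) by metis
    have t'E: "t' \<in> E" using root[OF t'(1)] t'(4) E(4) by auto
    obtain \<sigma> where \<sigma>: "\<sigma> \<in> ring_hom (\<Omega>\<lparr>carrier := \<Omega>.simple_extension F t\<rparr>) \<Omega>"
      "\<And>p. p \<in> carrier (F[X]\<^bsub>\<Omega>\<^esub>) \<Longrightarrow> \<sigma> (\<Omega>.eval p t) = \<Omega>.eval p t'"
      using \<Omega>.conjugate_hom[OF F tc(1) alg[OF tc(1)] t'(1,3)] by blast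
    define G where "G = \<Omega>.simple_extension F t"
    let ?G = "\<Omega>\<lparr>carrier := G\<rparr>"
    have G: "subfield G \<Omega>" "F \<subseteq> G" "\<Omega>.finite_dimension F G" "t \<in> G" "G \<subseteq> E"
      unfolding G_def
      using \<Omega>.simple_extension_is_subfield[OF F tc(1)] alg[OF tc(1)] \<Omega>.simple_extension_incl[OF Fc tc(1)]
        \<Omega>.finite_dimension_simple_extension[OF F tc(1)] \<Omega>.simple_extension_mem[OF subfieldE(1)[OF F] tc(1)]
        \<Omega>.simple_extension_subring_incl[OF subfieldE(1)[OF E(1)] E(2) tc(2)] by auto
    have fG: "field ?G" using \<Omega>.subfield_iff(2)[OF G(1)] .
    have Gimg: "G = (\<lambda>p. \<Omega>.eval p t) ` carrier (F[X]\<^bsub>\<Omega>\<^esub>)"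
      unfolding G_def using \<Omega>.simple_extension_as_eval_img[OF Fc tc(1)] .
    have \<sigma>E: "\<sigma> z \<in> E" if zG: "z \<in> G" for z
    proof -
      obtain p where p: "p \<in> carrier (F[X]\<^bsub>\<Omega>\<^esub>)" "z = \<Omega>.eval p t" using zG Gimg by auto
      have "\<Omega>.eval p t' \<in> \<Omega>.simple_extension F t'"
        using p(1) \<Omega>.simple_extension_as_eval_img[OF Fc t'(1)] by auto
      then show ?thesis
        using \<sigma>(2)[OF p(1)] p(2) \<Omega>.simple_extension_subring_incl[OF subfieldE(1)[OF E(1)] E(2) t'E] by auto
    qed
    have \<sigma>F: "\<sigma> z = z" if z: "z \<in> F" for z
    proof -
      have p: "\<Omega>.poly_of_const z \<in> carrier (F[X]\<^bsub>\<Omega>\<^esub>)"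
        using z unfolding univ_poly_carrier[symmetric] polynomial_def \<Omega>.poly_of_const_def by auto
      have "\<Omega>.eval (\<Omega>.poly_of_const z) a = z" if "a \<in> carrier \<Omega>" for a
        using that z Fc by (auto simp: \<Omega>.poly_of_const_def)
      then show ?thesis using \<sigma>(2)[OF p] tc(1) t'(1) by metis
    qed
    have Xc: "X\<^bsub>\<Omega>\<^esub> \<in> carrier (F[X]\<^bsub>\<Omega>\<^esub>)" using \<Omega>.var_closed(1)[OF subfieldE(1)[OF F]] .
    have \<sigma>t: "\<sigma> t = t'" using \<sigma>(2)[OF Xc] \<Omega>.eval_var tc(1) t'(1) by metis
    have \<sigma>h: "\<sigma> \<in> ring_hom ?G ?E" using \<sigma>(1) \<sigma>E unfolding ring_hom_def G_def[symmetric] by auto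
    have idh: "id \<in> ring_hom ?G ?E" using G(5) unfolding ring_hom_def by auto
    have \<psi>G: "?\<psi> \<in> carrier K \<rightarrow> carrier ?G" using \<psi>F G(2) by (auto simp: image_subset_iff)
    \<comment> \<open>The inclusion of \<open>F(t)\<close> and the conjugation
      \<open>\<sigma>\<close> pull \<open>wE\<close> back to two extensions of
      \<open>v\<close>.\<close>
    have e1: "extends_valuation K v ?G ?\<psi> (wE \<circ> id)"
      using extends_valuation_comp[OF wE fG fE idh \<psi>G] by simp
    have e2: "extends_valuation K v ?G ?\<psi> (wE \<circ> \<sigma>)"
      using extends_valuation_comp[OF wE fG fE \<sigma>h \<psi>G] \<sigma>F \<psi>F by (simp add: image_subset_iff)
    have t1: "t \<ominus>\<^bsub>\<Omega>\<^esub> \<one>\<^bsub>\<Omega>\<^esub> \<in> G" "t \<noteq> \<one>\<^bsub>\<Omega>\<^esub>"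
      using tF G subringE(3,5,7)[OF subfieldE(1)[OF G(1)]] subringE(3)[OF subfieldE(1)[OF F]]
      by (auto simp: \<Omega>.minus_eq)
    have t10: "t \<ominus>\<^bsub>\<Omega>\<^esub> \<one>\<^bsub>\<Omega>\<^esub> \<noteq> \<zero>\<^bsub>\<Omega>\<^esub>" using t1(2) tc(1) by simp
    then have nz: "t \<ominus>\<^bsub>\<Omega>\<^esub> \<one>\<^bsub>\<Omega>\<^esub> \<in> nonzeros ?G" using t1 by (simp add: nonzeros_def)
    \<comment> \<open>They are compared at \<open>t - 1\<close>, whose positive value expresses that
      \<open>t\<close> is a one-unit; it is nonzero because \<open>t\<close> lies outside
      \<open>F\<close>.\<close>
    have eq: "wE (t \<ominus>\<^bsub>\<Omega>\<^esub> \<one>\<^bsub>\<Omega>\<^esub>) = wE (\<sigma> (t \<ominus>\<^bsub>\<Omega>\<^esub> \<one>\<^bsub>\<Omega>\<^esub>))"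
      using henselian_unique_extension[OF K hens fin_ext[OF G(1-3)]] e1 e2 nz by (metis comp_apply id_apply)
    interpret \<sigma>: ring_hom_ring ?G ?E \<sigma>
      using \<sigma>h by (intro ring_hom_ringI2) (use fG fE in \<open>auto intro: field.is_ring\<close>)
    have "\<sigma> (t \<ominus>\<^bsub>?G\<^esub> \<one>\<^bsub>?G\<^esub>) = t' \<ominus>\<^bsub>?E\<^esub> \<one>\<^bsub>?E\<^esub>"
      using \<sigma>.hom_add[of t "\<ominus>\<^bsub>?G\<^esub> \<one>\<^bsub>?G\<^esub>"] \<sigma>.hom_a_inv[of "\<one>\<^bsub>?G\<^esub>"] \<sigma>.hom_one
        G(4) \<sigma>t \<sigma>.R.one_closed \<sigma>.R.a_inv_closed[of "\<one>\<^bsub>?G\<^esub>"] by (simp add: a_minus_def)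
    then have \<sigma>t1: "\<sigma> (t \<ominus>\<^bsub>\<Omega>\<^esub> \<one>\<^bsub>\<Omega>\<^esub>) = t' \<ominus>\<^bsub>\<Omega>\<^esub> \<one>\<^bsub>\<Omega>\<^esub>"
      using \<Omega>.minus_consistent[OF subfieldE(1)[OF G(1)] G(4)] \<sigma>.R.one_closed mE[OF t'E oneE] by simp
    have "0 < wE (t \<ominus>\<^bsub>\<Omega>\<^esub> \<one>\<^bsub>\<Omega>\<^esub>)"
      using t(2) t10 by (simp add: UE E.M_iff)
    then have "t' \<ominus>\<^bsub>\<Omega>\<^esub> \<one>\<^bsub>\<Omega>\<^esub> \<in> E.M"
      using eq \<sigma>t1 \<sigma>E[OF t1(1)] by (simp add: E.M_iff)
    then have t'U: "t' \<in> E.U" using t'E by (simp add: UE)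
    have "t = t'"
      by (rule E.U_eq_if_power_eq[OF t(2) t'U _ nE])
        (use tc t' t'E in \<open>simp_all add: \<Omega>.m_comm pE tn\<close>)
    then show False using t'(2) by simp
  qed
  then obtain s where s: "s \<in> carrier L" "t = \<iota> s" by (auto simp: F_def)
  have "\<iota> (s [^]\<^bsub>L\<^esub> n) = \<iota> x" using s tn \<iota>.hom_nat_pow[OF s(1)] by (simp add: y_def)
  then have "s [^]\<^bsub>L\<^esub> n = x" using inj_onD[OF \<iota>inj] s(1) xc by simp
  then show ?thesis using U_\<iota>[OF s(1)] t(2) s(2) by blast
qed

section \<open>Products of conjugates\<close>

context skew_field
begin

text \<open>The list \<open>[s\<^sub>0, \<dots>, s\<^sub>r]\<close> acts as the operator \<open>u \<mapsto> s\<^sub>0 u + s\<^sub>1 u a + \<dots> + s\<^sub>r u a\<^sup>r\<close>,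
  which vanishes at \<open>u \<noteq> 0\<close> iff the left polynomial with these coefficients vanishes at the
  conjugate \<open>u a u\<inverse>\<close>.\<close>

fun twist :: "'a \<Rightarrow> 'a list \<Rightarrow> 'a \<Rightarrow> 'a"
  where
    "twist a [] u = \<zero>"
  | "twist a (s # l) u = s \<otimes> u \<oplus> twist a l u \<otimes> a"

context
  fixes a assumes a: "a \<in> carrier R"
begin

lemma twist_closed [simp]: "set l \<subseteq> carrier R \<Longrightarrow> u \<in> carrier R \<Longrightarrow> twist a l u \<in> carrier R"
  using a by (induction l) auto

lemma map2_minus_closed:
  "set l \<subseteq> carrier R \<Longrightarrow> set m \<subseteq> carrier R \<Longrightarrow> set (map2 (\<lambda>x y. x \<ominus> y) l m) \<subseteq> carrier R"
  by (force dest: set_zip_leftD set_zip_rightD)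

lemma twist_diff:
  "length l = length m \<Longrightarrow> set l \<subseteq> carrier R \<Longrightarrow> set m \<subseteq> carrier R \<Longrightarrow> u \<in> carrier R \<Longrightarrow>
    twist a (map2 (\<lambda>x y. x \<ominus> y) l m) u = twist a l u \<ominus> twist a m u"
proof (induction l m rule: list_induct2)
  case (Cons x xs y ys)
  then have c: "twist a xs u \<in> carrier R" "twist a ys u \<in> carrier R" by auto
  have "(x \<ominus> y) \<otimes> u \<oplus> (twist a xs u \<ominus> twist a ys u) \<otimes> a
      = (x \<otimes> u \<oplus> twist a xs u \<otimes> a) \<ominus> (y \<otimes> u \<oplus> twist a ys u \<otimes> a)"
    using c Cons.prems a by (simp, algebra)
  then show ?case using Cons by simp
qed (simp add: a_minus_def)

lemma twist_scale:
  "set l \<subseteq> carrier R \<Longrightarrow> u \<in> carrier R \<Longrightarrow> c \<in> carrier R \<Longrightarrow>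
    twist a (map (\<lambda>x. c \<otimes> x) l) u = c \<otimes> twist a l u"
  using a by (induction l) (auto simp: r_distr m_assoc)

lemma twist_append_zero:
  "set l \<subseteq> carrier R \<Longrightarrow> u \<in> carrier R \<Longrightarrow> twist a (l @ [\<zero>]) u = twist a l u"
  using a by (induction l) auto

text \<open>Conjugating the coefficients by \<open>c\<close> only moves the argument to
  \<open>inv c \<otimes> u\<close>, so vanishing at every argument is preserved.\<close>

lemma twist_conj:
  assumes "set l \<subseteq> carrier R" "u \<in> carrier R" "c \<in> carrier R" "c \<noteq> \<zero>"
  shows "twist a (map (\<lambda>x. c \<otimes> x \<otimes> inv c) l) u = c \<otimes> twist a l (inv c \<otimes> u)"
  using assms a inv_closed[OF assms(3,4)] by (induction l) (auto simp: r_distr m_assoc)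

text \<open>Central coefficients let \<open>u\<close> be pulled out to the left: an operator that
  vanishes at one vanishes everywhere, that is, a central polynomial with root \<open>a\<close> has
  all conjugates of \<open>a\<close> as roots.\<close>

lemma twist_central:
  assumes "set l \<subseteq> ring_center R" "u \<in> carrier R"
  shows "twist a l u = u \<otimes> twist a l \<one>"
  using assms(1)
proof (induction l)
  case (Cons x l)
  then have x: "x \<in> carrier R" "x \<otimes> u = u \<otimes> x" and l: "set l \<subseteq> carrier R"
    using assms(2) by (auto simp: ring_center_def)
  then show ?case using Cons assms(2) a by (simp add: r_distr m_assoc)
qed (use assms in simp)

text \<open>The coefficients of \<open>(T - c) q\<close> for a central variable \<open>T\<close>:
  the shift of \<open>q\<close> minus \<open>c\<close> times \<open>q\<close>, both padded to the
  same length.\<close>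

definition twist_step :: "'a \<Rightarrow> 'a list \<Rightarrow> 'a list"
  where "twist_step c q = map2 (\<lambda>x y. x \<ominus> y) (\<zero> # q) (map (\<lambda>x. c \<otimes> x) q @ [\<zero>])"

lemma twist_step:
  assumes "set q \<subseteq> carrier R" "u \<in> carrier R" "c \<in> carrier R"
  shows "twist a (twist_step c q) u = twist a q u \<otimes> a \<ominus> c \<otimes> twist a q u"
proof -
  have c: "set (map (\<lambda>x. c \<otimes> x) q) \<subseteq> carrier R" using assms by auto
  then have "twist a (twist_step c q) u
      = twist a (\<zero> # q) u \<ominus> twist a (map (\<lambda>x. c \<otimes> x) q @ [\<zero>]) u"
    unfolding twist_step_def using assms by (intro twist_diff) auto
  then show ?thesis
    using assms a c by (simp only: twist_append_zero twist_scale) simp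
qed

text \<open>Wedderburn's factorisation: each step appends a linear factor whose root is a conjugate of
  \<open>a\<close>, chosen such that the product vanishes at one more conjugate; the set \<open>W\<close> records the
  conjugates handled so far.\<close>

inductive wedderburn_chain :: "'a list \<Rightarrow> 'a set \<Rightarrow> 'a list \<Rightarrow> bool"
  where
    start: "wedderburn_chain [\<one>] {} []"
  | step: "wedderburn_chain q W cs \<Longrightarrow> b \<in> carrier R \<Longrightarrow> twist a q b \<noteq> \<zero> \<Longrightarrow>
      c = twist a q b \<otimes> a \<otimes> inv (twist a q b) \<Longrightarrow>
      wedderburn_chain (twist_step c q) (insert b W) (c # cs)"

definition conjugates :: "'a set"
  where "conjugates = {u \<otimes> a \<otimes> inv u | u. u \<in> carrier R \<and> u \<noteq> \<zero>}"

lemma conjugates_carrier: "c \<in> conjugates \<Longrightarrow> c \<in> carrier R"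
  using a by (auto simp: conjugates_def inv_closed)

text \<open>The list stays monic, and each factor \<open>T - c\<close> multiplies the constant
  coefficient by \<open>- c\<close>. Up to sign, \<open>hd q\<close> is therefore the product of the
  chosen conjugates.\<close>

lemma wedderburn_chain_props:
  assumes "wedderburn_chain q W cs"
  shows "set q \<subseteq> carrier R \<and> length q = Suc (length cs) \<and> last q = \<one> \<and> set cs \<subseteq> conjugates \<and>
    hd q = foldr (\<lambda>c x. \<ominus> (c \<otimes> x)) cs \<one> \<and> W \<subseteq> carrier R \<and> (\<forall>b\<in>W. twist a q b = \<zero>)"
  using assms
proof (induction rule: wedderburn_chain.induct)
  case (step q W cs b c)
  let ?e = "twist a q b"
  have q: "set q \<subseteq> carrier R" "q \<noteq> []" "last q = \<one>" using step.IH by auto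
  have e: "?e \<in> carrier R" using q(1) step.hyps(2) by simp
  have c: "c \<in> conjugates" using e step.hyps(3,4) unfolding conjugates_def by blast
  note cc = conjugates_carrier[OF c]
  obtain h q' where hq: "q = h # q'" using q(2) by (cases q) auto
  have set': "set (twist_step c q) \<subseteq> carrier R"
    unfolding twist_step_def using q(1) cc by (intro map2_minus_closed) auto
  have len: "length (twist_step c q) = Suc (length q)" by (simp add: twist_step_def)
  have last': "last (twist_step c q) = \<one>"
  proof -
    have len: "length (\<zero> # butlast q) = length (map (\<lambda>x. c \<otimes> x) q)" using q(2) by (cases q) auto
    have "twist_step c q = map2 (\<lambda>x y. x \<ominus> y) ((\<zero> # butlast q) @ [last q]) (map (\<lambda>x. c \<otimes> x) q @ [\<zero>])"
      using q(2) by (simp add: twist_step_def)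
    also have "\<dots> = map2 (\<lambda>x y. x \<ominus> y) (\<zero> # butlast q) (map (\<lambda>x. c \<otimes> x) q) @ [last q \<ominus> \<zero>]"
      by (subst zip_append[OF len]) simp
    finally have "twist_step c q = \<dots>" .
    then show ?thesis using q(3) by (simp add: a_minus_def)
  qed
  have hd': "hd (twist_step c q) = foldr (\<lambda>c x. \<ominus> (c \<otimes> x)) (c # cs) \<one>"
    using step.IH cc q(1) by (simp add: twist_step_def hq a_minus_def)
  \<comment> \<open>With \<open>e = twist a q b\<close>, the choice \<open>c = e a e^(-1)\<close>
    makes \<open>e a - c e\<close> vanish. Arguments already in \<open>W\<close> give
    \<open>e = 0\<close> and stay zeros.\<close>
  have "twist a (twist_step c q) b = \<zero>"
    using twist_step[OF q(1) step.hyps(2) cc] e step.hyps(3,4) a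
    by (simp add: m_assoc l_inv_nz inv_closed a_minus_def r_neg)
  moreover have "twist a (twist_step c q) b' = \<zero>" if "b' \<in> W" for b'
    using twist_step[OF q(1) _ cc, of b'] step.IH that cc a by (auto simp: a_minus_def)
  ultimately show ?case using set' len last' hd' c step by auto
qed auto

text \<open>The chain is a minimal annihilator of \<open>W\<close>. Subtracting
  \<open>last s\<close> times the chain from \<open>s\<close> lowers the degree; by induction the
  remainder is a multiple of the preceding \<open>q\<close>. It also vanishes at \<open>b\<close>,
  where \<open>q\<close> does not, so the multiplier is zero.\<close>

lemma wedderburn_chain_division:
  assumes "wedderburn_chain q W cs" "set s \<subseteq> carrier R" "length s = length q" "\<forall>b\<in>W. twist a s b = \<zero>"
  shows "s = map (\<lambda>x. last s \<otimes> x) q"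
  using assms
proof (induction arbitrary: s rule: wedderburn_chain.induct)
  case start
  then obtain c where "s = [c]" by (cases s) auto
  then show ?case using start by simp
next
  case (step q W cs b c s)
  let ?q = "twist_step c q"
  note ch = wedderburn_chain.step[OF step.hyps]
  note P = wedderburn_chain_props[OF step.hyps(1)] and P' = wedderburn_chain_props[OF ch]
  have ne: "s \<noteq> []" "?q \<noteq> []" using step.prems P' by auto
  let ?l = "last s"
  have l: "?l \<in> carrier R" using ne(1) step.prems(1) by auto
  define s' where "s' = map2 (\<lambda>x y. x \<ominus> y) s (map (\<lambda>x. ?l \<otimes> x) ?q)"
  have lq: "set (map (\<lambda>x. ?l \<otimes> x) ?q) \<subseteq> carrier R" using P' l by auto
  have s': "set s' \<subseteq> carrier R" "length s' = length s"
    unfolding s'_def using map2_minus_closed[OF step.prems(1) lq] step.prems(2) by auto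
  have tw: "twist a s' x = twist a s x \<ominus> ?l \<otimes> twist a ?q x" if "x \<in> carrier R" for x
  proof -
    have "twist a s' x = twist a s x \<ominus> twist a (map (\<lambda>x. ?l \<otimes> x) ?q) x"
      unfolding s'_def using lq step.prems that by (intro twist_diff) auto
    then show ?thesis using P' l that by (simp add: twist_scale)
  qed
  have "last s' = \<zero>"
  proof -
    have "zip s (map (\<lambda>x. ?l \<otimes> x) ?q) \<noteq> []" using ne by (cases s; cases ?q) auto
    moreover have "last (zip s (map (\<lambda>x. ?l \<otimes> x) ?q)) = (last s, last (map (\<lambda>x. ?l \<otimes> x) ?q))"
      using ne step.prems(2) by (intro last_zip) auto
    ultimately have "last s' = ?l \<ominus> ?l \<otimes> \<one>"
      unfolding s'_def using P' ne by (simp add: last_map)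
    then show ?thesis using l by (simp add: a_minus_def r_neg)
  qed
  moreover have "s' \<noteq> []" using s'(2) ne by auto
  ultimately have s'b: "s' = butlast s' @ [\<zero>]" by (metis append_butlast_last_id)
  define r where "r = butlast s'"
  have r: "s' = r @ [\<zero>]" "set r \<subseteq> carrier R" "length r = length q"
    using s'b s' step.prems P P' by (auto simp: r_def dest: in_set_butlastD)
  have tr: "twist a r x = \<zero>" if "x \<in> insert b W" for x
  proof -
    have x: "x \<in> carrier R" using P' that by auto
    have "twist a r x = twist a s x \<ominus> ?l \<otimes> twist a ?q x"
      using tw[OF x] r x by (simp add: twist_append_zero)
    then show ?thesis using P' step.prems(3) that l by (auto simp: a_minus_def)
  qed
  have rq: "r = map (\<lambda>x. last r \<otimes> x) q" using step.IH[of r] r tr by blast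
  have lr: "last r \<in> carrier R" using r(2,3) P by (metis in_mono last_in_set length_0_conv old.nat.distinct(1))
  have "last r \<otimes> twist a q b = \<zero>"
    using tr[of b] twist_scale[of q b "last r"] P lr step.hyps(2) rq by (metis insertI1)
  then have "last r = \<zero>" using mult_zero_cases[of "last r" "twist a q b"] lr P step.hyps(2,3) by auto
  moreover have "x = last r \<otimes> y \<Longrightarrow> y \<in> set q \<Longrightarrow> last r = \<zero> \<Longrightarrow> x = \<zero>" for x y
    using P by auto
  moreover have "x \<in> set r \<Longrightarrow> \<exists>y\<in>set q. x = last r \<otimes> y" for x
    by (subst (asm) rq) auto
  ultimately have "\<forall>x\<in>set s'. x = \<zero>" using r(1) by force
  then have "s' ! i = \<zero>" if "i < length s" for i
    using that s'(2) by simp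
  then have z: "s ! i \<ominus> ?l \<otimes> ?q ! i = \<zero>" if "i < length s" for i
    using that step.prems(2) by (simp add: s'_def)
  show ?case
  proof (rule nth_equalityI)
    fix i assume i: "i < length s"
    then have "s ! i \<in> carrier R" "?l \<otimes> ?q ! i \<in> carrier R"
      using step.prems(1,2) P' l by (auto simp: subset_iff)
    then show "s ! i = map (\<lambda>x. ?l \<otimes> x) ?q ! i"
      using z[OF i] i step.prems(2) by simp
  qed (use step.prems in simp)
qed

text \<open>As long as \<open>q\<close> is nonzero at some \<open>b\<close>, the chain can be
  prolonged. Had it not stopped earlier, it would reach the length of \<open>k\<close>; then
  \<open>k\<close> is a nonzero left multiple of \<open>q\<close>, and \<open>q\<close> vanishes
  everywhere because \<open>k\<close> does.\<close>

lemma wedderburn_chain_stops: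
  assumes k: "set k \<subseteq> carrier R" "\<not> set k \<subseteq> {\<zero>}" "\<And>u. u \<in> carrier R \<Longrightarrow> twist a k u = \<zero>"
  shows "\<exists>q W cs. wedderburn_chain q W cs \<and> length q \<le> length k \<and> (\<forall>u\<in>carrier R. twist a q u = \<zero>)"
proof (rule ccontr)
  assume no: "\<not> ?thesis"
  have "\<exists>q W cs. wedderburn_chain q W cs \<and> length q = Suc n" if "Suc n \<le> length k" for n
    using that
  proof (induction n)
    case 0
    show ?case using wedderburn_chain.start by force
  next
    case (Suc n)
    then obtain q W cs where q: "wedderburn_chain q W cs" "length q = Suc n" by auto
    then have "length q \<le> length k" using Suc.prems by simp
    then obtain b where b: "b \<in> carrier R" "twist a q b \<noteq> \<zero>" using no q(1) by blast
    obtain c where "wedderburn_chain (twist_step c q) (insert b W) (c # cs)"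
      using wedderburn_chain.step[OF q(1) b refl] by blast
    moreover have "length (twist_step c q) = Suc (Suc n)" using q(2) by (simp add: twist_step_def)
    ultimately show ?case by blast
  qed
  moreover have "k \<noteq> []" using k(2) by auto
  ultimately obtain q W cs where q: "wedderburn_chain q W cs" "length q = length k"
    by (metis Suc_pred le_refl length_greater_0_conv)
  note P = wedderburn_chain_props[OF q(1)]
  have kq: "k = map (\<lambda>x. last k \<otimes> x) q"
    using P k q(2) by (intro wedderburn_chain_division[OF q(1)]) auto
  have lk: "last k \<in> carrier R" using k(1) \<open>k \<noteq> []\<close> by auto
  have "last k \<noteq> \<zero>"
  proof
    assume "last k = \<zero>"
    moreover have "x \<in> set k \<Longrightarrow> \<exists>y\<in>set q. x = last k \<otimes> y" for x
      by (subst (asm) kq) auto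
    ultimately have "set k \<subseteq> {\<zero>}" using P by fastforce
    then show False using k(2) by blast
  qed
  moreover have "last k \<otimes> twist a q u = \<zero>" if "u \<in> carrier R" for u
    using k(3)[OF that] twist_scale[of q u "last k"] P lk that kq by metis
  ultimately have "twist a q u = \<zero>" if "u \<in> carrier R" for u
    using mult_zero_cases[OF lk, of "twist a q u"] P that by auto
  moreover have "length q \<le> length k" using q(2) by simp
  ultimately show False using no q(1) by blast
qed

lemma ring_center_minus: "x \<in> ring_center R \<Longrightarrow> \<ominus> x \<in> ring_center R"
  by (auto simp: ring_center_def l_minus r_minus)

text \<open>For the final list, conjugating the coefficients keeps it monic and everywhere
  vanishing, so by \<open>wedderburn_chain_division\<close> it is unchanged. Its constant
  coefficient is thus central, and up to sign it is the product of the conjugates.\<close>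

lemma wedderburn_product_of_conjugates:
  assumes k: "set k \<subseteq> ring_center R" "\<not> set k \<subseteq> {\<zero>}" "twist a k \<one> = \<zero>"
  obtains cs where "cs \<noteq> []" "length cs < length k" "set cs \<subseteq> conjugates"
    "foldr (\<otimes>) cs \<one> \<in> ring_center R"
proof -
  have kc: "set k \<subseteq> carrier R" using k(1) by (auto simp: ring_center_def)
  have "twist a k u = \<zero>" if "u \<in> carrier R" for u
    using twist_central[OF k(1) that] that unfolding k(3) by simp
  then obtain q W cs where q: "wedderburn_chain q W cs" "length q \<le> length k"
    "\<And>u. u \<in> carrier R \<Longrightarrow> twist a q u = \<zero>"
    using wedderburn_chain_stops[OF kc k(2)] by blast
  note P = wedderburn_chain_props[OF q(1)]
  have ne: "q \<noteq> []" using P by auto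
  \<comment> \<open>The initial list \<open>[\<one>]\<close> is the identity operator, so at least
    one step has taken place.\<close>
  have "cs \<noteq> []"
  proof
    assume "cs = []"
    then have "q = [\<one>]" using P by (cases q) auto
    then show False using q(3)[OF one_closed] one_neq_zero a by simp
  qed
  have inv: "map (\<lambda>x. c \<otimes> x \<otimes> inv c) q = q" if c: "c \<in> carrier R" "c \<noteq> \<zero>" for c
  proof -
    let ?s = "map (\<lambda>x. c \<otimes> x \<otimes> inv c) q"
    note i = inv_closed[OF c]
    have "last ?s = \<one>" using P ne c i by (simp add: last_map r_inv_nz)
    moreover have "?s = map (\<lambda>x. last ?s \<otimes> x) q"
      using P c i q(3)[of "inv c \<otimes> _"]
      by (intro wedderburn_chain_division[OF q(1)]) (auto simp: twist_conj)
    ultimately show ?thesis using P by (simp add: map_idI subset_iff)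
  qed
  have hc: "hd q \<in> carrier R" using P ne by (meson hd_in_set subset_iff)
  have "hd q \<in> ring_center R"
    unfolding ring_center_def
  proof (intro CollectI conjI ballI hc)
    fix x assume x: "x \<in> carrier R"
    show "hd q \<otimes> x = x \<otimes> hd q"
    proof (cases "x = \<zero>")
      case False
      have "x \<otimes> hd q \<otimes> inv x = hd q" using inv[OF x False] ne by (metis list.map_sel(1))
      then have "x \<otimes> hd q \<otimes> inv x \<otimes> x = hd q \<otimes> x" by simp
      then show ?thesis using x False hc by (simp add: m_assoc inv_closed l_inv_nz)
    qed (use hc in simp)
  qed
  moreover have "foldr (\<otimes>) cs \<one> \<in> carrier R \<and> (hd q = foldr (\<otimes>) cs \<one> \<or> hd q = \<ominus> foldr (\<otimes>) cs \<one>)"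
  proof -
    have "foldr (\<otimes>) cs \<one> \<in> carrier R \<and> (foldr (\<lambda>c x. \<ominus> (c \<otimes> x)) cs \<one> = foldr (\<otimes>) cs \<one> \<or>
        foldr (\<lambda>c x. \<ominus> (c \<otimes> x)) cs \<one> = \<ominus> foldr (\<otimes>) cs \<one>)" if "set cs \<subseteq> conjugates" for cs
      using that by (induction cs) (auto simp: conjugates_carrier r_minus)
    then show ?thesis using P by metis
  qed
  ultimately have "foldr (\<otimes>) cs \<one> \<in> ring_center R"
    using ring_center_minus[of "hd q"] by auto
  then show thesis using that[of cs] \<open>cs \<noteq> []\<close> P q(2) by auto
qed

end

end

section \<open>The regular representation over the center\<close>

context skew_field
begin

section \<open>Commutants as a source of commutative subfields\<close>

definition commutant :: "'a set \<Rightarrow> 'a set"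
  where "commutant S = {y \<in> carrier R. \<forall>s\<in>S. y \<otimes> s = s \<otimes> y}"

lemma ring_center_eq_commutant: "ring_center R = commutant (carrier R)"
  by (simp add: ring_center_def commutant_def)

lemma commutant_subset: "commutant S \<subseteq> carrier R"
  by (auto simp: commutant_def)

lemma commutant_subring:
  assumes "S \<subseteq> carrier R"
  shows "subring (commutant S) R"
  using assms
  by (intro subringI)
    (auto simp: commutant_def subset_iff l_distr r_distr l_minus r_minus m_assoc,
      metis m_assoc)

lemma commutant_inv:
  assumes "S \<subseteq> carrier R" "y \<in> commutant S" "y \<noteq> \<zero>"
  shows "inv y \<in> commutant S"
proof -
  have y: "y \<in> carrier R" using assms(2) by (simp add: commutant_def)
  note i = inv_closed[OF y assms(3)]
  have "inv y \<otimes> s = s \<otimes> inv y" if "s \<in> S" for s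
  proof -
    have s: "s \<in> carrier R" "y \<otimes> s = s \<otimes> y" using that assms by (auto simp: commutant_def)
    have "inv y \<otimes> (y \<otimes> s) \<otimes> inv y = inv y \<otimes> (s \<otimes> y) \<otimes> inv y" using s(2) by simp
    then have "(inv y \<otimes> y) \<otimes> s \<otimes> inv y = inv y \<otimes> s \<otimes> (y \<otimes> inv y)"
      using s(1) y i by (simp add: m_assoc)
    then show ?thesis using s(1) y i assms(3) by (simp add: l_inv_nz r_inv_nz)
  qed
  then show ?thesis using i by (simp add: commutant_def)
qed

text \<open>The second hypothesis says that \<open>commutant S\<close> is commutative.\<close>

lemma commutant_field:
  assumes "S \<subseteq> carrier R" "commutant S \<subseteq> commutant (commutant S)"
  shows "field (R\<lparr>carrier := commutant S\<rparr>)"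
proof -
  let ?C = "R\<lparr>carrier := commutant S\<rparr>"
  have "subcring (commutant S) R"
    using assms commutant_subring[OF assms(1)] by (intro subcringI) (auto simp: commutant_def)
  then interpret C: cring ?C using subcring_iff[OF commutant_subset] by simp
  show ?thesis
  proof (rule C.cring_fieldI2)
    show "\<zero>\<^bsub>?C\<^esub> \<noteq> \<one>\<^bsub>?C\<^esub>" using one_neq_zero by simp
    fix y assume "y \<in> carrier ?C" "y \<noteq> \<zero>\<^bsub>?C\<^esub>"
    then show "\<exists>z\<in>carrier ?C. y \<otimes>\<^bsub>?C\<^esub> z = \<one>\<^bsub>?C\<^esub>"
      using commutant_inv[OF assms(1), of y] r_inv_nz[of y] commutant_subset by auto
  qed
qed

lemma center_field: "field (R\<lparr>carrier := ring_center R\<rparr>)"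
  unfolding ring_center_eq_commutant
  by (rule commutant_field) (auto simp: commutant_def)

lemma center_subfield: "subfield (ring_center R) R"
  using center_field commutant_subset by (intro subfield_iff(1)) (auto simp: ring_center_eq_commutant)

text \<open>As \<open>x\<close> belongs to its own commutant and commutants reverse inclusions, the
  double commutant lies in the commutant of \<open>x\<close>, with all of which it commutes.\<close>

lemma double_commutant_field:
  assumes "x \<in> carrier R"
  shows "field (R\<lparr>carrier := commutant (commutant {x})\<rparr>)"
proof (rule commutant_field[OF commutant_subset])
  have "x \<in> commutant {x}" using assms by (simp add: commutant_def)
  then have "commutant (commutant {x}) \<subseteq> commutant {x}" by (auto simp: commutant_def)
  then show "commutant (commutant {x}) \<subseteq> commutant (commutant (commutant {x}))"
    by (auto simp: commutant_def)
qed

lemma double_commutant_incl: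
  assumes "x \<in> carrier R"
  shows "x \<in> commutant (commutant {x})" "ring_center R \<subseteq> commutant (commutant {x})"
  using assms by (auto simp: commutant_def ring_center_def)

lemma double_commutant_finite_dimension:
  assumes "x \<in> carrier R" "finite_dimension (ring_center R) (carrier R)"
  shows "finite_dimension (ring_center R) (commutant (commutant {x}))"
proof (rule subalbegra_incl_imp_finite_dimension[OF center_subfield assms(2) _ commutant_subset])
  let ?L = "commutant (commutant {x})"
  have "subring ?L R" using commutant_subring commutant_subset by blast
  then show "subalgebra (ring_center R) ?L R"
    using subringE(6)[of ?L R] double_commutant_incl(2)[OF assms(1)]
    by (auto simp: subalgebra_def subalgebra_axioms_def subring_def)
qed

section \<open>Annihilating polynomials over the center\<close>

lemma combine_powers:
  assumes "a \<in> carrier R" "set k \<subseteq> carrier R"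
  shows "combine k (map (\<lambda>i. a [^] (i + j)) [0..<length k]) = twist a k \<one> \<otimes> a [^] (j::nat)"
  using assms(2)
proof (induction k arbitrary: j)
  case (Cons x k)
  have "map (\<lambda>i. a [^] (i + j)) [0..<length (x # k)] = a [^] j # map (\<lambda>i. a [^] (i + Suc j)) [0..<length k]"
    by (simp add: upt_conv_Cons map_Suc_upt[symmetric] comp_def del: upt_Suc)
  moreover have "combine k (map (\<lambda>i. a [^] (i + Suc j)) [0..<length k]) = twist a k \<one> \<otimes> a [^] Suc j"
    by (rule Cons.IH) (use Cons.prems in simp)
  ultimately have "combine (x # k) (map (\<lambda>i. a [^] (i + j)) [0..<length (x # k)])
      = x \<otimes> a [^] j \<oplus> twist a k \<one> \<otimes> a [^] Suc j"
    by (simp only: combine.simps)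
  then show ?case
    using Cons.prems assms(1) twist_closed[OF assms(1), of k \<one>]
    by (simp add: l_distr m_assoc flip: nat_pow_Suc2)
qed (use assms in simp)

text \<open>The \<open>n + 1\<close> powers from \<open>a^0\<close> to \<open>a^n\<close> are
  linearly dependent. The length \<open>Suc n\<close> is the origin of the bound
  \<open>m \<le> n\<close> on the number of conjugates.\<close>

lemma exists_annihilator:
  assumes a: "a \<in> carrier R" and d: "dimension n (ring_center R) (carrier R)"
  obtains k where "set k \<subseteq> ring_center R" "\<not> set k \<subseteq> {\<zero>}" "twist a k \<one> = \<zero>" "length k = Suc n"
proof -
  let ?Us = "map (\<lambda>i. a [^] (i + 0)) [0..<Suc n]"
  have c: "set ?Us \<subseteq> carrier R" using a by auto
  have "dependent (ring_center R) ?Us"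
    using independent_length_le_dimension[OF center_subfield d, of ?Us] c by fastforce
  then obtain k where k: "length k = length ?Us" "combine k ?Us = \<zero>" "set k \<subseteq> ring_center R" "set k \<noteq> {\<zero>}"
    using dependent_imp_non_trivial_combine[OF center_subfield c] by metis
  have kc: "set k \<subseteq> carrier R" using k(3) commutant_subset ring_center_eq_commutant by auto
  have l: "length k = Suc n" using k(1) by simp
  have "twist a k \<one> = \<zero>"
    using combine_powers[OF a kc, of 0] k(2) twist_closed[OF a kc one_closed] unfolding l by simp
  moreover have "\<not> set k \<subseteq> {\<zero>}" using k(4) l by (metis length_0_conv nat.distinct(1) set_empty subset_singletonD)
  ultimately show thesis using that k(3) l by blast
qed

section \<open>Coordinates over the center and the determinant of left multiplication\<close>

lemma finsum_center:
  assumes "f \<in> A \<rightarrow> ring_center R"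
  shows "(\<Oplus>\<^bsub>R\<lparr>carrier := ring_center R\<rparr>\<^esub>i\<in>A. f i) = (\<Oplus>i\<in>A. f i)"
proof -
  interpret K: field "R\<lparr>carrier := ring_center R\<rparr>" by (rule center_field)
  show ?thesis
    using assms
  proof (induction A rule: infinite_finite_induct)
    case (insert x A)
    then have "f \<in> A \<rightarrow> carrier R" "f x \<in> carrier R"
      by (auto simp: ring_center_def)
    then show ?case using insert by (simp add: K.add.finprod_insert add.finprod_insert)
  next
    case (infinite A)
    then show ?case using K.add.finprod_infinite add.finprod_infinite by simp
  next
    case empty
    then show ?case using K.add.finprod_empty add.finprod_empty by simp
  qed
qed

lemma combine_eq_finsum:
  assumes "length k = length Us" "set k \<subseteq> carrier R" "set Us \<subseteq> carrier R"
  shows "combine k Us = (\<Oplus>i\<in>{..<length Us}. k ! i \<otimes> Us ! i)"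
  using assms
proof (induction k Us rule: list_induct2)
  case (Cons x xs y ys)
  have "(\<Oplus>i\<in>{..<Suc (length ys)}. (x # xs) ! i \<otimes> (y # ys) ! i)
      = x \<otimes> y \<oplus> (\<Oplus>i\<in>Suc ` {..<length ys}. (x # xs) ! i \<otimes> (y # ys) ! i)"
    unfolding lessThan_Suc_eq_insert_0 using Cons.prems Cons.hyps
    by (subst finsum_insert) (auto simp: subset_iff)
  also have "(\<Oplus>i\<in>Suc ` {..<length ys}. (x # xs) ! i \<otimes> (y # ys) ! i) = (\<Oplus>i\<in>{..<length ys}. xs ! i \<otimes> ys ! i)"
    using Cons.prems Cons.hyps by (subst add.finprod_reindex) (auto simp: subset_iff)
  finally show ?case using Cons by simp
qed simp

text \<open>Recasts a basis as indexed sums, the form in which matrix entries are multiplied and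
  rearranged.\<close>

lemma exists_coordinates:
  assumes d: "dimension n (ring_center R) (carrier R)"
  obtains u where "\<And>i. i < n \<Longrightarrow> u i \<in> carrier R"
    "\<And>z. z \<in> carrier R \<Longrightarrow> \<exists>k. (\<forall>i<n. k i \<in> ring_center R) \<and> z = (\<Oplus>i\<in>{..<n}. k i \<otimes> u i)"
    "\<And>k l. \<forall>i<n. k i \<in> ring_center R \<Longrightarrow> \<forall>i<n. l i \<in> ring_center R \<Longrightarrow>
      (\<Oplus>i\<in>{..<n}. k i \<otimes> u i) = (\<Oplus>i\<in>{..<n}. l i \<otimes> u i) \<Longrightarrow> \<forall>i<n. k i = l i"
proof -
  note K = center_subfield
  have Kc: "ring_center R \<subseteq> carrier R" by (auto simp: ring_center_def)
  obtain Us where Us: "set Us \<subseteq> carrier R" "independent (ring_center R) Us" "length Us = n"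
    "Span (ring_center R) Us = carrier R"
    using exists_base[OF K d] by blast
  have comb: "combine k Us = (\<Oplus>i\<in>{..<n}. k ! i \<otimes> Us ! i)" if "set k \<subseteq> ring_center R" "length k = n" for k
    using combine_eq_finsum[of k Us] that Us Kc by auto
  have fs: "(\<Oplus>i\<in>{..<n}. map k [0..<n] ! i \<otimes> Us ! i) = (\<Oplus>i\<in>{..<n}. k i \<otimes> Us ! i)"
    if "\<forall>i<n. k i \<in> ring_center R" for k
    using that Us(1,3) Kc by (intro add.finprod_cong') (auto simp: subset_iff)
  show thesis
  proof (rule that[of "\<lambda>i. Us ! i"])
    show "Us ! i \<in> carrier R" if "i < n" for i using that Us by (auto simp: subset_iff)
    show "\<exists>k. (\<forall>i<n. k i \<in> ring_center R) \<and> z = (\<Oplus>i\<in>{..<n}. k i \<otimes> Us ! i)" if z: "z \<in> carrier R" for z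
    proof -
      obtain k where "set k \<subseteq> ring_center R" "length k = n" "z = combine k Us"
        using unique_decomposition[OF K Us(2), of z] Us(3,4) z by auto
      then show ?thesis using comb by (intro exI[of _ "\<lambda>i. k ! i"]) (auto simp: subset_iff)
    qed
    show "\<forall>i<n. k i = l i" if k: "\<forall>i<n. k i \<in> ring_center R" and l: "\<forall>i<n. l i \<in> ring_center R"
      and eq: "(\<Oplus>i\<in>{..<n}. k i \<otimes> Us ! i) = (\<Oplus>i\<in>{..<n}. l i \<otimes> Us ! i)" for k l
    proof -
      have sk: "set (map k [0..<n]) \<subseteq> ring_center R" "set (map l [0..<n]) \<subseteq> ring_center R"
        using k l by auto
      have "combine (map k [0..<n]) Us = combine (map l [0..<n]) Us"
        using comb[OF sk(1)] comb[OF sk(2)] fs[OF k] fs[OF l] eq by simp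
      moreover have "combine (map k [0..<n]) Us \<in> Span (ring_center R) Us"
        using Us sk Kc by auto
      ultimately have "map k [0..<n] = map l [0..<n]"
        using unique_decomposition[OF K Us(2)] sk Us(3) by (metis length_map length_upt minus_nat.diff_0)
      then show ?thesis by (simp add: map_eq_conv)
    qed
  qed
qed

text \<open>The determinant of the regular representation over the center is a homomorphism to an
  abelian group, hence trivial on commutators, and it is the \<open>n\<close>-th power on the center.\<close>

lemma center_inter_derived_torsion:
  assumes d: "dimension n (ring_center R) (carrier R)"
    and c: "c \<in> ring_center R" "c \<in> comm_units R"
  shows "c [^] n = \<one>"
proof -
  let ?K = "ring_center R"
  let ?KR = "R\<lparr>carrier := ?K\<rparr>"
  interpret K: field ?KR by (rule center_field)
  have Kc: "x \<in> carrier R" if "x \<in> ?K" for x using that by (simp add: ring_center_def)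
  have Kcomm: "x \<otimes> y = y \<otimes> x" if "x \<in> ?K" "y \<in> carrier R" for x y using that by (simp add: ring_center_def)
  have Km: "x \<otimes> y \<in> ?K" if "x \<in> ?K" "y \<in> ?K" for x y using K.m_closed[of x y] that by simp
  obtain u where u: "\<And>i. i < n \<Longrightarrow> u i \<in> carrier R"
    and ex: "\<And>z. z \<in> carrier R \<Longrightarrow> \<exists>k. (\<forall>i<n. k i \<in> ?K) \<and> z = (\<Oplus>i\<in>{..<n}. k i \<otimes> u i)"
    and uniq: "\<And>k l. \<forall>i<n. k i \<in> ?K \<Longrightarrow> \<forall>i<n. l i \<in> ?K \<Longrightarrow>
      (\<Oplus>i\<in>{..<n}. k i \<otimes> u i) = (\<Oplus>i\<in>{..<n}. l i \<otimes> u i) \<Longrightarrow> \<forall>i<n. k i = l i"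
    using exists_coordinates[OF d] by blast
  define co where "co z = (SOME k. (\<forall>i<n. k i \<in> ?K) \<and> z = (\<Oplus>i\<in>{..<n}. k i \<otimes> u i))" for z
  have co: "\<forall>i<n. co z i \<in> ?K" "z = (\<Oplus>i\<in>{..<n}. co z i \<otimes> u i)" if "z \<in> carrier R" for z
    using someI_ex[OF ex[OF that]] unfolding co_def by auto
  have co_eq: "\<forall>i<n. co z i = k i" if "\<forall>i<n. k i \<in> ?K" "z = (\<Oplus>i\<in>{..<n}. k i \<otimes> u i)" for z k
  proof -
    have z: "z \<in> carrier R" unfolding that(2) using that(1) u Kc by (intro finsum_closed) auto
    show ?thesis
      by (rule uniq[OF co(1)[OF z] that(1) trans[OF co(2)[OF z, symmetric] that(2)]])
  qed
  define m where "m a i = co (a \<otimes> u i)" for a i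
  have mK: "m a i j \<in> ?K" if "a \<in> carrier R" "i < n" "j < n" for a i j
    using co(1)[of "a \<otimes> u i"] u that by (simp add: m_def)
  have m_sum: "a \<otimes> u i = (\<Oplus>j\<in>{..<n}. m a i j \<otimes> u j)" if "a \<in> carrier R" "i < n" for a i
    using co(2)[of "a \<otimes> u i"] u that by (simp add: m_def)
  define N where "N a = leibniz_det ?KR n (m a)" for a
  \<comment> \<open>Row \<open>i\<close> of the matrix of \<open>a\<close> holds the coordinates of
    \<open>a \<otimes> u i\<close>, so products come out in reverse order; the determinant has
    commutative values and does not notice.\<close>
  have m_mult: "m (a \<otimes> b) i l = (\<Oplus>\<^bsub>?KR\<^esub>j\<in>{..<n}. m b i j \<otimes>\<^bsub>?KR\<^esub> m a j l)"
    if a: "a \<in> carrier R" and b: "b \<in> carrier R" and i: "i < n" and l: "l < n" for a b i l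
  proof -
    have "(a \<otimes> b) \<otimes> u i = a \<otimes> (\<Oplus>j\<in>{..<n}. m b i j \<otimes> u j)"
      using m_sum[OF b i] a b u[OF i] by (simp add: m_assoc)
    also have "\<dots> = (\<Oplus>j\<in>{..<n}. a \<otimes> (m b i j \<otimes> u j))"
      using a mK[OF b i] u Kc by (subst finsum_rdistr) auto
    also have "\<dots> = (\<Oplus>j\<in>{..<n}. \<Oplus>l\<in>{..<n}. m b i j \<otimes> (m a j l \<otimes> u l))"
    proof (intro add.finprod_cong' refl)
      fix j assume "j \<in> {..<n}"
      then have j: "j < n" by simp
      note mb = mK[OF b i j]
      have "a \<otimes> (m b i j \<otimes> u j) = m b i j \<otimes> (a \<otimes> u j)"
        using Kcomm[OF mb a] Kc[OF mb] a u[OF j] by (metis m_assoc)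
      also have "\<dots> = m b i j \<otimes> (\<Oplus>l\<in>{..<n}. m a j l \<otimes> u l)" using m_sum[OF a j] by simp
      also have "\<dots> = (\<Oplus>l\<in>{..<n}. m b i j \<otimes> (m a j l \<otimes> u l))"
        using Kc[OF mb] mK[OF a j] u Kc by (subst finsum_rdistr) auto
      finally show "a \<otimes> (m b i j \<otimes> u j) = (\<Oplus>l\<in>{..<n}. m b i j \<otimes> (m a j l \<otimes> u l))" .
    qed (use mK[OF b i] mK[OF a] u Kc in \<open>auto intro!: finsum_closed\<close>)
    also have "\<dots> = (\<Oplus>l\<in>{..<n}. \<Oplus>j\<in>{..<n}. m b i j \<otimes> (m a j l \<otimes> u l))"
      using mK[OF b i] mK[OF a] u Kc by (intro finsum_swap) auto
    also have "\<dots> = (\<Oplus>l\<in>{..<n}. (\<Oplus>j\<in>{..<n}. m b i j \<otimes> m a j l) \<otimes> u l)"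
    proof (intro add.finprod_cong' refl)
      fix l assume "l \<in> {..<n}"
      then have l: "l < n" by simp
      have "(\<Oplus>j\<in>{..<n}. m b i j \<otimes> m a j l) \<otimes> u l = (\<Oplus>j\<in>{..<n}. m b i j \<otimes> m a j l \<otimes> u l)"
        using mK[OF b i] mK[OF a _ l] u[OF l] Kc by (subst finsum_ldistr) auto
      also have "\<dots> = (\<Oplus>j\<in>{..<n}. m b i j \<otimes> (m a j l \<otimes> u l))"
        using mK[OF b i] mK[OF a _ l] u[OF l] Kc by (intro add.finprod_cong' refl) (auto simp: m_assoc)
      finally show "(\<Oplus>j\<in>{..<n}. m b i j \<otimes> (m a j l \<otimes> u l)) = (\<Oplus>j\<in>{..<n}. m b i j \<otimes> m a j l) \<otimes> u l"
        by simp
    qed (use mK[OF b i] mK[OF a] u Kc in \<open>auto intro!: finsum_closed\<close>)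
    finally have eq: "(a \<otimes> b) \<otimes> u i = (\<Oplus>l\<in>{..<n}. (\<Oplus>j\<in>{..<n}. m b i j \<otimes> m a j l) \<otimes> u l)" .
    have sK: "(\<Oplus>\<^bsub>?KR\<^esub>j\<in>{..<n}. m b i j \<otimes> m a j l) = (\<Oplus>j\<in>{..<n}. m b i j \<otimes> m a j l)" if "l < n" for l
      using mK[OF b i] mK[OF a] that Km by (intro finsum_center) auto
    have "(\<Oplus>j\<in>{..<n}. m b i j \<otimes> m a j l) \<in> ?K" if "l < n" for l
      using K.finsum_closed[of "\<lambda>j. m b i j \<otimes> m a j l" "{..<n}"] sK[OF that] mK[OF b i] mK[OF a] that Km by auto
    then have "\<forall>l<n. co ((a \<otimes> b) \<otimes> u i) l = (\<Oplus>j\<in>{..<n}. m b i j \<otimes> m a j l)"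
      using eq by (intro co_eq) auto
    then show ?thesis using l sK[OF l] by (simp add: m_def[of "a \<otimes> b"])
  qed
  have N_closed: "N a \<in> ?K" if "a \<in> carrier R" for a
    using K.leibniz_det_closed[of n "m a"] mK[OF that] by (simp add: N_def)
  have N_mult: "N (a \<otimes> b) = N b \<otimes> N a" if a: "a \<in> carrier R" and b: "b \<in> carrier R" for a b
  proof -
    have "leibniz_det ?KR n (\<lambda>i l. \<Oplus>\<^bsub>?KR\<^esub>j\<in>{..<n}. m b i j \<otimes>\<^bsub>?KR\<^esub> m a j l) = N (a \<otimes> b)"
      unfolding N_def using m_mult[OF a b] mK[of "a \<otimes> b"] a b by (intro K.leibniz_det_cong) auto
    then have "N (a \<otimes> b) = leibniz_det ?KR n (\<lambda>i l. \<Oplus>\<^bsub>?KR\<^esub>j\<in>{..<n}. m b i j \<otimes>\<^bsub>?KR\<^esub> m a j l)"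
      by (rule sym)
    also have "\<dots> = N b \<otimes> N a"
      unfolding N_def using K.leibniz_det_mult[of n "m b" "m a"] mK[OF a] mK[OF b] by simp
    finally show ?thesis .
  qed
  have N_center: "N z = z [^] n" if z: "z \<in> ?K" for z
  proof -
    have zero: "\<zero> \<in> ?K" using K.zero_closed by simp
    have mz: "m z i j = (if i = j then z else \<zero>\<^bsub>?KR\<^esub>)" if i: "i < n" and j: "j < n" for i j
    proof -
      have "(\<Oplus>l\<in>{..<n}. (if i = l then z else \<zero>) \<otimes> u l) = (\<Oplus>l\<in>{..<n}. if i = l then z \<otimes> u l else \<zero>)"
        using z u Kc by (intro add.finprod_cong' refl) auto
      also have "\<dots> = z \<otimes> u i"
        using i z u Kc by (intro add.finprod_singleton) auto
      finally have "\<forall>l<n. co (z \<otimes> u i) l = (if i = l then z else \<zero>)"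
        using z zero by (intro co_eq) auto
      then show ?thesis using j by (simp add: m_def)
    qed
    have "N z = leibniz_det ?KR n (\<lambda>i j. if i = j then z else \<zero>\<^bsub>?KR\<^esub>)"
      unfolding N_def using mz z zero by (intro K.leibniz_det_cong) auto
    also have "\<dots> = z [^]\<^bsub>?KR\<^esub> n" using z by (intro K.leibniz_det_scalar) simp
    finally show ?thesis by (simp add: nat_pow_def)
  qed
  interpret G: group "units_of R" by (rule units_group)
  have oneK: "\<one> \<in> ?K" using K.one_closed by simp
  have N1: "N \<one> = \<one>" using N_center[OF oneK] by simp
  have Ninv: "N (inv a) \<otimes> N a = \<one>" if "a \<in> Units R" for a
    using N_mult[of a "inv a"] N1 that Units_closed[OF that] by simp
  have comm: "N (a \<otimes> b \<otimes> inv a \<otimes> inv b) = \<one>" if a: "a \<in> Units R" and b: "b \<in> Units R" for a b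
  proof -
    have c: "N a \<in> ?K" "N b \<in> ?K" "N (inv a) \<in> ?K" "N (inv b) \<in> ?K" using a b N_closed by auto
    have "N (a \<otimes> b \<otimes> inv a \<otimes> inv b) = N (inv b) \<otimes> (N (inv a) \<otimes> (N b \<otimes> N a))"
      using Units_closed[OF a] Units_closed[OF b] Units_inv_closed[OF a] Units_inv_closed[OF b]
      by (simp add: N_mult)
    also have "\<dots> = (N (inv b) \<otimes> N b) \<otimes> (N (inv a) \<otimes> N a)"
    proof -
      have "N (inv a) \<otimes> (N b \<otimes> N a) = N b \<otimes> (N (inv a) \<otimes> N a)"
        using c Kcomm[OF c(3), of "N b"] Kc by (metis m_assoc)
      then show ?thesis using c Kc by (simp add: m_assoc)
    qed
    finally show ?thesis using Ninv[OF a] Ninv[OF b] by simp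
  qed
  have "x \<in> generate (units_of R) (derived_set (units_of R) (carrier (units_of R))) \<Longrightarrow> x \<in> Units R \<and> N x = \<one>" for x
  proof (induction rule: generate.induct)
    case one
    then show ?case using N1 by (simp add: units_of_one)
  next
    case (incl h)
    then show ?case using comm by (auto simp: units_of_carrier units_of_mult units_of_inv)
  next
    case (inv h)
    then have "h \<in> Units R" "N h = \<one>" using comm by (auto simp: units_of_carrier units_of_mult units_of_inv)
    then show ?case using Ninv[of h] N_closed[of "inv h"] Kc by (auto simp: units_of_inv)
  next
    case (eng h1 h2)
    then show ?case using N_mult by (auto simp: units_of_mult Units_closed)
  qed
  then have "N c = \<one>" using c(2) by (simp add: comm_units_def derived_def)
  then show ?thesis using N_center[OF c(1)] by simp
qed

end

section \<open>Torsion in the Whitehead group\<close>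

context skew_field
begin

section \<open>The abelian quotient by commutators\<close>

definition whitehead where "whitehead = units_of R Mod comm_units R"

abbreviation wclass where "wclass x \<equiv> comm_units R #>\<^bsub>units_of R\<^esub> x"

lemma comm_units_normal: "comm_units R \<lhd> units_of R"
  unfolding comm_units_def by (rule group.derived_self_is_normal[OF units_group])

lemma whitehead_comm_group: "comm_group whitehead"
  unfolding whitehead_def comm_units_def by (rule group.derived_quot_is_comm_group[OF units_group])

lemma wclass_hom: "group_hom (units_of R) whitehead wclass"
  using normal.r_coset_hom_Mod[OF comm_units_normal] units_group
    normal.factorgroup_is_group[OF comm_units_normal]
  by (simp add: group_hom_def group_hom_axioms_def whitehead_def)

lemma wclass_closed: "x \<in> Units R \<Longrightarrow> wclass x \<in> carrier whitehead"
  using group_hom.hom_closed[OF wclass_hom] by (simp add: units_of_carrier)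

lemma wclass_mult: "x \<in> Units R \<Longrightarrow> y \<in> Units R \<Longrightarrow> wclass (x \<otimes> y) = wclass x \<otimes>\<^bsub>whitehead\<^esub> wclass y"
  using group_hom.hom_mult[OF wclass_hom] by (simp add: units_of_carrier units_of_mult)

lemma units_of_pow_eq: "x [^]\<^bsub>units_of R\<^esub> (k::nat) = x [^] k"
  by (simp add: nat_pow_def units_of_mult units_of_one)

lemma wclass_pow: "x \<in> Units R \<Longrightarrow> wclass (x [^] k) = wclass x [^]\<^bsub>whitehead\<^esub> (k::nat)"
  using group_hom.hom_nat_pow[OF wclass_hom, of x k] by (simp add: units_of_carrier units_of_pow_eq)

lemma wclass_one_iff: "x \<in> Units R \<Longrightarrow> wclass x = \<one>\<^bsub>whitehead\<^esub> \<longleftrightarrow> x \<in> comm_units R"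
proof -
  assume x: "x \<in> Units R"
  interpret G: group "units_of R" by (rule units_group)
  have s: "subgroup (comm_units R) (units_of R)"
    using comm_units_normal by (rule normal_imp_subgroup)
  show ?thesis
    using G.coset_join1[OF _ _ s, of x] G.coset_join2[OF _ s, of x] x
    by (auto simp: units_of_carrier FactGroup_def whitehead_def)
qed

lemma power_in_comm_units_iff:
  "x \<in> Units R \<Longrightarrow> x [^] (k::nat) \<in> comm_units R \<longleftrightarrow> wclass x [^]\<^bsub>whitehead\<^esub> k = \<one>\<^bsub>whitehead\<^esub>"
  using wclass_one_iff[of "x [^] k"] wclass_pow[of x k] by (simp add: Units_pow_closed)

lemma wclass_conj:
  assumes "u \<in> Units R" "x \<in> Units R"
  shows "wclass (u \<otimes> x \<otimes> inv u) = wclass x"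
proof -
  interpret Q: comm_group whitehead by (rule whitehead_comm_group)
  have i: "inv u \<in> Units R" using assms by simp
  have "wclass (u \<otimes> x \<otimes> inv u) = wclass u \<otimes>\<^bsub>whitehead\<^esub> wclass x \<otimes>\<^bsub>whitehead\<^esub> wclass (inv u)"
    using assms i by (simp add: wclass_mult Units_m_closed)
  also have "\<dots> = wclass x \<otimes>\<^bsub>whitehead\<^esub> (wclass u \<otimes>\<^bsub>whitehead\<^esub> wclass (inv u))"
    using wclass_closed[OF assms(1)] wclass_closed[OF assms(2)] wclass_closed[OF i]
    by (simp only: Q.m_comm[of "wclass u" "wclass x"] Q.m_assoc)
  also have "wclass u \<otimes>\<^bsub>whitehead\<^esub> wclass (inv u) = wclass (u \<otimes> inv u)"
    using assms(1) i by (simp only: wclass_mult)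
  also have "\<dots> = \<one>\<^bsub>whitehead\<^esub>"
    using assms(1) group_hom.hom_one[OF wclass_hom] by (simp add: units_of_one)
  finally show ?thesis using wclass_closed[OF assms(2)] by simp
qed

lemma wclass_product_of_conjugates:
  assumes x: "x \<in> Units R" and cs: "set cs \<subseteq> conjugates x"
  shows "foldr (\<otimes>) cs \<one> \<in> Units R \<and> wclass (foldr (\<otimes>) cs \<one>) = wclass x [^]\<^bsub>whitehead\<^esub> length cs"
  using cs
proof (induction cs)
  case Nil
  then show ?case using group_hom.hom_one[OF wclass_hom] by (simp add: units_of_one)
next
  case (Cons c cs)
  interpret Q: comm_group whitehead by (rule whitehead_comm_group)
  have xc: "x \<in> carrier R" using x by (rule Units_closed)
  obtain u where u: "u \<in> carrier R" "u \<noteq> \<zero>" "c = u \<otimes> x \<otimes> inv u"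
    using Cons.prems unfolding conjugates_def[OF xc] by auto
  have uU: "u \<in> Units R" using u by (simp add: Units_iff)
  have c: "c \<in> Units R" "wclass c = wclass x"
    unfolding u(3) using uU x wclass_conj by (auto intro: Units_m_closed)
  then show ?case
    using Cons wclass_closed[OF x] by (simp add: wclass_mult Units_m_closed Q.m_comm)
qed

end

context valued_division_ring
begin

section \<open>Residue characteristic and prime-to-p parts\<close>

lemma natural_mult: "[(a * b :: nat)] \<cdot> \<one> = ([a] \<cdot> \<one>) \<otimes> ([b] \<cdot> \<one>)"
proof -
  have "([a] \<cdot> \<one>) \<otimes> ([b] \<cdot> \<one>) = [a] \<cdot> ([b] \<cdot> \<one>)"
    using add_pow_ldistr[of \<one> "[b] \<cdot> \<one>" a] by simp
  also have "\<dots> = [(b * a)] \<cdot> \<one>"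
    using add.nat_pow_pow[OF one_closed, of a b] by (simp add: add_pow_def)
  finally show ?thesis by (simp add: mult.commute)
qed

lemma V_subring: "subring V R"
  using V_add V_minus V_mult one_V by (intro subringI) (auto simp: V_iff)

lemma M_ideal: "ideal M (R\<lparr>carrier := V\<rparr>)"
proof -
  interpret V: ring "R\<lparr>carrier := V\<rparr>" using subring_is_ring[OF V_subring] .
  show ?thesis
  proof (rule idealI[OF V.ring_axioms])
    show "subgroup M (add_monoid (R\<lparr>carrier := V\<rparr>))"
    proof (rule V.add.subgroupI)
      show "M \<noteq> {}" using zero_M by blast
      fix a assume a: "a \<in> M"
      have "\<ominus> a \<oplus> a = \<zero>" "\<ominus> a \<in> V" using M_carrier[OF a] M_V[OF M_minus[OF a]] by (auto simp: l_neg)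
      then have "\<ominus>\<^bsub>R\<lparr>carrier := V\<rparr>\<^esub> a = \<ominus> a" using V.minus_equality[of "\<ominus> a" a] M_V[OF a] by simp
      then show "\<ominus>\<^bsub>R\<lparr>carrier := V\<rparr>\<^esub> a \<in> M" using M_minus[OF a] by simp
    qed (use M_V M_add in auto)
  qed (use M_mult_left M_mult_right in auto)
qed

text \<open>The characteristic is the order of one in the additive group, zero if infinite. Since
  \<open>0 dvd j\<close> only for \<open>j = 0\<close>, divisibility covers both cases
  uniformly.\<close>

lemma residue_char_dvd_iff: "ring_char (residue_ring R v) dvd j \<longleftrightarrow> [j] \<cdot> \<one> \<in> M"
proof -
  let ?V = "R\<lparr>carrier := V\<rparr>"
  interpret V: ring ?V using subring_is_ring[OF V_subring] .
  interpret M: ideal M ?V by (rule M_ideal)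
  interpret Q: ring "?V Quot M" by (rule M.quotient_is_ring)
  interpret h: ring_hom_ring ?V "?V Quot M" "(+>\<^bsub>?V\<^esub>) M" by (rule M.rcos_ring_hom_ring)
  have n: "[j] \<cdot>\<^bsub>?V\<^esub> \<one>\<^bsub>?V\<^esub> = [j] \<cdot> \<one>" for j :: nat by (simp add: add_pow_def nat_pow_def)
  have nat: "M +>\<^bsub>?V\<^esub> ([j] \<cdot>\<^bsub>?V\<^esub> \<one>\<^bsub>?V\<^esub>) = [j] \<cdot>\<^bsub>?V Quot M\<^esub> \<one>\<^bsub>?V Quot M\<^esub>" for j :: nat
  proof (induction j)
    case 0
    show ?case using h.hom_zero by (simp add: add_pow_def)
  next
    case (Suc j)
    have c: "[j] \<cdot>\<^bsub>?V\<^esub> \<one>\<^bsub>?V\<^esub> \<in> carrier ?V" using natural_V[of j] unfolding n by simp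
    have "M +>\<^bsub>?V\<^esub> ([Suc j] \<cdot>\<^bsub>?V\<^esub> \<one>\<^bsub>?V\<^esub>) = M +>\<^bsub>?V\<^esub> ([j] \<cdot>\<^bsub>?V\<^esub> \<one>\<^bsub>?V\<^esub> \<oplus>\<^bsub>?V\<^esub> \<one>\<^bsub>?V\<^esub>)"
      by (simp add: add_pow_def)
    also have "\<dots> = [j] \<cdot>\<^bsub>?V Quot M\<^esub> \<one>\<^bsub>?V Quot M\<^esub> \<oplus>\<^bsub>?V Quot M\<^esub> \<one>\<^bsub>?V Quot M\<^esub>"
      using h.hom_add[OF c V.one_closed] Suc h.hom_one by simp
    finally show ?case by (simp add: add_pow_def)
  qed
  have z: "M +>\<^bsub>?V\<^esub> y = \<zero>\<^bsub>?V Quot M\<^esub> \<longleftrightarrow> y \<in> M" if "y \<in> V" for y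
    using V.a_coset_join1[of M y] V.a_coset_join2[of y M] that M.a_subgroup
    by (auto simp: FactRing_def)
  have "ring_char (residue_ring R v) dvd j \<longleftrightarrow> [j] \<cdot>\<^bsub>?V Quot M\<^esub> \<one>\<^bsub>?V Quot M\<^esub> = \<zero>\<^bsub>?V Quot M\<^esub>"
    unfolding ring_char_def residue_ring_def
    using Q.add.pow_eq_id[of "\<one>\<^bsub>?V Quot M\<^esub>" j] by (simp add: add_pow_def)
  also have "\<dots> \<longleftrightarrow> [j] \<cdot> \<one> \<in> M" using z[OF natural_V[of j]] nat[of j] by (simp only: n)
  finally show ?thesis .
qed

lemma residue_char_prime:
  assumes p: "\<And>j::nat. [j] \<cdot> \<one> \<in> M \<longleftrightarrow> p dvd j" and pos: "p > 0"
  shows "Factorial_Ring.prime (p::nat)"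
  unfolding prime_nat_iff
proof (intro conjI allI impI)
  have "p \<noteq> 1"
  proof
    assume "p = 1"
    then show False using p[of 1] by (simp add: add_pow_def)
  qed
  then show "1 < p" using pos by simp
  fix a assume "a dvd p"
  then obtain b where ab: "p = a * b" by blast
  then have "p dvd a \<or> p dvd b"
    using M_prime[OF natural_V[of a] natural_V[of b]] p[of p] p[of a] p[of b] natural_mult[of a b] by auto
  then show "a = 1 \<or> a = p"
  proof
    assume "p dvd b"
    then obtain c where "b = a * b * c" using ab by auto
    then have "a * c = 1" using ab pos by (simp add: mult_ac)
    then show ?thesis by simp
  qed (use \<open>a dvd p\<close> dvd_antisym in blast)
qed

text \<open>\<open>q\<close> is the p-part of \<open>m\<close>. In residue characteristic zero no
  positive integer lies in \<open>M\<close>, and the p-part is one; the conditional carries both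
  alternatives of the final disjunction at once.\<close>

lemma residue_char_decomposition:
  assumes p: "\<And>j::nat. [j] \<cdot> \<one> \<in> M \<longleftrightarrow> p dvd j" and "m > 0"
  obtains q j e where "m = q * j" "[j] \<cdot> \<one> \<notin> M" "q = (if p = 0 then 1 else p ^ e)"
proof (cases "p = 0")
  case True
  then show ?thesis using that[of 1 m] p[of m] \<open>m > 0\<close> by simp
next
  case False
  obtain e j where "\<not> p dvd j" "m = j * p ^ e"
    using prime_power_canonical[OF residue_char_prime[OF p] \<open>m > 0\<close>] False by auto
  then show ?thesis using that[of "p ^ e" j e] p[of j] False by (simp add: mult.commute)
qed

text \<open>By Wedderburn some product of \<open>m \<le> n\<close> conjugates of \<open>x\<close> is central. It is congruent to
  \<open>x\<^sup>m\<close> modulo commutators, hence torsion modulo commutators, hence a root of unity.\<close>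

lemma torsion_power_central:
  assumes d: "dimension n (ring_center R) (carrier R)"
    and x: "x \<in> U" and k: "x [^] (k::nat) \<in> comm_units R"
  obtains m c where "0 < m" "m \<le> n" "c \<in> U" "c [^] (k * n) = \<one>"
    "wclass c = wclass x [^]\<^bsub>whitehead\<^esub> (m::nat)"
proof -
  interpret Q: comm_group whitehead by (rule whitehead_comm_group)
  have xc: "x \<in> carrier R" using U_carrier[OF x] .
  have xU: "x \<in> Units R" using xc U_nz[OF x] by (simp add: Units_iff)
  obtain l where l: "set l \<subseteq> ring_center R" "\<not> set l \<subseteq> {\<zero>}" "twist x l \<one> = \<zero>" "length l = Suc n"
    using exists_annihilator[OF xc d] by blast
  obtain cs where cs: "cs \<noteq> []" "length cs < length l" "set cs \<subseteq> conjugates x"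
    "foldr (\<otimes>) cs \<one> \<in> ring_center R"
    using wedderburn_product_of_conjugates[OF xc l(1-3)] by blast
  let ?c = "foldr (\<otimes>) cs \<one>" and ?m = "length cs"
  have cU: "?c \<in> Units R" and cc: "wclass ?c = wclass x [^]\<^bsub>whitehead\<^esub> ?m"
    using wclass_product_of_conjugates[OF xU cs(3)] by auto
  have "?c \<in> U"
    using cs(3)
  proof (induction cs)
    case (Cons c cs)
    then show ?case using U_conj[OF x] U_mult by (auto simp: conjugates_def[OF xc])
  qed simp
  \<comment> \<open>The factor \<open>k\<close> brings the product into the commutator subgroup; it
    stays central, and \<open>n\<close> is the exponent from
    \<open>center_inter_derived_torsion\<close>.\<close>
  moreover have "?c [^] (k * n) = \<one>"
  proof -
    have "wclass (?c [^] k) = wclass x [^]\<^bsub>whitehead\<^esub> (?m * k)"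
      using wclass_pow[OF cU] cc Q.nat_pow_pow[OF wclass_closed[OF xU]] by simp
    also have "\<dots> = wclass (x [^] k) [^]\<^bsub>whitehead\<^esub> ?m"
      using wclass_pow[OF xU] Q.nat_pow_pow[OF wclass_closed[OF xU]] by (simp add: mult.commute)
    also have "\<dots> = \<one>\<^bsub>whitehead\<^esub>"
      using wclass_one_iff[of "x [^] k"] k xU by (simp add: Units_pow_closed)
    finally have "?c [^] k \<in> comm_units R"
      using wclass_one_iff[of "?c [^] k"] cU by (simp add: Units_pow_closed)
    moreover have "?c [^] k \<in> ring_center R"
    proof (induction k)
      case 0
      show ?case by (simp add: ring_center_def)
    next
      case (Suc k)
      then show ?case using cs(4) subringE(6)[OF subfieldE(1)[OF center_subfield]] by simp
    qed
    ultimately show ?thesis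
      using center_inter_derived_torsion[OF d] nat_pow_pow[OF Units_closed[OF cU], of k n] by simp
  qed
  ultimately show thesis using that[of ?m ?c] cs(1,2) l(4) cc by simp
qed

text \<open>Two exponents are split into p-part and rest: \<open>n!\<close> into \<open>q\<close>
  and \<open>j\<close>, and the exponent killing \<open>c\<close> into \<open>q'\<close> and
  \<open>j'\<close>. The root \<open>t\<close> takes care of \<open>j\<close>, the triviality of
  prime-to-p torsion among one-units removes \<open>j'\<close>, and \<open>q * q'\<close> is what
  remains.\<close>

lemma torsion_power_in_derived:
  assumes d: "dimension n (ring_center R) (carrier R)"
    and p: "\<And>j::nat. [j] \<cdot> \<one> \<in> M \<longleftrightarrow> p dvd j"
    and root: "\<And>j x. [(j::nat)] \<cdot> \<one> \<notin> M \<Longrightarrow> x \<in> U \<Longrightarrow> \<exists>t\<in>U. t [^] j = x"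
    and x: "x \<in> U" and k: "k > 0" "x [^] (k::nat) \<in> comm_units R"
  shows "\<exists>e. x [^] (if p = 0 then 1 else p ^ e) \<in> comm_units R"
proof -
  interpret Q: comm_group whitehead by (rule whitehead_comm_group)
  obtain q j e where q: "fact n = q * j" "[j] \<cdot> \<one> \<notin> M" "q = (if p = 0 then 1 else p ^ e)"
    using residue_char_decomposition[OF p fact_gt_zero] by metis
  obtain t where t: "t \<in> U" "t [^] j = x" using root[OF q(2) x] by blast
  have tc: "t \<in> carrier R" using U_carrier[OF t(1)] .
  have tU: "t \<in> Units R" using tc U_nz[OF t(1)] by (simp add: Units_iff)
  note wt = wclass_closed[OF tU]
  have tk: "t [^] (j * k) \<in> comm_units R" using k(2) nat_pow_pow[OF tc, of j k] t(2) by simp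
  obtain m c where m: "0 < m" "m \<le> n" "c \<in> U" "c [^] (j * k * n) = \<one>"
    "wclass c = wclass t [^]\<^bsub>whitehead\<^esub> m"
    using torsion_power_central[OF d t(1) tk] by blast
  have "j > 0" using q(2) by (cases j) (auto simp: add_pow_def)
  then have "j * k * n > 0" using k(1) m by simp
  then obtain q' j' e' where q': "j * k * n = q' * j'" "[j'] \<cdot> \<one> \<notin> M" "q' = (if p = 0 then 1 else p ^ e')"
    using residue_char_decomposition[OF p] by metis
  have "(c [^] q') [^] j' = \<one>"
    using m(4) q'(1) nat_pow_pow[OF U_carrier[OF m(3)], of q' j'] by simp
  then have c1: "c [^] q' = \<one>"
    using U_torsion_trivial[OF U_pow[OF m(3)] q'(2)] by blast
  have cU: "c \<in> Units R" using U_carrier[OF m(3)] U_nz[OF m(3)] by (simp add: Units_iff)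
  have "wclass t [^]\<^bsub>whitehead\<^esub> (m * q') = \<one>\<^bsub>whitehead\<^esub>"
    using wclass_pow[OF cU, of q'] c1 m(5) Q.nat_pow_pow[OF wt, of m q'] group_hom.hom_one[OF wclass_hom]
    by (simp add: units_of_one)
  moreover have "m dvd fact n" using m(1,2) by (intro dvd_fact) auto
  then obtain b where "fact n = m * b" by blast
  ultimately have "wclass t [^]\<^bsub>whitehead\<^esub> (fact n * q') = \<one>\<^bsub>whitehead\<^esub>"
    using Q.nat_pow_pow[OF wt, of "m * q'" b] by (simp add: mult_ac)
  then have "wclass (t [^] (j * (q * q'))) = \<one>\<^bsub>whitehead\<^esub>"
    using wclass_pow[OF tU, of "j * (q * q')"] q(1) by (simp add: mult_ac)
  then have "t [^] (j * (q * q')) \<in> comm_units R"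
    using wclass_one_iff[of "t [^] (j * (q * q'))"] tU by (simp add: Units_pow_closed)
  then have "x [^] (q * q') \<in> comm_units R"
    using nat_pow_pow[OF tc, of j "q * q'"] t(2) by simp
  moreover have "q * q' = (if p = 0 then 1 else p ^ (e + e'))"
    using q(3) q'(3) by (simp add: power_add)
  ultimately show ?thesis by metis
qed

text \<open>Torsion elements of a nonabelian group need not form a subgroup; torsion modulo
  commutators does, as it is read off in the abelian quotient.\<close>

lemma U_torsion_subgroup: "subgroup (U \<inter> torsion_units R) (units_of R)"
proof -
  interpret Q: comm_group whitehead by (rule whitehead_comm_group)
  interpret G: group "units_of R" by (rule units_group)
  have T: "x \<in> torsion_units R \<longleftrightarrow> x \<in> Units R \<and> (\<exists>k>0. wclass x [^]\<^bsub>whitehead\<^esub> (k::nat) = \<one>\<^bsub>whitehead\<^esub>)" for x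
    by (auto simp: torsion_units_def Suc_le_eq power_in_comm_units_iff)
  show ?thesis
  proof (rule G.subgroupI)
    show "U \<inter> torsion_units R \<subseteq> carrier (units_of R)" by (auto simp: T units_of_carrier)
    have "wclass \<one> [^]\<^bsub>whitehead\<^esub> (1::nat) = \<one>\<^bsub>whitehead\<^esub>"
      using group_hom.hom_one[OF wclass_hom] by (simp add: units_of_one)
    then have "\<one> \<in> U \<inter> torsion_units R" unfolding Int_iff T by (intro conjI one_U Units_one_closed exI[of _ 1]) auto
    then show "U \<inter> torsion_units R \<noteq> {}" by blast
  next
    fix x assume x: "x \<in> U \<inter> torsion_units R"
    then obtain k where k: "x \<in> Units R" "k > 0" "wclass x [^]\<^bsub>whitehead\<^esub> (k::nat) = \<one>\<^bsub>whitehead\<^esub>" by (auto simp: T)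
    have "wclass (inv x) = inv\<^bsub>whitehead\<^esub> wclass x"
      using group_hom.hom_inv[OF wclass_hom, of x] k(1) by (simp add: units_of_carrier units_of_inv)
    then have "wclass (inv x) [^]\<^bsub>whitehead\<^esub> k = \<one>\<^bsub>whitehead\<^esub>"
      using k Q.nat_pow_inv[OF wclass_closed[OF k(1)]] by simp
    then show "inv\<^bsub>units_of R\<^esub> x \<in> U \<inter> torsion_units R"
      using x k U_inv by (auto simp: T units_of_inv)
  next
    fix x y assume x: "x \<in> U \<inter> torsion_units R" and y: "y \<in> U \<inter> torsion_units R"
    obtain k where k: "x \<in> Units R" "k > 0" "wclass x [^]\<^bsub>whitehead\<^esub> (k::nat) = \<one>\<^bsub>whitehead\<^esub>" using x by (auto simp: T)
    obtain l where l: "y \<in> Units R" "l > 0" "wclass y [^]\<^bsub>whitehead\<^esub> (l::nat) = \<one>\<^bsub>whitehead\<^esub>" using y by (auto simp: T)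
    note w = wclass_closed[OF k(1)] wclass_closed[OF l(1)]
    have "wclass (x \<otimes> y) [^]\<^bsub>whitehead\<^esub> (k * l)
        = (wclass x [^]\<^bsub>whitehead\<^esub> k) [^]\<^bsub>whitehead\<^esub> l \<otimes>\<^bsub>whitehead\<^esub> (wclass y [^]\<^bsub>whitehead\<^esub> l) [^]\<^bsub>whitehead\<^esub> k"
      unfolding wclass_mult[OF k(1) l(1)]
      using Q.nat_pow_distrib[OF w] Q.nat_pow_pow[OF w(1)] Q.nat_pow_pow[OF w(2)] by (simp add: mult.commute)
    also have "\<dots> = \<one>\<^bsub>whitehead\<^esub>" using k(3) l(3) by simp
    finally have "\<exists>j>0. wclass (x \<otimes> y) [^]\<^bsub>whitehead\<^esub> (j::nat) = \<one>\<^bsub>whitehead\<^esub>"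
      using k(2) l(2) by (intro exI[of _ "k * l"]) simp
    then show "x \<otimes>\<^bsub>units_of R\<^esub> y \<in> U \<inter> torsion_units R"
      using x y k(1) l(1) U_mult by (auto simp: T units_of_mult Units_m_closed)
  qed
qed

text \<open>The factor from \<open>comm_units R\<close> disappears in the quotient, so every class
  is represented by some \<open>u\<close> in \<open>U \<inter> torsion_units R\<close>, and its
  order divides a power of \<open>p\<close>.\<close>

lemma H_group_p_group:
  assumes p: "Factorial_Ring.prime (p::nat)" and pow: "\<And>x. x \<in> U \<inter> torsion_units R \<Longrightarrow> \<exists>e. x [^] (p ^ e :: nat) \<in> comm_units R"
  shows "p_group p (H_group R v)"
proof -
  interpret G: group "units_of R" by (rule units_group)
  let ?D = "comm_units R" and ?S = "U \<inter> torsion_units R"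
  let ?A = "?S <#>\<^bsub>units_of R\<^esub> ?D"
  have D: "subgroup ?D (units_of R)" using comm_units_normal by (rule normal_imp_subgroup)
  have A: "subgroup ?A (units_of R)"
    using G.mult_norm_subgroup[OF comm_units_normal U_torsion_subgroup]
      G.commut_normal[OF U_torsion_subgroup comm_units_normal] by simp
  have S: "\<one>\<^bsub>units_of R\<^esub> \<in> ?S" using subgroup.one_closed[OF U_torsion_subgroup] .
  have DA: "?D \<subseteq> ?A"
  proof
    fix d assume "d \<in> ?D"
    then have "d = \<one>\<^bsub>units_of R\<^esub> \<otimes>\<^bsub>units_of R\<^esub> d" using subgroup.mem_carrier[OF D] by simp
    then show "d \<in> ?A" using S \<open>d \<in> ?D\<close> unfolding set_mult_def by blast
  qed
  have nA: "?D \<lhd> (units_of R)\<lparr>carrier := ?A\<rparr>"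
    using G.normal_restrict_supergroup[OF A comm_units_normal DA] .
  have gH: "group (H_group R v)"
    unfolding H_group_def by (rule normal.factorgroup_is_group[OF nA])
  interpret H: group "H_group R v" by (rule gH)
  \<comment> \<open>The multiplication of cosets ignores the carrier, so powers may be computed in
    the full Whitehead group.\<close>
  have powH: "Y [^]\<^bsub>H_group R v\<^esub> (k::nat) = Y [^]\<^bsub>whitehead\<^esub> k" for Y k
    by (simp add: H_group_def whitehead_def nat_pow_def FactGroup_def set_mult_def)
  have "\<exists>n. H.ord Y = p ^ n" if Y: "Y \<in> carrier (H_group R v)" for Y
  proof -
    obtain a where a: "a \<in> ?A" "Y = wclass a"
      using Y by (auto simp: H_group_def FactGroup_def RCOSETS_def r_coset_def)
    obtain u d where u: "u \<in> ?S" "d \<in> ?D" "a = u \<otimes> d"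
      using a(1) by (auto simp: set_mult_def units_of_mult)
    have uU: "u \<in> Units R" "d \<in> Units R"
      using subgroup.mem_carrier[OF U_torsion_subgroup u(1)] subgroup.mem_carrier[OF D u(2)] by (auto simp: units_of_carrier)
    interpret Q: comm_group whitehead by (rule whitehead_comm_group)
    have Yu: "Y = wclass u"
      using a(2) u wclass_mult[OF uU] wclass_one_iff[OF uU(2)] wclass_closed[OF uU(1)] by simp
    obtain e where "u [^] (p ^ e) \<in> ?D" using pow[OF u(1)] by blast
    then have "wclass u [^]\<^bsub>whitehead\<^esub> (p ^ e) = \<one>\<^bsub>whitehead\<^esub>"
      using power_in_comm_units_iff[OF uU(1)] by blast
    then have "Y [^]\<^bsub>H_group R v\<^esub> (p ^ e) = \<one>\<^bsub>H_group R v\<^esub>"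
      unfolding powH Yu by (simp add: H_group_def whitehead_def FactGroup_def)
    then have "H.ord Y dvd p ^ e" using H.pow_eq_id[OF Y] by simp
    then show ?thesis using divides_primepow_nat[OF p] by blast
  qed
  then show ?thesis using gH by (simp add: p_group_def)
qed

end

theorem theorem1:
  fixes D :: "('a, 'b) ring_scheme"
    and K :: "'a set"
    and v :: "'a \<Rightarrow> 'g::linordered_ab_group_add"
    and w :: "'a \<Rightarrow> 'g divisible_hull"
  assumes "central_division_algebra K D"
    and "henselian (D\<lparr>carrier := K\<rparr>) v"
    and "extends_valuation (D\<lparr>carrier := K\<rparr>) v D id w"
    and "tame K D w"
  shows "one_plus_ideal D w \<inter> torsion_units D \<subseteq> comm_units D \<or>
    (\<exists>p. ring_char (residue_ring (D\<lparr>carrier := K\<rparr>) v) = p \<and> p > 0 \<and> p_group p (H_group D w))"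
proof -
  let ?K = "D\<lparr>carrier := K\<rparr>"
  have D: "division_ring D" and K: "ring_center D = K" and fin: "ring.finite_dimension D K (carrier D)"
    using assms(1) by (auto simp: central_division_algebra_def)
  interpret D: ring D using D by (simp add: division_ring_def)
  interpret D: skew_field D using D by unfold_locales
  interpret D: valued_division_ring D w
    using assms(3) by unfold_locales (simp add: extends_valuation_def)
  have fK: "field ?K" using D.center_field K by simp
  interpret K: field ?K by (rule fK)
  interpret K: skew_field ?K by (rule K.field_division_ring)
  interpret K: valued_division_ring ?K v
    using assms(2) by unfold_locales (simp add: henselian_def)
  have Kc: "K \<subseteq> carrier D" using K by (auto simp: ring_center_def)
  obtain n where n: "D.dimension n (ring_center D) (carrier D)"
    using fin K by (auto elim: D.finite_dimensionE')
  define p where "p = ring_char (residue_ring ?K v)"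
  have natK: "[j] \<cdot>\<^bsub>?K\<^esub> \<one>\<^bsub>?K\<^esub> = [j] \<cdot>\<^bsub>D\<^esub> \<one>\<^bsub>D\<^esub>" for j :: nat
    by (simp add: add_pow_def nat_pow_def)
  \<comment> \<open>The residue characteristic is read off from \<open>v\<close> on
    \<open>K\<close>, the argument runs with \<open>w\<close> on \<open>D\<close>; the two meet
    because \<open>M_K\<close> is the trace of \<open>M_D\<close> on \<open>K\<close>.\<close>
  have ideal_K: "z \<in> K.M \<longleftrightarrow> z \<in> D.M" if "z \<in> K" for z
  proof (cases "z = \<zero>\<^bsub>D\<^esub>")
    case False
    then have "w z = hull_of (v z)"
      using assms(3) that by (simp add: extends_valuation_def nonzeros_def)
    moreover have "0 = hull_of (0 :: 'g)" by transfer simp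
    ultimately have "0 < v z \<longleftrightarrow> 0 < w z"
      using hull_of_le_iff[of "v z" 0] by (simp add: not_le[symmetric])
    then show ?thesis using that Kc False by (auto simp: K.M_iff D.M_iff)
  qed (use that Kc in \<open>auto simp: K.M_iff D.M_iff\<close>)
  have p: "[j] \<cdot>\<^bsub>D\<^esub> \<one>\<^bsub>D\<^esub> \<in> D.M \<longleftrightarrow> p dvd j" for j
    using K.residue_char_dvd_iff[of j, unfolded natK] ideal_K[of "[j] \<cdot>\<^bsub>D\<^esub> \<one>\<^bsub>D\<^esub>"]
      K.V_carrier[OF K.natural_V[of j], unfolded natK]
    by (simp add: p_def)
  have root: "\<exists>t\<in>D.U. t [^]\<^bsub>D\<^esub> j = x" if j: "[j] \<cdot>\<^bsub>D\<^esub> \<one>\<^bsub>D\<^esub> \<notin> D.M" and x: "x \<in> D.U" for j :: nat and x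
  proof -
    have xc: "x \<in> carrier D" using D.U_carrier[OF x] .
    define L where "L = D.commutant (D.commutant {x})"
    let ?L = "D\<lparr>carrier := L\<rparr>"
    have fL: "field ?L" using D.double_commutant_field[OF xc] by (simp add: L_def)
    have Lc: "L \<subseteq> carrier D" using D.commutant_subset by (simp add: L_def)
    have sL: "subring L D" using D.commutant_subring D.commutant_subset by (simp add: L_def)
    have KL: "K \<subseteq> L" and xL: "x \<in> L"
      using D.double_commutant_incl[OF xc] K by (auto simp: L_def)
    interpret L: field ?L by (rule fL)
    have "finite_field_extension ?K ?L id"
      using D.double_commutant_finite_dimension[OF xc] fin K KL sL fL Kc
      by (intro finite_field_extension_subfield[OF D.ring_axioms fK]) (auto simp: L_def ring_hom_def)
    \<comment> \<open>The restriction of \<open>w\<close> itself extends \<open>v\<close> to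
      \<open>L\<close>, so the one-units of \<open>L\<close> are exactly those of \<open>D\<close>
      lying in \<open>L\<close>, and a root found there is a one-unit of \<open>D\<close>.\<close>
    moreover have wL: "extends_valuation ?K v ?L id w"
    proof -
      have "valuation_on ?L w"
        unfolding valuation_on_def nonzeros_def
        using D.v_mult[OF subsetD[OF Lc] subsetD[OF Lc]] D.v_add[OF subsetD[OF Lc] subsetD[OF Lc]] by simp
      then show ?thesis using assms(3) by (simp add: extends_valuation_def)
    qed
    moreover have ideal_L: "z \<in> val_ideal ?L w \<longleftrightarrow> z \<in> D.M" if "z \<in> L" for z
      using that Lc by (auto simp: val_ideal_def nonzeros_def)
    have natL: "[j] \<cdot>\<^bsub>?L\<^esub> \<one>\<^bsub>?L\<^esub> = [j] \<cdot>\<^bsub>D\<^esub> \<one>\<^bsub>D\<^esub>"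
      by (simp add: add_pow_def nat_pow_def)
    have "[j] \<cdot>\<^bsub>?L\<^esub> \<one>\<^bsub>?L\<^esub> \<in> L" using L.add.nat_pow_closed[of "\<one>\<^bsub>?L\<^esub>" j] subringE(3)[OF sL] by (simp add: add_pow_def)
    then have "[j] \<cdot>\<^bsub>?L\<^esub> \<one>\<^bsub>?L\<^esub> \<notin> val_ideal ?L w" using ideal_L j natL by simp
    moreover have UL: "z \<in> one_plus_ideal ?L w \<longleftrightarrow> z \<in> D.U" if z: "z \<in> L" for z
    proof -
      interpret L: skew_field ?L by (rule L.field_division_ring)
      interpret L: valued_division_ring ?L w
        using wL by unfold_locales (simp add: extends_valuation_def)
      have "z \<ominus>\<^bsub>?L\<^esub> \<one>\<^bsub>?L\<^esub> = z \<ominus>\<^bsub>D\<^esub> \<one>\<^bsub>D\<^esub>"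
        using D.minus_consistent[OF sL z subringE(3)[OF sL]] by simp
      moreover have "z \<ominus>\<^bsub>?L\<^esub> \<one>\<^bsub>?L\<^esub> \<in> L" using L.minus_closed[of z "\<one>\<^bsub>?L\<^esub>"] z subringE(3)[OF sL] by simp
      ultimately show ?thesis using ideal_L z Lc by (auto simp: L.U_iff D.U_iff)
    qed
    ultimately obtain t where t: "t \<in> one_plus_ideal ?L w" "t [^]\<^bsub>?L\<^esub> j = x"
      using henselian_root[OF fK assms(2)] x xL by metis
    have "t \<in> L" using t(1) L.a_closed subringE(3)[OF sL] by (auto simp: one_plus_ideal_def val_ideal_def nonzeros_def)
    then show ?thesis using t UL by (auto simp: nat_pow_def)
  qed
  have pow: "\<exists>e. x [^]\<^bsub>D\<^esub> (if p = 0 then 1 else p ^ e) \<in> comm_units D"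
    if "x \<in> D.U \<inter> torsion_units D" for x
    using D.torsion_power_in_derived[OF n p root, of x] that by (auto simp: torsion_units_def Suc_le_eq)
  show ?thesis
  proof (cases "p = 0")
    case True
    \<comment> \<open>For \<open>p = 0\<close> the exponent is one.\<close>
    have "x \<in> comm_units D" if "x \<in> D.U \<inter> torsion_units D" for x
      using pow[OF that] that True D.U_carrier by auto
    then show ?thesis by blast
  next
    case False
    then have "p_group p (H_group D w)"
      using pow D.residue_char_prime[OF p] by (intro D.H_group_p_group) auto
    then show ?thesis using False p_def by auto
  qed
qed

end
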